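(* Let $n\ge 1$ and $M\ge 2$ be integers, $[M]=\{1,\dots,M\}$, and let $\mathcal{G}$ be a $d$-regular hypergraph on $[M]$ with $d\ge 1$. Let $\{p_{s}: s\in\mathcal{G}\}$ and $r$ be real numbers in $(1,\infty)$ such that $$\sum_{s\in\mathcal{G}}\frac{1}{p_{s}}=|\mathcal{G}|-\frac{d}{r'},$$ and suppose in addition that $r\ge 2$ and $p_{s}\in[1,2]$ for each $s\in\mathcal{G}$. Let $f_{j}$, $j\in[M]$, be probability density functions on $\mathbb{R}^n$. Then $$\Big\|\star_{j\in[M]}f_{j}\Big\|_{r}\le\frac{1}{C_{r}^{n}}\prod_{s\in\mathcal{G}}\Big[C_{p_{s}}^{n}\Big\|\star_{j\in s}f_{j}\Big\|_{p_{s}}\Big]^{1/d}.$$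
   Context: A hypergraph $\mathcal{G}$ on $[M]$ is a collection of (nonempty) subsets of $[M]$, called hyperedges. It is $d$-regular if each $i\in[M]$ belongs to exactly $d$ members of $\mathcal{G}$. For $p\in(0,\infty]$, $p'$ is defined by $\frac1p+\frac1{p'}=1$, and $C_{p}>0$ is defined by $C_{p}^{2}=\dfrac{p^{1/p}}{|p'|^{1/p'}}$. $\star_{j\in s}f_j$ denotes the convolution of the functions $f_j$, $j\in s$ (equal to $f_j$ if $s=\{j\}$). $\|f\|_p=\big(\int_{\mathbb{R}^n}|f|^p\,dx\big)^{1/p}\in[0,\infty]$ is the $L^p$-norm with respect to Lebesgue measure on $\mathbb{R}^n$; the right side may be $+\infty$. *)

theory Defs
  imports "HOL-Analysis.Analysis"
begin

text \<open>Hypergraphs on \<open>[M]\<close> are sets (without repetition) of nonempty subsets of \<open>{1..M}\<close>.\<close>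

definition hypergraph_on :: "nat \<Rightarrow> nat set set \<Rightarrow> bool" where
  "hypergraph_on M G \<longleftrightarrow> (\<forall>s\<in>G. s \<noteq> {} \<and> s \<subseteq> {1..M})"

definition regular_hypergraph :: "nat \<Rightarrow> nat \<Rightarrow> nat set set \<Rightarrow> bool" where
  "regular_hypergraph M d G \<longleftrightarrow>
     hypergraph_on M G \<and> (\<forall>i\<in>{1..M}. card {s \<in> G. i \<in> s} = d)"

text \<open>The solution \<open>p'\<close> of \<open>1/p + 1/p' = 1\<close>, for real \<open>p \<noteq> 0, 1\<close>. It is negative for
  \<open>0 < p < 1\<close>, hence the absolute value in \<open>young_const\<close>. The value at \<open>p = 1\<close>, where \<open>p'\<close>
  would be infinite, has no meaning here.\<close>

definition conj_exp :: "real \<Rightarrow> real" where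
  "conj_exp p = p / (p - 1)"

lemma conj_exp_eq: "p \<noteq> 0 \<Longrightarrow> p \<noteq> 1 \<Longrightarrow> 1 / p + 1 / conj_exp p = 1"
  by (simp add: conj_exp_def field_simps)

definition young_const :: "real \<Rightarrow> real" where
  "young_const p = sqrt (p powr (1 / p) / \<bar>conj_exp p\<bar> powr (1 / conj_exp p))"

lemma young_const_pos: "0 < p \<Longrightarrow> p \<noteq> 1 \<Longrightarrow> 0 < young_const p"
  by (simp add: young_const_def conj_exp_def)

text \<open>Powers of extended nonnegative reals with exponent \<open>a > 0\<close>, with \<open>\<infinity>\<^sup>a = \<infinity>\<close>.\<close>

definition ennpowr :: "ennreal \<Rightarrow> real \<Rightarrow> ennreal" where
  "ennpowr x a = (if x = \<infinity> then \<infinity> else ennreal (enn2real x powr a))"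

definition Lp_norm :: "real \<Rightarrow> ('a::euclidean_space \<Rightarrow> ennreal) \<Rightarrow> ennreal" where
  "Lp_norm p f = ennpowr (\<integral>\<^sup>+ x. ennpowr (f x) p \<partial>lebesgue) (1 / p)"

definition prob_density :: "('a::euclidean_space \<Rightarrow> real) \<Rightarrow> bool" where
  "prob_density f \<longleftrightarrow>
     f \<in> borel_measurable lebesgue \<and> (\<forall>x. 0 \<le> f x) \<and> (\<integral>\<^sup>+ x. ennreal (f x) \<partial>lebesgue) = 1"

text \<open>Convolutions of densities can be infinite on a null set; taking \<open>[0, \<infinity>]\<close> as the range
  gives them a value at every point.\<close>

definition conv :: "('a::euclidean_space \<Rightarrow> ennreal) \<Rightarrow> ('a \<Rightarrow> ennreal) \<Rightarrow> 'a \<Rightarrow> ennreal" where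
  "conv f g = (\<lambda>x. \<integral>\<^sup>+ y. f (x - y) * g y \<partial>lebesgue)"

text \<open>The convolution has no unit among functions, so \<open>[]\<close> (which never occurs for the nonempty
  index sets of interest) receives a dummy value, and \<open>[f]\<close> is treated separately.\<close>

fun conv_list :: "('a::euclidean_space \<Rightarrow> ennreal) list \<Rightarrow> 'a \<Rightarrow> ennreal" where
  "conv_list [] = (\<lambda>_. 0)"
| "conv_list [f] = f"
| "conv_list (f # g # fs) = conv f (conv_list (g # fs))"

text \<open>On measurable functions \<open>conv\<close> is commutative and associative at every point (by Tonelli),
  so that arranging the indices in increasing order is immaterial.\<close>

definition conv_over :: "nat set \<Rightarrow> (nat \<Rightarrow> 'a::euclidean_space \<Rightarrow> real) \<Rightarrow> 'a \<Rightarrow> ennreal" where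
  "conv_over s f = conv_list (map (\<lambda>j x. ennreal (f j x)) (sorted_list_of_set s))"

end

(* The convolution of all f_j has Fourier transform h^ = PROD_j f_j^, and by d-regularity |h^|^d is the
   product over s in G of the transforms of the convolutions over s.  Hoelder's inequality (the
   scaling relation makes the exponents match) bounds ||h^||_{r'} by the norms ||.||_{p_s'} of these
   transforms, and the sharp Hausdorff-Young inequality of Babenko and Beckner is applied twice: to
   each s, and, by duality and a Gaussian-regularised Parseval identity, to pass from ||h^||_{r'}
   back to ||h||_r (where 1 / C_r = C_{r'} appears).

   Sharp Hausdorff-Young for nonnegative f is proved by a heat flow.  In Gaussian form it is Beckner's
   hypercontractive estimate at the imaginary point i omega, omega^2 = p - 1.  For a compactly
   supported measure M put
     H(s, x, w) = INT exp (cos s a.w + i omega sin s a.x + sin^2 s (p/2) |a|^2) dM(a)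
   and let Psi(s) be the integral over Gaussian x of (INT |H|^p over Gaussian w) to the power
   p'/p.  Psi(0) contains the L^p norm, Psi(pi/2) the L^{p'} norm of the transform.  Differentiating in
   s, Gaussian integration by parts in x and w and Cauchy-Schwarz reduce Psi' <= 0 to a pointwise
   inequality between second-order terms.  Since |H|^p need not be smooth, |H|^2 is replaced by
   |H|^2 + epsilon^2, which only helps.  A scaling limit removes the Gaussian weights. *)

theory Submission
  imports Defs "HOL-Probability.Probability"
begin

section \<open>Differentiation under the integral and Gaussian integrals\<close>

text \<open>The exponent of \<open>H\<close> comes from Hermite normalisation. The Hermite
  generating function at z is exp (z a.w - z^2 |a|^2 / 2), and Beckner's operator replaces z = 1 by
  z = i \<omega>. Along the rotation cos s a.w + i \<omega> sin s a.x the normalising term is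
  -(cos^2 s - (p - 1) sin^2 s) |a|^2 / 2 = -|a|^2 / 2 + sin^2 s (p / 2) |a|^2. The part free of s is
  absorbed into M, which leaves the p / 2. The variable x enters only through a phase. For bounded
  support all integrands therefore stay below K exp (C |w|), uniformly in s and x, and the Gaussian
  weight justifies every differentiation and every integration by parts. The constant survives the
  removal of the weights because dilation changes both sides by the same power: the bound is the
  same number at every scale. In the dual half the test functions must be continuous, since the
  regularised Parseval identity sees g only through its Gaussian averages.\<close>

lemma has_vector_derivative_iff_quotient:
  "(f has_vector_derivative d) (at t) \<longleftrightarrow> ((\<lambda>h. (1 / h) *\<^sub>R (f (t + h) - f t)) \<longlongrightarrow> d) (at 0)"
proof -
  let ?q = "\<lambda>h. (1 / h) *\<^sub>R (f (t + h) - f t)"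
  have "(f has_vector_derivative d) (at t) \<longleftrightarrow> ((\<lambda>h. norm (f (t + h) - f t - h *\<^sub>R d) / norm h) \<longlongrightarrow> 0) (at 0)"
    unfolding has_vector_derivative_def has_derivative_at by (simp add: bounded_linear_scaleR_left)
  also have "\<dots> \<longleftrightarrow> ((\<lambda>h. norm (?q h - d)) \<longlongrightarrow> 0) (at 0)"
  proof (rule filterlim_cong[OF refl refl], unfold eventually_at_filter, rule always_eventually, intro allI impI)
    fix h :: real assume "h \<noteq> 0"
    then have "?q h - d = (1 / h) *\<^sub>R (f (t + h) - f t - h *\<^sub>R d)" by (simp add: scaleR_diff_right)
    then show "norm (f (t + h) - f t - h *\<^sub>R d) / norm h = norm (?q h - d)" by (simp add: divide_inverse_commute)
  qed
  finally show ?thesis by (simp only: tendsto_norm_zero_iff LIM_zero_iff)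
qed

text \<open>By the mean value inequality the difference quotients are dominated by \<open>g\<close>,
  so dominated convergence applies along every sequence tending to 0; measurability of
  \<open>f' t0\<close> comes from the same limit. The derivative is asked for at every point but its
  bound only almost everywhere, because the support of the measure in the flow is known only up to
  null sets.\<close>

lemma has_vector_derivative_integral:
  fixes f f' :: "real \<Rightarrow> 'b \<Rightarrow> 'c::euclidean_space"
  assumes "0 < \<delta>"
    and int: "\<And>t. \<bar>t - t0\<bar> < \<delta> \<Longrightarrow> integrable M (f t)"
    and der: "\<And>t x. \<bar>t - t0\<bar> < \<delta> \<Longrightarrow> x \<in> space M \<Longrightarrow>
      ((\<lambda>t. f t x) has_vector_derivative f' t x) (at t)"
    and bound: "AE x in M. \<forall>t. \<bar>t - t0\<bar> < \<delta> \<longrightarrow> norm (f' t x) \<le> g x"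
    and g: "integrable M g"
  shows "((\<lambda>t. integral\<^sup>L M (f t)) has_vector_derivative integral\<^sup>L M (f' t0)) (at t0)"
    and "integrable M (f' t0)"
proof -
  define q where "q h x = (1 / h) *\<^sub>R (f (t0 + h) x - f t0 x)" for h x
  have lim: "((\<lambda>h. q h x) \<longlongrightarrow> f' t0 x) (at 0)" if "x \<in> space M" for x
    using der[of t0 x] that \<open>0 < \<delta>\<close> by (simp add: q_def has_vector_derivative_iff_quotient)
  have q_bound: "AE x in M. \<forall>h\<in>{-\<delta><..<\<delta>} - {0}. norm (q h x) \<le> g x"
    using bound AE_space
  proof eventually_elim
    case (elim x)
    show ?case
    proof
      fix h assume h: "h \<in> {-\<delta><..<\<delta>} - {0}"
      have "norm (f (t0 + h) x - f t0 x) \<le> g x * norm (t0 + h - t0)"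
      proof (rule differentiable_bound)
        show "convex {t0 - \<delta><..<t0 + \<delta>}" by simp
        fix t assume "t \<in> {t0 - \<delta><..<t0 + \<delta>}"
        then have t: "\<bar>t - t0\<bar> < \<delta>" by auto
        show "((\<lambda>t. f t x) has_derivative (\<lambda>s. s *\<^sub>R f' t x)) (at t within {t0 - \<delta><..<t0 + \<delta>})"
          using der[OF t elim(2)] by (auto simp: has_vector_derivative_def intro: has_derivative_at_withinI)
        have "norm (f' t x) \<le> g x" using elim(1) t by auto
        then show "onorm (\<lambda>s::real. s *\<^sub>R f' t x) \<le> g x"
          by (intro onorm_bound) (auto simp: mult.commute mult_left_mono intro: order_trans[OF norm_ge_zero])
      qed (use h \<open>0 < \<delta>\<close> in auto)
      then show "norm (q h x) \<le> g x"
        using h by (simp add: q_def scaleR_diff_right[symmetric] pos_divide_le_eq abs_divide[symmetric] mult.commute)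
    qed
  qed
  have int_q: "integrable M (q h)" if "h \<in> {-\<delta><..<\<delta>}" for h
  proof -
    have "\<bar>h\<bar> < \<delta>" using that by auto
    then have "integrable M (f (t0 + h))" "integrable M (f t0)"
      using int[of "t0 + h"] int[of t0] \<open>0 < \<delta>\<close> by auto
    then show ?thesis unfolding q_def by (intro integrable_scaleR_right Bochner_Integration.integrable_diff)
  qed
  have seq: "integrable M (f' t0) \<and> (\<lambda>i. integral\<^sup>L M (q (X i))) \<longlonglongrightarrow> integral\<^sup>L M (f' t0)"
    if X: "\<forall>i. X i \<in> {-\<delta><..<\<delta>} - {0}" "X \<longlonglongrightarrow> 0" for X
  proof -
    have limX: "(\<lambda>i. q (X i) x) \<longlonglongrightarrow> f' t0 x" if "x \<in> space M" for x
      using lim[OF that] X unfolding tendsto_at_iff_sequentially comp_def by auto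
    have meas: "f' t0 \<in> borel_measurable M"
      by (rule borel_measurable_LIMSEQ_metric[OF _ limX]) (use int_q X in auto)
    show ?thesis
      using X limX q_bound int_q g meas
      by (intro conjI integrable_dominated_convergence[where s="\<lambda>i. q (X i)" and w=g]
          integral_dominated_convergence[where w=g]) auto
  qed
  have "((\<lambda>h. integral\<^sup>L M (q h)) \<longlongrightarrow> integral\<^sup>L M (f' t0)) (at 0 within {-\<delta><..<\<delta>})"
    unfolding tendsto_at_iff_sequentially comp_def using seq by auto
  then have "((\<lambda>h. integral\<^sup>L M (q h)) \<longlongrightarrow> integral\<^sup>L M (f' t0)) (at 0)"
    using \<open>0 < \<delta>\<close> by (subst (asm) at_within_open) auto
  also have "?this \<longleftrightarrow> ((\<lambda>h. (1 / h) *\<^sub>R (integral\<^sup>L M (f (t0 + h)) - integral\<^sup>L M (f t0))) \<longlongrightarrow> integral\<^sup>L M (f' t0)) (at 0)"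
  proof (rule filterlim_cong[OF refl refl], unfold eventually_at, rule exI[of _ \<delta>], intro conjI ballI impI)
    fix h :: real assume "h \<noteq> 0 \<and> dist h 0 < \<delta>"
    then show "integral\<^sup>L M (q h) = (1 / h) *\<^sub>R (integral\<^sup>L M (f (t0 + h)) - integral\<^sup>L M (f t0))"
      using int[of "t0 + h"] int[of t0] \<open>0 < \<delta>\<close> unfolding q_def
      by (subst integral_scaleR_right) (auto simp: Bochner_Integration.integral_diff)
  qed fact
  finally show "((\<lambda>t. integral\<^sup>L M (f t)) has_vector_derivative integral\<^sup>L M (f' t0)) (at t0)"
    unfolding has_vector_derivative_iff_quotient .
  \<comment> \<open>Any single admissible sequence yields integrability of the limit. The shift by 2
    keeps every term strictly below \<delta>.\<close>
  obtain X where "\<forall>i. X i \<in> {-\<delta><..<\<delta>} - {0}" "X \<longlonglongrightarrow> 0"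
  proof (rule that[of "\<lambda>i. \<delta> / real (i + 2)"])
    show "\<forall>i. \<delta> / real (i + 2) \<in> {-\<delta><..<\<delta>} - {0}"
    proof
      fix i
      have "0 < \<delta> / real (i + 2)" using \<open>0 < \<delta>\<close> by simp
      moreover have "\<delta> / real (i + 2) < \<delta> / 1"
        using \<open>0 < \<delta>\<close> by (intro divide_strict_left_mono) auto
      ultimately show "\<delta> / real (i + 2) \<in> {-\<delta><..<\<delta>} - {0}"
        using \<open>0 < \<delta>\<close> by (simp only: Diff_iff greaterThanLessThan_iff singleton_iff) linarith
    qed
    show "(\<lambda>i. \<delta> / real (i + 2)) \<longlonglongrightarrow> 0" 
      by (intro real_tendsto_divide_at_top[OF tendsto_const] filterlim_compose[OF filterlim_real_sequentially filterlim_add_const_nat_at_top])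
  qed
  then show "integrable M (f' t0)" using seq by blast
qed

section \<open>Affine substitutions and product integrals\<close>

lemma nn_integral_lborel_affine:
  fixes f :: "'a::euclidean_space \<Rightarrow> ennreal"
  assumes [measurable]: "f \<in> borel_measurable borel" and "c \<noteq> 0"
  shows "(\<integral>\<^sup>+x. f x \<partial>lborel) = ennreal (\<bar>c\<bar> ^ DIM('a)) * (\<integral>\<^sup>+x. f (t + c *\<^sub>R x) \<partial>lborel)"
  by (subst lborel_affine[OF \<open>c \<noteq> 0\<close>, of t])
    (simp add: nn_integral_density nn_integral_distr nn_integral_cmult)

lemma nn_integral_lborel_minus:
  fixes f :: "'a::euclidean_space \<Rightarrow> ennreal"
  assumes "f \<in> borel_measurable borel"
  shows "(\<integral>\<^sup>+y. f (x - y) \<partial>lborel) = (\<integral>\<^sup>+y. f y \<partial>lborel)"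
  using nn_integral_lborel_affine[OF assms, of "-1" x] by simp

lemma
  fixes f :: "'a::euclidean_space \<Rightarrow> 'b::{banach, second_countable_topology}"
  assumes [measurable]: "f \<in> borel_measurable borel" and "c \<noteq> 0"
  shows integrable_lborel_affine_iff:
      "integrable lborel (\<lambda>x. f (t + c *\<^sub>R x)) \<longleftrightarrow> integrable lborel f"
    and integral_lborel_affine:
      "(LBINT x. f x) = (\<bar>c\<bar> ^ DIM('a)) *\<^sub>R (LBINT x. f (t + c *\<^sub>R x))"
proof -
  have "integrable lborel f \<longleftrightarrow> integrable lborel (\<lambda>x. \<bar>c\<bar> ^ DIM('a) *\<^sub>R f (t + c *\<^sub>R x))"
    by (subst lborel_affine[OF \<open>c \<noteq> 0\<close>, of t]) (simp add: integrable_density integrable_distr_eq)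
  then show "integrable lborel (\<lambda>x. f (t + c *\<^sub>R x)) \<longleftrightarrow> integrable lborel f"
    using \<open>c \<noteq> 0\<close> integrable_scaleR_right[of "1 / \<bar>c\<bar> ^ DIM('a)" lborel "\<lambda>x. \<bar>c\<bar> ^ DIM('a) *\<^sub>R f (t + c *\<^sub>R x)"]
    by auto
  show "(LBINT x. f x) = (\<bar>c\<bar> ^ DIM('a)) *\<^sub>R (LBINT x. f (t + c *\<^sub>R x))"
    by (subst lborel_affine[OF \<open>c \<noteq> 0\<close>, of t])
      (simp add: integral_density integral_distr integral_scaleR_right)
qed

lemma
  fixes f :: "'a::euclidean_space \<Rightarrow> real \<Rightarrow> 'b::{real_normed_field, banach, second_countable_topology}"
  assumes int: "\<And>b. b \<in> Basis \<Longrightarrow> integrable lborel (f b)"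
  shows integrable_lborel_prod: "integrable lborel (\<lambda>x. \<Prod>b\<in>Basis. f b (x \<bullet> b))"
    and integral_lborel_prod:
      "(LBINT x. (\<Prod>b\<in>Basis. f b (x \<bullet> b))) = (\<Prod>b\<in>Basis. \<integral>t. f b t \<partial>lborel)"
proof -
  interpret product_sigma_finite "\<lambda>_::'a. lborel :: real measure" ..
  have [measurable]: "\<And>b. b \<in> Basis \<Longrightarrow> f b \<in> borel_measurable borel"
    using borel_measurable_integrable[OF int] by simp
  have [measurable]: "(\<lambda>x. \<Prod>b\<in>Basis. f b (x \<bullet> b)) \<in> borel_measurable borel"
    by (intro borel_measurable_prod measurable_compose[OF _ \<open>\<And>b. b \<in> Basis \<Longrightarrow> f b \<in> borel_measurable borel\<close>]) auto
  have eq: "(\<Prod>b\<in>Basis. f b ((\<Sum>b\<in>Basis. x b *\<^sub>R b) \<bullet> b)) = (\<Prod>b\<in>Basis. f b (x b))" for x :: "'a \<Rightarrow> real"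
    by simp
  show "integrable lborel (\<lambda>x. \<Prod>b\<in>Basis. f b (x \<bullet> b))"
    by (subst lborel_eq, subst integrable_distr_eq)
      (auto intro!: product_integrable_prod int simp: eq)
  show "(LBINT x. (\<Prod>b\<in>Basis. f b (x \<bullet> b))) = (\<Prod>b\<in>Basis. \<integral>t. f b t \<partial>lborel)"
    by (subst lborel_eq, subst integral_distr)
      (auto simp: product_integral_prod int)
qed

section \<open>Gaussian integrals and Gaussian integration by parts\<close>

definition gauss :: "'a::euclidean_space \<Rightarrow> real"
  where "gauss x = exp (- (x \<bullet> x) / 2)"

lemma gauss_measurable [measurable]: "gauss \<in> borel_measurable borel"
  unfolding gauss_def[abs_def] by measurable

lemma gauss_pos [simp]: "0 < gauss x" "0 \<le> gauss x"
  by (simp_all add: gauss_def)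

text \<open>Up to the factor sqrt (2 pi) this is the characteristic function of the standard normal
  distribution; the Euclidean case follows coordinate by coordinate.\<close>

lemma
  shows integrable_gauss_real_iexp: "integrable lborel (\<lambda>x::real. iexp (t * x) * of_real (exp (- x\<^sup>2 / 2)))"
    and integral_gauss_real_iexp:
      "(LBINT x. iexp (t * x) * of_real (exp (- x\<^sup>2 / 2))) = of_real (sqrt (2 * pi) * exp (- t\<^sup>2 / 2))"
proof -
  have eq: "std_normal_density x *\<^sub>R iexp (t * x) =
      of_real (1 / sqrt (2 * pi)) * (iexp (t * x) * of_real (exp (- x\<^sup>2 / 2)))" for x
    unfolding std_normal_density_def by (simp add: scaleR_conv_of_real)
  have "integrable lborel (\<lambda>x. sqrt (2 * pi) * std_normal_density x)"
    by (intro integrable_mult_right integrable_normal_density) simp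
  then show "integrable lborel (\<lambda>x::real. iexp (t * x) * of_real (exp (- x\<^sup>2 / 2)))"
    by (rule Bochner_Integration.integrable_bound) (auto simp: norm_mult std_normal_density_def)
  have "(LBINT x. std_normal_density x *\<^sub>R iexp (t * x)) = char std_normal_distribution t"
    unfolding char_def by (subst integral_density) auto
  also have "\<dots> = of_real (exp (- t\<^sup>2 / 2))" by (simp add: char_std_normal_distribution)
  finally show "(LBINT x. iexp (t * x) * of_real (exp (- x\<^sup>2 / 2))) = of_real (sqrt (2 * pi) * exp (- t\<^sup>2 / 2))"
    unfolding eq by (simp add: field_simps)
qed

lemma
  fixes \<xi> :: "'a::euclidean_space"
  shows integrable_gauss_iexp: "integrable lborel (\<lambda>x. iexp (\<xi> \<bullet> x) * of_real (gauss x))"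
    and integral_gauss_iexp: "(LBINT x. iexp (\<xi> \<bullet> x) * of_real (gauss x))
      = of_real (sqrt (2 * pi) ^ DIM('a) * gauss \<xi>)"
proof -
  have gauss: "gauss x = (\<Prod>b\<in>Basis. exp (- (x \<bullet> b)\<^sup>2 / 2))" for x :: 'a
    by (subst exp_sum[symmetric])
      (simp_all add: gauss_def euclidean_inner[of x x] power2_eq_square sum_negf sum_divide_distrib)
  have eq: "iexp (\<xi> \<bullet> x) * of_real (gauss x) =
      (\<Prod>b\<in>Basis. iexp ((\<xi> \<bullet> b) * (x \<bullet> b)) * of_real (exp (- (x \<bullet> b)\<^sup>2 / 2)))" for x :: 'a
    unfolding prod.distrib gauss of_real_prod
    by (subst exp_sum[symmetric]) (simp_all add: euclidean_inner[of \<xi> x] sum_distrib_left)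
  show "integrable lborel (\<lambda>x. iexp (\<xi> \<bullet> x) * of_real (gauss x))"
    unfolding eq by (rule integrable_lborel_prod) (rule integrable_gauss_real_iexp)
  show "(LBINT x. iexp (\<xi> \<bullet> x) * of_real (gauss x)) = of_real (sqrt (2 * pi) ^ DIM('a) * gauss \<xi>)"
    unfolding eq
    by (subst integral_lborel_prod[OF integrable_gauss_real_iexp])
      (simp only: integral_gauss_real_iexp prod.distrib gauss of_real_prod[symmetric] prod_constant)
qed

lemma
  shows integrable_gauss: "integrable lborel (gauss :: 'a::euclidean_space \<Rightarrow> real)"
    and integral_gauss: "(LBINT x. gauss (x::'a)) = sqrt (2 * pi) ^ DIM('a)"
proof -
  have g: "(\<lambda>x::'a. iexp (0 \<bullet> x) * of_real (gauss x)) = (\<lambda>x. complex_of_real (gauss x))" by simp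
  show "integrable lborel (gauss :: 'a \<Rightarrow> real)"
    using integrable_gauss_iexp[of "0::'a"] unfolding g complex_of_real_integrable_eq .
  show "(LBINT x. gauss (x::'a)) = sqrt (2 * pi) ^ DIM('a)"
    using integral_gauss_iexp[of "0::'a"] unfolding g integral_complex_of_real of_real_eq_iff
    by (simp add: gauss_def[of 0])
qed

text \<open>Half of the Gaussian exponent pays for the exponential: C t - t^2 / 2 \<le> C^2 - t^2 /
  4 is the statement (C - t / 2)^2 \<ge> 0, and what remains is a dilated Gaussian.\<close>

lemma integrable_exp_norm_gauss:
  "integrable lborel (\<lambda>x::'a::euclidean_space. exp (C * norm x) * gauss x)"
proof (rule Bochner_Integration.integrable_bound)
  have "integrable lborel (\<lambda>x::'a. gauss (0 + (1 / sqrt 2) *\<^sub>R x))"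
    by (subst integrable_lborel_affine_iff) (auto simp: integrable_gauss)
  then show "integrable lborel (\<lambda>x::'a. exp (C\<^sup>2) * gauss ((1 / sqrt 2) *\<^sub>R x))" by simp
  have "C * norm x - (x \<bullet> x) / 2 \<le> C\<^sup>2 - (x \<bullet> x) / 4" for x :: 'a
    using zero_le_power2[of "C - norm x / 2"] by (simp add: power2_eq_square algebra_simps dot_square_norm)
  then show "AE x in lborel. norm (exp (C * norm x) * gauss x) \<le> norm (exp (C\<^sup>2) * gauss ((1 / sqrt 2) *\<^sub>R x :: 'a))"
    by (auto simp: gauss_def exp_add[symmetric] abs_mult)
qed auto

lemma has_vector_derivative_line_shift:
  fixes \<phi> :: "'a::real_normed_vector \<Rightarrow> real"
  assumes "((\<lambda>s. \<phi> ((x + t *\<^sub>R e) + s *\<^sub>R e)) has_vector_derivative d) (at 0)"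
  shows "((\<lambda>t. \<phi> (x + t *\<^sub>R e)) has_vector_derivative d) (at t)"
proof -
  have "((\<lambda>s. \<phi> (x + (s + t) *\<^sub>R e)) has_field_derivative d) (at 0)"
    using assms by (simp add: has_real_derivative_iff_has_vector_derivative algebra_simps)
  then have "((\<lambda>s. \<phi> (x + s *\<^sub>R e)) has_field_derivative d) (at (0 + t))"
    by (subst DERIV_shift)
  then show ?thesis by (simp add: has_real_derivative_iff_has_vector_derivative)
qed

text \<open>Gaussian integration by parts without boundary terms: the integral of \<phi> times the
  Gaussian over the translated variable x + t e does not depend on t, so the integral of its
  t-derivative at 0 vanishes. The growth bounds supply the domination.\<close>

lemma integral_gauss_inner_eq:
  fixes \<phi> \<phi>' :: "'a::euclidean_space \<Rightarrow> real"
  assumes e: "norm e = 1"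
    and [measurable]: "\<phi> \<in> borel_measurable borel" "\<phi>' \<in> borel_measurable borel"
    and der: "\<And>x. ((\<lambda>t. \<phi> (x + t *\<^sub>R e)) has_vector_derivative \<phi>' x) (at 0)"
    and "\<And>x. \<bar>\<phi> x\<bar> \<le> K * exp (C * norm x)" "\<And>x. \<bar>\<phi>' x\<bar> \<le> K * exp (C * norm x)"
    and "0 \<le> C"
  shows "(LBINT x. (x \<bullet> e) * \<phi> x * gauss x) = (LBINT x. \<phi>' x * gauss x)"
proof -
  have K: "0 \<le> K"
    using order_trans[OF abs_ge_zero assms(5)[of 0]] by simp
  define F where "F t x = \<phi> (x + t *\<^sub>R e) * gauss (x + t *\<^sub>R e)" for t x
  define F' where "F' t x = (\<phi>' (x + t *\<^sub>R e) - ((x + t *\<^sub>R e) \<bullet> e) * \<phi> (x + t *\<^sub>R e)) * gauss (x + t *\<^sub>R e)" for t x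
  \<comment> \<open>Envelope for |t| < 1. The exponent C + 2 consists of C for the growth of \<phi>
    and \<open>\<phi>'\<close>, 1 for the linear factor |(x + t e).e| \<le> exp |x|, and 1 for
    comparing the shifted Gaussian with the centred one.\<close>
  define g where "g x = 2 * K * exp (C + 1) * (exp ((C + 2) * norm x) * gauss x)" for x :: 'a
  have int_C: "integrable lborel (\<lambda>x::'a. K * (exp (C * norm x) * gauss x))" for C K
    by (intro integrable_mult_right integrable_exp_norm_gauss)
  have int_g: "integrable lborel g"
    unfolding g_def by (rule int_C)
  have int1: "integrable lborel (\<lambda>x. \<phi> x * gauss x)"
    by (rule Bochner_Integration.integrable_bound[OF int_C[of K C]])
      (use assms(5) K in \<open>auto simp: abs_mult intro!: mult_right_mono\<close>)
  have int2: "integrable lborel (\<lambda>x. \<phi>' x * gauss x)"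
    by (rule Bochner_Integration.integrable_bound[OF int_C[of K C]])
      (use assms(6) K in \<open>auto simp: abs_mult intro!: mult_right_mono\<close>)
  have int_F: "integrable lborel (F t)" for t
    unfolding F_def using integrable_lborel_affine_iff[of "\<lambda>x. \<phi> x * gauss x" 1 "t *\<^sub>R e"] int1
    by (simp add: add.commute)
  have F_const: "integral\<^sup>L lborel (F t) = integral\<^sup>L lborel (F 0)" for t
    unfolding F_def using integral_lborel_affine[of "\<lambda>x. \<phi> x * gauss x" 1 "t *\<^sub>R e"]
    by (simp add: add.commute)
  have der': "((\<lambda>t. \<phi> (x + t *\<^sub>R e)) has_vector_derivative \<phi>' (x + t *\<^sub>R e)) (at t)" for t x
    by (rule has_vector_derivative_line_shift[OF der])
  have der_gauss: "((\<lambda>t. gauss (x + t *\<^sub>R e)) has_vector_derivative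
      - ((x + t *\<^sub>R e) \<bullet> e) * gauss (x + t *\<^sub>R e)) (at t)" for t x
  proof -
    have "((\<lambda>t. exp (- (x \<bullet> x + 2 * t * (x \<bullet> e) + t * t * (e \<bullet> e)) / 2)) has_field_derivative
      - ((x + t *\<^sub>R e) \<bullet> e) * exp (- (x \<bullet> x + 2 * t * (x \<bullet> e) + t * t * (e \<bullet> e)) / 2)) (at t)"
      by (auto intro!: derivative_eq_intros simp: inner_simps field_simps)
    then show ?thesis
      unfolding gauss_def has_real_derivative_iff_has_vector_derivative
      by (simp add: inner_simps inner_commute algebra_simps)
  qed
  have derF: "((\<lambda>t. F t x) has_vector_derivative F' t x) (at t)" for t x
    unfolding F_def F'_def
    using has_vector_derivative_mult[OF der'[of x t] der_gauss[of x t]] by (simp add: algebra_simps)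
  have "AE x in lborel. \<forall>t. \<bar>t - 0\<bar> < 1 \<longrightarrow> norm (F' t x) \<le> g x"
  proof -
    have "norm (F' t x) \<le> g x" if t: "\<bar>t - 0\<bar> < 1" for t x
    proof -
      let ?y = "x + t *\<^sub>R e" and ?k = "K * exp (C * (norm x + 1))"
      have n: "norm ?y \<le> norm x + 1"
        using norm_triangle_ineq[of x "t *\<^sub>R e"] t e by simp
      have b: "K * exp (C * norm ?y) \<le> ?k"
        using K n \<open>0 \<le> C\<close> by (intro mult_left_mono) (auto intro: mult_left_mono)
      have "\<bar>?y \<bullet> e\<bar> \<le> norm x + 1"
        using Cauchy_Schwarz_ineq2[of ?y e] e n by simp
      also have "\<dots> \<le> exp (norm x)" using exp_ge_add_one_self[of "norm x"] by linarith
      finally have m: "\<bar>?y \<bullet> e\<bar> \<le> exp (norm x)" .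
      have "\<bar>\<phi>' ?y - (?y \<bullet> e) * \<phi> ?y\<bar>
        \<le> \<bar>\<phi>' ?y\<bar> + \<bar>?y \<bullet> e\<bar> * \<bar>\<phi> ?y\<bar>"
        unfolding abs_mult[symmetric] by (rule abs_triangle_ineq4)
      also have "\<dots> \<le> ?k + exp (norm x) * ?k"
        using m order_trans[OF assms(5) b] order_trans[OF assms(6) b] by (intro add_mono mult_mono) auto
      also have "\<dots> \<le> exp (norm x) * ?k + exp (norm x) * ?k"
        using mult_right_mono[of 1 "exp (norm x)" "?k"] K by (simp add: ac_simps)
      finally have A: "\<bar>\<phi>' ?y - (?y \<bullet> e) * \<phi> ?y\<bar>
        \<le> 2 * K * (exp (norm x) * exp (C * (norm x + 1)))" by simp
      have "- (norm x) \<le> t * (x \<bullet> e)"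
      proof -
        have "\<bar>t * (x \<bullet> e)\<bar> \<le> 1 * norm x"
          unfolding abs_mult using t Cauchy_Schwarz_ineq2[of x e] e by (intro mult_mono) auto
        then show ?thesis by simp
      qed
      then have "gauss (x + t *\<^sub>R e) \<le> exp (norm x) * gauss x"
        using e by (simp add: gauss_def exp_add[symmetric] inner_simps inner_commute norm_eq_1)
          (smt (verit) zero_le_square)
      then have "norm (F' t x) \<le> 2 * K * (exp (norm x) * exp (C * (norm x + 1))) * (exp (norm x) * gauss x)"
        unfolding F'_def real_norm_def abs_mult using A K by (intro mult_mono) auto
      also have "\<dots> = 2 * K * exp C * (exp ((C + 2) * norm x) * gauss x)"
        by (simp add: gauss_def exp_add[symmetric] algebra_simps)
      also have "\<dots> \<le> g x"
        unfolding g_def using K by (intro mult_right_mono mult_left_mono) auto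
      finally show ?thesis .
    qed
    then show ?thesis by simp
  qed
  note bound = this
  have "((\<lambda>t. integral\<^sup>L lborel (F t)) has_vector_derivative integral\<^sup>L lborel (F' 0)) (at 0)"
    by (rule has_vector_derivative_integral(1)[where f=F and f'=F' and g=g, OF zero_less_one]) (rule int_F derF bound int_g)+
  moreover have intF': "integrable lborel (F' 0)"
    by (rule has_vector_derivative_integral(2)[where f=F and f'=F' and g=g, OF zero_less_one]) (rule int_F derF bound int_g)+
  moreover have "((\<lambda>t. integral\<^sup>L lborel (F t)) has_vector_derivative 0) (at 0)"
    using has_vector_derivative_const[of "integral\<^sup>L lborel (F 0)"]
    by (simp only: ext[of "\<lambda>t. integral\<^sup>L lborel (F t)" "\<lambda>_. integral\<^sup>L lborel (F 0)", OF F_const])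
  ultimately have "integral\<^sup>L lborel (F' 0) = 0"
    using vector_derivative_unique_at by blast
  moreover have "integral\<^sup>L lborel (F' 0) = (LBINT x. \<phi>' x * gauss x) - (LBINT x. (x \<bullet> e) * \<phi> x * gauss x)"
  proof -
    have "integrable lborel (\<lambda>x. \<phi>' x * gauss x - F' 0 x)"
      by (intro Bochner_Integration.integrable_diff int2 intF')
    then have int3: "integrable lborel (\<lambda>x. (x \<bullet> e) * \<phi> x * gauss x)"
      by (simp add: F'_def algebra_simps)
    have "F' 0 = (\<lambda>x. \<phi>' x * gauss x - (x \<bullet> e) * \<phi> x * gauss x)"
      by (simp add: F'_def fun_eq_iff algebra_simps)
    then show ?thesis
      using int2 int3 by (simp only: Bochner_Integration.integral_diff)
  qed
  ultimately show ?thesis by simp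
qed

text \<open>Multiplication by \<open>\<i>\<close> is a rotation by a right angle, so this is
  Pythagoras for the orthogonal pair \<open>v\<close>, \<open>\<i> * v\<close> in the plane. It is
  what makes the second-order terms in w and in x cancel, the derivative in x carrying the
  additional factor \<open>\<i>\<close>.\<close>

lemma complex_inner_identity:
  "(h \<bullet> v)\<^sup>2 + (h \<bullet> (\<i> * v))\<^sup>2 = (norm h)\<^sup>2 * (norm v)\<^sup>2" for h v :: complex
  unfolding cmod_power2 by (simp add: inner_complex_def power2_eq_square algebra_simps)

text \<open>The term \<open>\<epsilon>\<^sup>2\<close> keeps the base positive, so a real power is
  differentiable also where h vanishes.\<close>

lemma has_vector_derivative_reg_norm:
  fixes h :: "real \<Rightarrow> complex" and \<epsilon> :: real
  assumes h: "(h has_vector_derivative h') (at t)" and "0 < \<epsilon>"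
  shows
    "((\<lambda>t. ((norm (h t))\<^sup>2 + \<epsilon>\<^sup>2) powr r) has_vector_derivative
       2 * r * ((norm (h t))\<^sup>2 + \<epsilon>\<^sup>2) powr (r - 1) * (h t \<bullet> h')) (at t)"
proof -
  have pos: "0 < (h t) \<bullet> (h t) + \<epsilon>\<^sup>2" using \<open>0 < \<epsilon>\<close> by (intro add_nonneg_pos) auto
  have "((\<lambda>t. h t \<bullet> h t) has_vector_derivative (h t \<bullet> h' + h' \<bullet> h t)) (at t)"
    by (rule bounded_bilinear.has_vector_derivative[OF bounded_bilinear_inner h h])
  then have "((\<lambda>t. h t \<bullet> h t) has_field_derivative 2 * (h t \<bullet> h')) (at t)"
    by (simp add: has_real_derivative_iff_has_vector_derivative inner_commute)
  then have "((\<lambda>t. (h t \<bullet> h t + \<epsilon>\<^sup>2) powr r) has_field_derivative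
      r * (h t \<bullet> h t + \<epsilon>\<^sup>2) powr (r - 1) * (2 * (h t \<bullet> h'))) (at t)"
    using pos by (auto intro!: derivative_eq_intros simp: powr_diff)
  then show ?thesis
    by (simp add: has_real_derivative_iff_has_vector_derivative power2_norm_eq_inner ac_simps)
qed

text \<open>One second-derivative formula for both Gaussian variables: z is 1 for w and
  \<open>\<i> * \<omega>\<close> for x, while \<kappa> is cos s or sin s. The first derivative is
  kept without its factor \<kappa>, so that only one such factor appears here.\<close>

lemma has_vector_derivative_reg_norm_inner:
  fixes h v :: "real \<Rightarrow> complex" and \<epsilon> \<kappa> :: real and z :: complex
  assumes h: "(h has_vector_derivative \<kappa> *\<^sub>R (z * v t)) (at t)"
    and v: "(v has_vector_derivative \<kappa> *\<^sub>R (z * w)) (at t)" and "0 < \<epsilon>"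
  shows "((\<lambda>t. p * ((norm (h t))\<^sup>2 + \<epsilon>\<^sup>2) powr (p / 2 - 1) * (h t \<bullet> (z * v t))) has_vector_derivative
       \<kappa> * (p * (p - 2) * ((norm (h t))\<^sup>2 + \<epsilon>\<^sup>2) powr (p / 2 - 2) * (h t \<bullet> (z * v t))\<^sup>2
         + p * ((norm (h t))\<^sup>2 + \<epsilon>\<^sup>2) powr (p / 2 - 1) * ((norm (z * v t))\<^sup>2 + h t \<bullet> (z\<^sup>2 * w)))) (at t)"
proof -
  have 1: "((\<lambda>t. ((norm (h t))\<^sup>2 + \<epsilon>\<^sup>2) powr (p / 2 - 1)) has_vector_derivative
      2 * (p / 2 - 1) * ((norm (h t))\<^sup>2 + \<epsilon>\<^sup>2) powr (p / 2 - 1 - 1) * (h t \<bullet> (\<kappa> *\<^sub>R (z * v t)))) (at t)"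
    by (rule has_vector_derivative_reg_norm[OF h \<open>0 < \<epsilon>\<close>])
  have "((\<lambda>t. z * v t) has_vector_derivative z * (\<kappa> *\<^sub>R (z * w))) (at t)"
    by (rule has_vector_derivative_mult_right[OF v])
  from bounded_bilinear.has_vector_derivative[OF bounded_bilinear_inner h this]
  have 2: "((\<lambda>t. h t \<bullet> (z * v t)) has_vector_derivative
      h t \<bullet> (z * (\<kappa> *\<^sub>R (z * w))) + (\<kappa> *\<^sub>R (z * v t)) \<bullet> (z * v t)) (at t)" .
  have 3: "h t \<bullet> (z * (\<kappa> *\<^sub>R (z * w))) + (\<kappa> *\<^sub>R (z * v t)) \<bullet> (z * v t)
      = \<kappa> * ((norm (z * v t))\<^sup>2 + h t \<bullet> (z\<^sup>2 * w))"
    unfolding power2_norm_eq_inner by (simp add: power2_eq_square algebra_simps)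
  show ?thesis
    using has_vector_derivative_mult_right[OF has_vector_derivative_mult[OF 1 2[unfolded 3]], of p]
    by (simp add: power2_eq_square algebra_simps)
qed

lemma
  fixes f :: "'a::euclidean_space \<Rightarrow> real"
  assumes [measurable]: "f \<in> borel_measurable borel"
    and f: "\<And>x. \<bar>f x\<bar> \<le> K * exp (C * norm x)"
  shows integrable_exp_growth_gauss: "integrable lborel (\<lambda>x. f x * gauss x)"
    and integral_exp_growth_gauss:
      "\<bar>\<integral>x. f x * gauss x \<partial>lborel\<bar> \<le> K * (LBINT x. exp (C * norm (x::'a)) * gauss x)"
proof -
  have K: "0 \<le> K"
    using order_trans[OF abs_ge_zero f[of 0]] by simp
  have int: "integrable lborel (\<lambda>x::'a. K * (exp (C * norm x) * gauss x))"
    by (intro integrable_mult_right integrable_exp_norm_gauss)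
  have le: "norm (f x * gauss x) \<le> K * (exp (C * norm x) * gauss x)" for x
    using f[of x] K by (auto simp: abs_mult mult.assoc[symmetric] intro!: mult_right_mono)
  show *: "integrable lborel (\<lambda>x. f x * gauss x)"
    by (rule Bochner_Integration.integrable_bound[OF int]) (use le K in auto)
  have "norm (LBINT x. f x * gauss x) \<le> (LBINT x. norm (f x * gauss x))"
    by (rule integral_norm_bound)
  also have "\<dots> \<le> (LBINT x. K * (exp (C * norm x) * gauss (x::'a)))"
    by (rule integral_mono[OF integrable_norm[OF *] int]) (use le in simp)
  finally have "norm (LBINT x. f x * gauss x) \<le> (LBINT x. K * (exp (C * norm x) * gauss (x::'a)))" .
  then show "\<bar>\<integral>x. f x * gauss x \<partial>lborel\<bar> \<le> K * (LBINT x. exp (C * norm (x::'a)) * gauss x)"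
    by simp
qed

text \<open>The discriminant argument: the integral of \<open>(s * f x + g x)\<^sup>2\<close> is a
  nonnegative quadratic polynomial in s.\<close>

lemma integral_mult_square_le:
  fixes f g :: "'a \<Rightarrow> real"
  assumes f2: "integrable M (\<lambda>x. (f x)\<^sup>2)" and g2: "integrable M (\<lambda>x. (g x)\<^sup>2)"
    and fg: "integrable M (\<lambda>x. f x * g x)"
  shows "(\<integral>x. f x * g x \<partial>M)\<^sup>2 \<le> (\<integral>x. (f x)\<^sup>2 \<partial>M) * (\<integral>x. (g x)\<^sup>2 \<partial>M)"
proof -
  define a b c where "a = (\<integral>x. (f x)\<^sup>2 \<partial>M)" and "b = (\<integral>x. f x * g x \<partial>M)" and "c = (\<integral>x. (g x)\<^sup>2 \<partial>M)"
  have quad: "0 \<le> s\<^sup>2 * a + 2 * s * b + c" for s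
  proof -
    have "0 \<le> (\<integral>x. (s * f x + g x)\<^sup>2 \<partial>M)" by simp
    also have "(\<lambda>x. (s * f x + g x)\<^sup>2) = (\<lambda>x. s\<^sup>2 * (f x)\<^sup>2 + 2 * s * (f x * g x) + (g x)\<^sup>2)"
      by (auto simp: power2_eq_square algebra_simps)
    also have "(\<integral>x. s\<^sup>2 * (f x)\<^sup>2 + 2 * s * (f x * g x) + (g x)\<^sup>2 \<partial>M) = s\<^sup>2 * a + 2 * s * b + c"
      unfolding a_def b_def c_def using f2 g2 fg by simp
    finally show ?thesis .
  qed
  have "0 \<le> a" by (simp add: a_def)
  show ?thesis
  proof (cases "a = 0")
    case True
    have "b = 0"
    proof (rule ccontr)
      assume "b \<noteq> 0"
      \<comment> \<open>With a = 0 the polynomial is affine in s, and this s gives it the value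
        -1.\<close>
      then show False using quad[of "- (c + 1) / (2 * b)"] True by (simp add: field_simps)
    qed
    then show ?thesis using True by (simp add: a_def b_def c_def)
  next
    case False
    then have "0 < a" using \<open>0 \<le> a\<close> by simp
    then have "0 \<le> a * ((- b / a)\<^sup>2 * a + 2 * (- b / a) * b + c)"
      using quad[of "- b / a"] by (intro mult_nonneg_nonneg) auto
    also have "\<dots> = a * c - b\<^sup>2" using \<open>0 < a\<close> by (simp add: power2_eq_square field_simps)
    finally show ?thesis by (simp add: a_def b_def c_def)
  qed
qed

section \<open>The flow and its derivatives\<close>

lemma continuous_local_bound:
  fixes f :: "real \<Rightarrow> 'a::real_normed_vector"
  assumes "continuous_on UNIV f"
  obtains B where "0 \<le> B" "\<And>t. \<bar>t - t0\<bar> < 1 \<Longrightarrow> norm (f t) \<le> B"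
proof -
  have "bounded (f ` {t0 - 1..t0 + 1})"
    by (intro compact_imp_bounded compact_continuous_image continuous_on_subset[OF assms]) auto
  then obtain B where B: "\<forall>y\<in>f ` {t0 - 1..t0 + 1}. norm y \<le> B"
    unfolding bounded_iff by auto
  show ?thesis
  proof (rule that[of "max B 0"])
    fix t assume "\<bar>t - t0\<bar> < 1"
    then have "t \<in> {t0 - 1..t0 + 1}" by (auto simp: abs_less_iff)
    then have "norm (f t) \<le> B" using B by blast
    then show "norm (f t) \<le> max B 0" by simp
  qed simp
qed

text \<open>Bounded support provides all exponential moments. With \<open>1 \<le> R\<close> the
  single number \<open>R\<^sup>2\<close> bounds the three weights 1, \<open>a \<bullet> e\<close>
  and \<open>(a \<bullet> e)\<^sup>2\<close> that occur in H and its derivatives.\<close>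

locale gauss_flow = finite_measure M
  for M :: "'a::euclidean_space measure" and R p \<epsilon> :: real +
  assumes sets_M [measurable_cong, simp]: "sets M = sets borel"
    and supp: "AE a in M. norm a \<le> R"
    and R: "1 \<le> R" and p: "1 < p" "p \<le> 2" and eps: "0 < \<epsilon>"
begin

definition \<omega> where "\<omega> = sqrt (p - 1)"

lemma \<omega>: "0 < \<omega>" "\<omega> \<le> 1" "\<omega>\<^sup>2 = p - 1"
  using p by (auto simp: \<omega>_def)

lemma space_M [simp]: "space M = UNIV"
  using sets_eq_imp_space_eq[OF sets_M] by simp

text \<open>Kernel of a transform that is Laplace in w and Fourier in x. Keeping w, x and t as
  separate parameters lets one differentiation rule serve all directions of the flow.\<close>

definition E :: "'a \<Rightarrow> 'a \<Rightarrow> real \<Rightarrow> 'a \<Rightarrow> complex"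
  where "E w x t a = exp (of_real (w \<bullet> a + t * (a \<bullet> a)) + \<i> * of_real (x \<bullet> a))"

definition L :: "('a \<Rightarrow> complex) \<Rightarrow> 'a \<Rightarrow> 'a \<Rightarrow> real \<Rightarrow> complex"
  where "L k w x t = (\<integral>a. k a * E w x t a \<partial>M)"

lemma measurable_E [measurable (raw)]:
  assumes [measurable]: "w \<in> borel_measurable N" "x \<in> borel_measurable N" "t \<in> borel_measurable N" "a \<in> borel_measurable N"
  shows "(\<lambda>n. E (w n) (x n) (t n) (a n)) \<in> borel_measurable N"
  unfolding E_def by measurable

lemma measurable_L [measurable (raw)]:
  assumes [measurable]: "k \<in> borel_measurable borel" "w \<in> borel_measurable N" "x \<in> borel_measurable N" "t \<in> borel_measurable N"
  shows "(\<lambda>n. L k (w n) (x n) (t n)) \<in> borel_measurable N"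
  unfolding L_def by measurable

lemma norm_E: "norm (E w x t a) = exp (w \<bullet> a + t * (a \<bullet> a))"
  by (simp add: E_def)

lemma norm_E_le:
  assumes "norm a \<le> R" "norm w \<le> D" "\<bar>t\<bar> \<le> T"
  shows "norm (E w x t a) \<le> exp (D * R + T * R\<^sup>2)"
proof -
  have "w \<bullet> a \<le> norm w * norm a" by (rule norm_cauchy_schwarz)
  also have "\<dots> \<le> D * R" using assms R by (intro mult_mono) (auto intro: order_trans[OF norm_ge_zero])
  finally have 1: "w \<bullet> a \<le> D * R" .
  have "t * (a \<bullet> a) \<le> T * R\<^sup>2"
    unfolding power2_norm_eq_inner[symmetric]
    using assms R by (intro mult_mono power_mono) auto
  with 1 show ?thesis by (simp add: norm_E)
qed

lemma
  assumes [measurable]: "k \<in> borel_measurable borel" and k: "\<And>a. norm a \<le> R \<Longrightarrow> norm (k a) \<le> B"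
  shows integrable_L: "integrable M (\<lambda>a. k a * E w x t a)"
    and norm_L_le: "\<bar>t\<bar> \<le> T \<Longrightarrow> norm (L k w x t) \<le> B * exp (norm w * R + T * R\<^sup>2) * measure M UNIV"
proof -
  have B: "0 \<le> B" using order_trans[OF norm_ge_zero k[of 0]] R by simp
  have le: "AE a in M. norm (k a * E w x t a) \<le> B * exp (norm w * R + T * R\<^sup>2)" if "\<bar>t\<bar> \<le> T" for T
    using supp
  proof eventually_elim
    case (elim a)
    show ?case
      using elim k[OF elim] norm_E_le[OF elim order_refl that, of w x] B by (auto simp: norm_mult intro!: mult_mono)
  qed
  show *: "integrable M (\<lambda>a. k a * E w x t a)"
    by (rule integrable_const_bound[OF le]) auto
  assume t: "\<bar>t\<bar> \<le> T"
  have "norm (L k w x t) \<le> (\<integral>a. B * exp (norm w * R + T * R\<^sup>2) \<partial>M)"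
    unfolding L_def
    by (rule order_trans[OF integral_norm_bound integral_mono_AE]) (use * le[OF t] in auto)
  then show "norm (L k w x t) \<le> B * exp (norm w * R + T * R\<^sup>2) * measure M UNIV"
    by (simp add: ac_simps)
qed

lemma has_vector_derivative_E:
  assumes w: "(w has_vector_derivative w') (at \<tau>)" and x: "(x has_vector_derivative x') (at \<tau>)"
    and t: "(t has_vector_derivative t') (at \<tau>)"
  shows "((\<lambda>\<tau>. E (w \<tau>) (x \<tau>) (t \<tau>) a) has_vector_derivative
    (of_real (w' \<bullet> a + t' * (a \<bullet> a)) + \<i> * of_real (x' \<bullet> a)) * E (w \<tau>) (x \<tau>) (t \<tau>) a) (at \<tau>)"
proof -
  have "((\<lambda>\<tau>. w \<tau> \<bullet> a + t \<tau> * (a \<bullet> a)) has_vector_derivative w' \<bullet> a + t' * (a \<bullet> a)) (at \<tau>)"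
    by (intro has_vector_derivative_add has_vector_derivative_mult_left
        bounded_linear.has_vector_derivative[OF bounded_linear_inner_left] assms)
  moreover have "((\<lambda>\<tau>. x \<tau> \<bullet> a) has_vector_derivative x' \<bullet> a) (at \<tau>)"
    by (rule bounded_linear.has_vector_derivative[OF bounded_linear_inner_left x])
  ultimately have "((\<lambda>\<tau>. of_real (w \<tau> \<bullet> a + t \<tau> * (a \<bullet> a)) + \<i> * of_real (x \<tau> \<bullet> a)) has_vector_derivative
    of_real (w' \<bullet> a + t' * (a \<bullet> a)) + \<i> * of_real (x' \<bullet> a)) (at \<tau>)"
    unfolding has_real_derivative_iff_has_vector_derivative[symmetric]
    by (intro has_vector_derivative_add has_vector_derivative_of_real has_vector_derivative_mult_right)
  from field_vector_diff_chain_at[OF this DERIV_exp]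
  show ?thesis by (simp add: E_def o_def)
qed

text \<open>The parameters move along an arbitrary curve: in the s-derivative all three vary
  together, in a directional derivative two of them are constant. Continuity of the velocities gives
  the local bounds needed for domination on the support.\<close>

lemma has_vector_derivative_L:
  assumes [measurable]: "k \<in> borel_measurable borel" and k: "\<And>a. norm a \<le> R \<Longrightarrow> norm (k a) \<le> B"
    and w: "\<And>\<tau>. (w has_vector_derivative w' \<tau>) (at \<tau>)" and x: "\<And>\<tau>. (x has_vector_derivative x' \<tau>) (at \<tau>)"
    and t: "\<And>\<tau>. (t has_vector_derivative t' \<tau>) (at \<tau>)"
    and "continuous_on UNIV w'" "continuous_on UNIV x'" "continuous_on UNIV t'"
  shows "((\<lambda>\<tau>. L k (w \<tau>) (x \<tau>) (t \<tau>)) has_vector_derivative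
    L (\<lambda>a. k a * (of_real (w' \<tau>0 \<bullet> a + t' \<tau>0 * (a \<bullet> a)) + \<i> * of_real (x' \<tau>0 \<bullet> a))) (w \<tau>0) (x \<tau>0) (t \<tau>0)) (at \<tau>0)"
proof -
  have B: "0 \<le> B" using order_trans[OF norm_ge_zero k[of 0]] R by simp
  have "continuous_on UNIV w"
    by (rule continuous_at_imp_continuous_on) (use w in \<open>blast intro: has_vector_derivative_continuous\<close>)
  then obtain B1 where B1: "0 \<le> B1" "\<And>\<tau>. \<bar>\<tau> - \<tau>0\<bar> < 1 \<Longrightarrow> norm (w \<tau>) \<le> B1"
    by (rule continuous_local_bound[of w \<tau>0]) blast
  have "continuous_on UNIV t"
    by (rule continuous_at_imp_continuous_on) (use t in \<open>blast intro: has_vector_derivative_continuous\<close>)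
  then obtain B2 where B2: "0 \<le> B2" "\<And>\<tau>. \<bar>\<tau> - \<tau>0\<bar> < 1 \<Longrightarrow> norm (t \<tau>) \<le> B2"
    by (rule continuous_local_bound[of t \<tau>0]) blast
  obtain B3 where B3: "0 \<le> B3" "\<And>\<tau>. \<bar>\<tau> - \<tau>0\<bar> < 1 \<Longrightarrow> norm (w' \<tau>) \<le> B3"
    using continuous_local_bound[OF assms(6), of \<tau>0] by blast
  obtain B4 where B4: "0 \<le> B4" "\<And>\<tau>. \<bar>\<tau> - \<tau>0\<bar> < 1 \<Longrightarrow> norm (x' \<tau>) \<le> B4"
    using continuous_local_bound[OF assms(7), of \<tau>0] by blast
  obtain B5 where B5: "0 \<le> B5" "\<And>\<tau>. \<bar>\<tau> - \<tau>0\<bar> < 1 \<Longrightarrow> norm (t' \<tau>) \<le> B5"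
    using continuous_local_bound[OF assms(8), of \<tau>0] by blast
  define f where "f \<tau> a = k a * E (w \<tau>) (x \<tau>) (t \<tau>) a" for \<tau> a
  define f' where "f' \<tau> a = k a * (of_real (w' \<tau> \<bullet> a + t' \<tau> * (a \<bullet> a)) + \<i> * of_real (x' \<tau> \<bullet> a)) * E (w \<tau>) (x \<tau>) (t \<tau>) a" for \<tau> a
  have "((\<lambda>\<tau>. integral\<^sup>L M (f \<tau>)) has_vector_derivative integral\<^sup>L M (f' \<tau>0)) (at \<tau>0)"
  proof (rule has_vector_derivative_integral(1)[of 1])
    show "integrable M (f \<tau>)" for \<tau> unfolding f_def by (rule integrable_L[OF assms(1) k])
    show "((\<lambda>\<tau>. f \<tau> a) has_vector_derivative f' \<tau> a) (at \<tau>)" for \<tau> a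
      unfolding f_def f'_def mult.assoc
      by (intro has_vector_derivative_mult_right has_vector_derivative_E w x t)
    show "AE a in M. \<forall>\<tau>. \<bar>\<tau> - \<tau>0\<bar> < 1 \<longrightarrow> norm (f' \<tau> a) \<le> B * (B3 * R + B5 * R\<^sup>2 + B4 * R) * exp (B1 * R + B2 * R\<^sup>2)"
      using supp
    proof eventually_elim
      case (elim a)
      show ?case
      proof (intro allI impI)
        fix \<tau> assume \<tau>: "\<bar>\<tau> - \<tau>0\<bar> < 1"
        have "norm (of_real (w' \<tau> \<bullet> a + t' \<tau> * (a \<bullet> a)) + \<i> * of_real (x' \<tau> \<bullet> a))
          \<le> \<bar>w' \<tau> \<bullet> a + t' \<tau> * (a \<bullet> a)\<bar> + \<bar>x' \<tau> \<bullet> a\<bar>"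
          by (rule order_trans[OF norm_triangle_ineq]) (simp add: norm_mult del: of_real_add)
        also have "\<dots> \<le> \<bar>w' \<tau> \<bullet> a\<bar> + \<bar>t' \<tau>\<bar> * (norm a)\<^sup>2 + \<bar>x' \<tau> \<bullet> a\<bar>"
          unfolding power2_norm_eq_inner by (rule add_right_mono, rule order_trans[OF abs_triangle_ineq]) (simp add: abs_mult)
        also have "\<dots> \<le> B3 * R + B5 * R\<^sup>2 + B4 * R"
          using B3(2)[OF \<tau>] B4(2)[OF \<tau>] B5(2)[OF \<tau>] elim B3(1) B4(1) B5(1)
          by (intro add_mono order_trans[OF Cauchy_Schwarz_ineq2] mult_mono power_mono) auto
        finally have 1: "norm (of_real (w' \<tau> \<bullet> a + t' \<tau> * (a \<bullet> a)) + \<i> * of_real (x' \<tau> \<bullet> a)) \<le> B3 * R + B5 * R\<^sup>2 + B4 * R" .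
        have 2: "norm (E (w \<tau>) (x \<tau>) (t \<tau>) a) \<le> exp (B1 * R + B2 * R\<^sup>2)"
          using norm_E_le[OF elim B1(2)[OF \<tau>]] B2(2)[OF \<tau>] by simp
        show "norm (f' \<tau> a) \<le> B * (B3 * R + B5 * R\<^sup>2 + B4 * R) * exp (B1 * R + B2 * R\<^sup>2)"
          unfolding f'_def norm_mult[of _ "E _ _ _ _"] norm_mult[of "k a"]
          using 1 2 k[OF elim] B R B3(1) B4(1) B5(1) by (intro mult_mono) auto
      qed
    qed
  qed auto
  then show ?thesis unfolding f_def[abs_def] f'_def[abs_def] L_def .
qed

text \<open>The flow with a polynomial weight \<open>k\<close> in the integrand. Differentiating in
  w or x multiplies \<open>k\<close> by \<open>a \<bullet> e\<close>, so the first and second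
  derivatives of \<open>H\<close> are again of this form, namely \<open>V\<close> and
  \<open>W\<close> up to scalar factors.\<close>

definition F :: "('a \<Rightarrow> real) \<Rightarrow> real \<Rightarrow> 'a \<Rightarrow> 'a \<Rightarrow> complex"
  where "F k s x w = L (\<lambda>a. of_real (k a)) (cos s *\<^sub>R w) ((sin s * \<omega>) *\<^sub>R x) ((sin s)\<^sup>2 * p / 2)"

lemma measurable_F [measurable (raw)]:
  assumes [measurable]: "k \<in> borel_measurable borel" "w \<in> borel_measurable N" "x \<in> borel_measurable N"
  shows "(\<lambda>n. F k s (x n) (w n)) \<in> borel_measurable N"
  unfolding F_def by measurable

abbreviation "H \<equiv> F (\<lambda>_. 1)"
abbreviation "V e \<equiv> F (\<lambda>a. a \<bullet> e)"
abbreviation "W e \<equiv> F (\<lambda>a. (a \<bullet> e)\<^sup>2)"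

text \<open>The factor 1 in the first claim keeps the shape
  \<open>\<kappa> *\<^sub>R (z * v)\<close>, so that both claims fit
  \<open>has_vector_derivative_reg_norm_inner\<close>.\<close>

lemma has_vector_derivative_F_line:
  assumes [measurable]: "k \<in> borel_measurable borel" and k: "\<And>a. norm a \<le> R \<Longrightarrow> \<bar>k a\<bar> \<le> B"
  shows has_vector_derivative_F_w: "((\<lambda>\<tau>. F k s x (w + \<tau> *\<^sub>R e)) has_vector_derivative
      cos s *\<^sub>R (1 * F (\<lambda>a. k a * (a \<bullet> e)) s x w)) (at 0)"
    and has_vector_derivative_F_x: "((\<lambda>\<tau>. F k s (x + \<tau> *\<^sub>R e) w) has_vector_derivative
      sin s *\<^sub>R ((\<i> * of_real \<omega>) * F (\<lambda>a. k a * (a \<bullet> e)) s x w)) (at 0)"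
proof -
  let ?F = "F (\<lambda>a. k a * (a \<bullet> e)) s x w"
  let ?L1 = "L (\<lambda>a. of_real (k a) * (of_real ((cos s *\<^sub>R e) \<bullet> a + 0 * (a \<bullet> a)) + \<i> * of_real (0 \<bullet> a)))
       (cos s *\<^sub>R (w + 0 *\<^sub>R e)) ((sin s * \<omega>) *\<^sub>R x) ((sin s)\<^sup>2 * p / 2)"
  let ?L2 = "L (\<lambda>a. of_real (k a) * (of_real (0 \<bullet> a + 0 * (a \<bullet> a)) + \<i> * of_real (((sin s * \<omega>) *\<^sub>R e) \<bullet> a)))
       (cos s *\<^sub>R w) ((sin s * \<omega>) *\<^sub>R (x + 0 *\<^sub>R e)) ((sin s)\<^sup>2 * p / 2)"
  have k': "norm a \<le> R \<Longrightarrow> norm (complex_of_real (k a)) \<le> B" for a using k by simp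
  have line: "((\<lambda>\<tau>. c *\<^sub>R (y + \<tau> *\<^sub>R e)) has_vector_derivative c *\<^sub>R e) (at \<tau>)" for c \<tau> and y :: 'a
    by (auto intro!: derivative_eq_intros)
  have const: "((\<lambda>\<tau>::real. c) has_vector_derivative 0) (at \<tau>)" for c :: "'b::real_normed_vector" and \<tau>
    by simp
  have "((\<lambda>\<tau>. F k s x (w + \<tau> *\<^sub>R e)) has_vector_derivative
     ?L1) (at 0)"
    unfolding F_def by (rule has_vector_derivative_L[OF _ k' line const const]) auto
  also have "?L1
     = cos s *\<^sub>R (1 * ?F)"
    unfolding F_def L_def by (simp add: inner_commute ac_simps scaleR_conv_of_real flip: integral_mult_right_zero)
  finally show "((\<lambda>\<tau>. F k s x (w + \<tau> *\<^sub>R e)) has_vector_derivative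
      cos s *\<^sub>R (1 * ?F)) (at 0)" .
  have "((\<lambda>\<tau>. F k s (x + \<tau> *\<^sub>R e) w) has_vector_derivative
     ?L2) (at 0)"
    unfolding F_def by (rule has_vector_derivative_L[OF _ k' const line const]) auto
  also have "?L2
     = sin s *\<^sub>R ((\<i> * of_real \<omega>) * ?F)"
    unfolding F_def L_def by (simp add: inner_commute ac_simps scaleR_conv_of_real flip: integral_mult_right_zero)
  finally show "((\<lambda>\<tau>. F k s (x + \<tau> *\<^sub>R e) w) has_vector_derivative
      sin s *\<^sub>R ((\<i> * of_real \<omega>) * ?F)) (at 0)" .
qed

lemma inner_Basis_bounds:
  assumes "e \<in> Basis" "norm a \<le> R"
  shows "\<bar>a \<bullet> e\<bar> \<le> R\<^sup>2" "(a \<bullet> e)\<^sup>2 \<le> R\<^sup>2"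
proof -
  have 1: "\<bar>a \<bullet> e\<bar> \<le> R" using Basis_le_norm[OF assms(1), of a] assms(2) by simp
  also have "R \<le> R\<^sup>2" using R by (simp add: power2_eq_square)
  finally show "\<bar>a \<bullet> e\<bar> \<le> R\<^sup>2" .
  show "(a \<bullet> e)\<^sup>2 \<le> R\<^sup>2" using power_mono[OF 1 abs_ge_zero, of 2] by simp
qed

text \<open>The three summands come from cos s, sin s and sin^2 s p / 2. They are expanded in
  coordinates, with |a|^2 as the sum of the \<open>(a \<bullet> b)\<^sup>2\<close>, because the
  later integrations by parts go coordinate by coordinate.\<close>

lemma has_vector_derivative_H_s:
  "((\<lambda>s. H s x w) has_vector_derivative (\<Sum>b\<in>Basis. (- sin s * (w \<bullet> b)) *\<^sub>R V b s x w
     + (cos s * (x \<bullet> b)) *\<^sub>R (\<i> * of_real \<omega> * V b s x w) + (sin s * cos s * p) *\<^sub>R W b s x w)) (at s)"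
proof -
  let ?D = "\<lambda>a. complex_of_real (((- sin s) *\<^sub>R w) \<bullet> a + (sin s * cos s * p) * (a \<bullet> a))
       + \<i> * of_real (((cos s * \<omega>) *\<^sub>R x) \<bullet> a)"
  let ?L = "L (\<lambda>a. of_real 1 * ?D a) (cos s *\<^sub>R w) ((sin s * \<omega>) *\<^sub>R x) ((sin s)\<^sup>2 * p / 2)"
  let ?E = "E (cos s *\<^sub>R w) ((sin s * \<omega>) *\<^sub>R x) ((sin s)\<^sup>2 * p / 2)"
  let ?S = "\<lambda>a. \<Sum>b\<in>Basis. of_real (- sin s * (w \<bullet> b)) * (of_real (a \<bullet> b) * ?E a)
         + of_real (cos s * (x \<bullet> b)) * (\<i> * of_real \<omega> * (of_real (a \<bullet> b) * ?E a))
         + of_real (sin s * cos s * p) * (of_real ((a \<bullet> b)\<^sup>2) * ?E a)"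
  have d1: "((\<lambda>s. cos s *\<^sub>R w) has_vector_derivative (- sin s) *\<^sub>R w) (at s)" for s
    by (auto intro!: derivative_eq_intros simp flip: has_real_derivative_iff_has_vector_derivative)
  have d2: "((\<lambda>s. (sin s * \<omega>) *\<^sub>R x) has_vector_derivative (cos s * \<omega>) *\<^sub>R x) (at s)" for s
    by (auto intro!: derivative_eq_intros simp flip: has_real_derivative_iff_has_vector_derivative)
  have d3: "((\<lambda>s. (sin s)\<^sup>2 * p / 2) has_vector_derivative sin s * cos s * p) (at s)" for s
    unfolding has_real_derivative_iff_has_vector_derivative[symmetric]
    by (auto intro!: derivative_eq_intros)
  have int: "integrable M (\<lambda>a. of_real (a \<bullet> b) * ?E a)" "integrable M (\<lambda>a. of_real ((a \<bullet> b)\<^sup>2) * ?E a)"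
    if "b \<in> Basis" for b
    by (rule integrable_L[where B="R\<^sup>2"]; use inner_Basis_bounds[OF that] in \<open>simp add: norm_power\<close>)+
  have "((\<lambda>s. H s x w) has_vector_derivative ?L) (at s)"
    unfolding F_def by (rule has_vector_derivative_L[OF _ _ d1 d2 d3, where B=1]) (auto intro!: continuous_intros)
  also have "?L
     = (\<integral>a. ?S a \<partial>M)"
    unfolding L_def
  proof (rule Bochner_Integration.integral_cong[OF refl])
    fix a
    have "(of_real 1 * ?D a) = (\<Sum>b\<in>Basis. of_real (- sin s * (w \<bullet> b)) * of_real (a \<bullet> b)
         + of_real (cos s * (x \<bullet> b)) * (\<i> * of_real \<omega> * of_real (a \<bullet> b))
         + of_real (sin s * cos s * p) * of_real ((a \<bullet> b)\<^sup>2))"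
      unfolding sum.distrib
      by (simp add: euclidean_inner[of w a] euclidean_inner[of x a] euclidean_inner[of a a] power2_eq_square
          sum_distrib_left sum_distrib_right sum_negf algebra_simps)
    then show "(of_real 1 * ?D a) * ?E a = ?S a"
      by (simp only: sum_distrib_right distrib_right mult.assoc)
  qed
  also have "\<dots> = (\<Sum>b\<in>Basis. (- sin s * (w \<bullet> b)) *\<^sub>R V b s x w
     + (cos s * (x \<bullet> b)) *\<^sub>R (\<i> * of_real \<omega> * V b s x w) + (sin s * cos s * p) *\<^sub>R W b s x w)"
    unfolding scaleR_conv_of_real F_def L_def
    by (subst Bochner_Integration.integral_sum)
      (auto intro!: sum.cong Bochner_Integration.integrable_add integrable_mult_right int
        simp: Bochner_Integration.integral_add int simp del: of_real_power)
  finally show ?thesis .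
qed

end

text \<open>Pointwise inequality behind the monotonicity of the flow. For \<open>\<epsilon> = 0\<close> it is an equality:
  this is the infinitesimal form of Beckner's two-point inequality.\<close>

lemma flow_pointwise_le:
  fixes h v w :: complex and p \<omega> \<epsilon> :: real
  assumes p: "1 < p" "p \<le> 2" and \<omega>: "\<omega>\<^sup>2 = p - 1" and "0 < \<epsilon>"
  defines "A \<equiv> (norm h)\<^sup>2 + \<epsilon>\<^sup>2" and "z \<equiv> \<i> * of_real \<omega>"
  shows "(p * (p - 2) * A powr (p / 2 - 2) * (h \<bullet> (z * v))\<^sup>2 + p * A powr (p / 2 - 1) * ((norm (z * v))\<^sup>2 + h \<bullet> (z\<^sup>2 * w)))
      - (p * (p - 2) * A powr (p / 2 - 2) * (h \<bullet> (1 * v))\<^sup>2 + p * A powr (p / 2 - 1) * ((norm (1 * v))\<^sup>2 + h \<bullet> (1\<^sup>2 * w)))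
      + p * (p * A powr (p / 2 - 1) * (h \<bullet> w))
      + (1 / (p - 1) - 1) * (p\<^sup>2 * A powr (p / 2 - 2) * (h \<bullet> (z * v))\<^sup>2) \<le> 0"
proof -
  have A: "0 < A" using \<open>0 < \<epsilon>\<close> by (auto simp: A_def intro: add_nonneg_pos)
  define X Y where "X = h \<bullet> v" and "Y = h \<bullet> (\<i> * v)"
  have XY: "X\<^sup>2 + Y\<^sup>2 = (A - \<epsilon>\<^sup>2) * (norm v)\<^sup>2"
    using complex_inner_identity[of h v] by (simp add: X_def Y_def A_def)
  have 1: "h \<bullet> (z * v) = \<omega> * Y"
    by (simp add: z_def Y_def inner_complex_def algebra_simps)
  have 2: "(norm (z * v))\<^sup>2 = (p - 1) * (norm v)\<^sup>2"
    by (simp add: z_def norm_mult power_mult_distrib \<omega>)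
  have "z\<^sup>2 = of_real (- (p - 1))"
    unfolding \<omega>[symmetric] by (simp add: z_def power_mult_distrib)
  then have 3: "h \<bullet> (z\<^sup>2 * w) = - (p - 1) * (h \<bullet> w)"
    by (simp only: scaleR_conv_of_real[symmetric] inner_scaleR_right)
  have 4: "A powr (p / 2 - 1) = A powr (p / 2 - 2) * A"
    using A powr_add[of A "p / 2 - 2" 1] by simp
  define B k where "B = A powr (p / 2 - 2)" and "k = 1 / (p - 1) - 1"
  \<comment> \<open>Collecting terms, the coefficient of \<open>h \<bullet> w\<close> is a multiple
    of -(p - 1) - 1 + p = 0. With k (p - 1) = 2 - p the coefficient of \<open>Y\<^sup>2\<close>
    becomes 2 - p, the same as that of \<open>X\<^sup>2\<close>, so only X^2 + Y^2 remains.\<close>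
  have "(p * (p - 2) * B * (\<omega> * Y)\<^sup>2 + p * (B * A) * ((p - 1) * (norm v)\<^sup>2 + - (p - 1) * (h \<bullet> w)))
      - (p * (p - 2) * B * X\<^sup>2 + p * (B * A) * ((norm v)\<^sup>2 + h \<bullet> w)) + p * (p * (B * A) * (h \<bullet> w))
      + k * (p\<^sup>2 * B * (\<omega> * Y)\<^sup>2)
    = p * B * ((p - 2) * ((p - 1) * Y\<^sup>2) + ((p - 2) * A * (norm v)\<^sup>2 - (p - 2) * X\<^sup>2)
      + p * (k * (p - 1)) * Y\<^sup>2)"
    unfolding power_mult_distrib \<omega> by (simp add: algebra_simps power2_eq_square)
  also have "k * (p - 1) = 2 - p"
    using p by (simp add: k_def field_simps)
  also have "(p - 2) * ((p - 1) * Y\<^sup>2) + ((p - 2) * A * (norm v)\<^sup>2 - (p - 2) * X\<^sup>2) + p * (2 - p) * Y\<^sup>2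
    = (2 - p) * (X\<^sup>2 + Y\<^sup>2 - A * (norm v)\<^sup>2)"
    by (simp add: algebra_simps)
  also have "\<dots> = - (2 - p) * (\<epsilon>\<^sup>2 * (norm v)\<^sup>2)"
    unfolding XY by (simp add: algebra_simps)
  also have "p * B * (- (2 - p) * (\<epsilon>\<^sup>2 * (norm v)\<^sup>2)) \<le> 0"
    using p by (intro mult_nonneg_nonpos mult_nonneg_nonneg mult_nonpos_nonneg) (auto simp: B_def)
  finally show ?thesis
    unfolding 1 2 3 4 B_def[symmetric] k_def[symmetric] mult_1 power_one X_def[symmetric] .
qed

context gauss_flow
begin

text \<open>In a direction \<open>e\<close> the derivatives of \<open>H\<close> and \<open>V e\<close> are \<open>\<kappa> z V e\<close> and \<open>\<kappa> z W e\<close>, where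
  \<open>(\<kappa>, z)\<close> is \<open>(cos s, 1)\<close> for the variable \<open>w\<close> and \<open>(sin s, \<i> \<omega>)\<close> for \<open>x\<close>. Accordingly \<open>P\<close> has
  derivative \<open>\<kappa> U z e\<close> and \<open>U z e\<close> has derivative \<open>\<kappa> Q z e\<close>; \<open>S\<close> comes from the \<open>s\<close>-derivative and
  \<open>Z\<close> from Cauchy-Schwarz.\<close>

definition "A s x w = (norm (H s x w))\<^sup>2 + \<epsilon>\<^sup>2"
definition "P s x w = A s x w powr (p / 2)"
definition "U z e s x w = p * A s x w powr (p / 2 - 1) * (H s x w \<bullet> (z * V e s x w))"
definition "Q z e s x w = p * (p - 2) * A s x w powr (p / 2 - 2) * (H s x w \<bullet> (z * V e s x w))\<^sup>2
  + p * A s x w powr (p / 2 - 1) * ((norm (z * V e s x w))\<^sup>2 + H s x w \<bullet> (z\<^sup>2 * W e s x w))"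
definition "S e s x w = p * A s x w powr (p / 2 - 1) * (H s x w \<bullet> W e s x w)"
definition "Z z e s x w = p\<^sup>2 * A s x w powr (p / 2 - 2) * (H s x w \<bullet> (z * V e s x w))\<^sup>2"

definition z0 :: complex where "z0 = \<i> * of_real \<omega>"

lemma norm_z0: "norm z0 \<le> 1"
  using \<omega> by (simp add: z0_def norm_mult)

lemma measurable_flow [measurable (raw)]:
  assumes [measurable]: "x \<in> borel_measurable N" "w \<in> borel_measurable N"
  shows "(\<lambda>n. A s (x n) (w n)) \<in> borel_measurable N"
    and "(\<lambda>n. P s (x n) (w n)) \<in> borel_measurable N"
    and "(\<lambda>n. U z e s (x n) (w n)) \<in> borel_measurable N"
    and "(\<lambda>n. Q z e s (x n) (w n)) \<in> borel_measurable N"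
    and "(\<lambda>n. S e s (x n) (w n)) \<in> borel_measurable N"
    and "(\<lambda>n. Z z e s (x n) (w n)) \<in> borel_measurable N"
  unfolding A_def P_def U_def Q_def S_def Z_def by measurable

lemma A_pos: "\<epsilon>\<^sup>2 \<le> A s x w" "0 < A s x w"
  using eps by (auto simp: A_def intro: add_nonneg_pos)

text \<open>The bound depends neither on s nor on x: x contributes a phase, and sin^2 s p / 2 \<le>
  1 because p \<le> 2.\<close>

lemma F_norm_le: 
  assumes [measurable]: "k \<in> borel_measurable borel" and k: "\<And>a. norm a \<le> R \<Longrightarrow> \<bar>k a\<bar> \<le> R\<^sup>2"
  shows "norm (F k s x w) \<le> R\<^sup>2 * exp (R\<^sup>2) * measure M UNIV * exp (R * norm w)"
proof -
  have sin: "(sin s)\<^sup>2 \<le> 1" by (simp add: abs_square_le_1)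
  have "norm (F k s x w) \<le> R\<^sup>2 * exp (norm (cos s *\<^sub>R w) * R + 1 * R\<^sup>2) * measure M UNIV"
    unfolding F_def using k p mult_mono[OF sin p(2)] by (intro norm_L_le) auto
  also have "\<dots> \<le> R\<^sup>2 * exp (norm w * R + R\<^sup>2) * measure M UNIV"
    using R by (intro mult_right_mono mult_left_mono) (auto intro!: mult_right_mono mult_left_le_one_le)
  finally show ?thesis by (simp add: exp_add ac_simps)
qed

text \<open>One exponential envelope for everything that gets integrated. The powers of
  \<open>A\<close> with negative exponent are bounded through A \<ge> \<epsilon>^2. The square
  \<open>(H \<bullet> (z * V))\<^sup>2\<close> has degree four in \<open>Y\<close>, and since
  \<open>Y\<close> is at least 1 all lower powers can be raised to the fourth.\<close>

lemma flow_bounds: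
  obtains K C where "0 \<le> K" "0 \<le> C"
    "\<And>s x w. \<bar>P s x w\<bar> \<le> K * exp (C * norm w)"
    "\<And>s x w z e. norm z \<le> 1 \<Longrightarrow> e \<in> Basis \<Longrightarrow> \<bar>U z e s x w\<bar> \<le> K * exp (C * norm w)"
    "\<And>s x w z e. norm z \<le> 1 \<Longrightarrow> e \<in> Basis \<Longrightarrow> \<bar>Q z e s x w\<bar> \<le> K * exp (C * norm w)"
    "\<And>s x w e. e \<in> Basis \<Longrightarrow> \<bar>S e s x w\<bar> \<le> K * exp (C * norm w)"
    "\<And>s x w z e. norm z \<le> 1 \<Longrightarrow> e \<in> Basis \<Longrightarrow> \<bar>Z z e s x w\<bar> \<le> K * exp (C * norm w)"
proof -
  define K1 where "K1 = max 1 (R\<^sup>2 * exp (R\<^sup>2) * measure M UNIV)"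
  define Y where "Y w = K1 * exp (R * norm w)" for w :: 'a
  have Y1: "1 \<le> Y w" for w
    unfolding Y_def using R mult_mono[of 1 K1 1 "exp (R * norm w)"] by (auto simp: K1_def)
  have F_le: "norm (F k s x w) \<le> Y w"
    if "k \<in> borel_measurable borel" "\<And>a. norm a \<le> R \<Longrightarrow> \<bar>k a\<bar> \<le> R\<^sup>2" for k s x w
    using F_norm_le[OF that, of s x w] unfolding Y_def
    by (rule order_trans) (auto simp: K1_def intro: mult_right_mono)
  have R2: "1 \<le> R\<^sup>2" using R by simp
  have H: "norm (H s x w) \<le> Y w" for s x w
    by (rule F_le) (use R2 in auto)
  have V: "norm (V e s x w) \<le> Y w" and W: "norm (W e s x w) \<le> Y w" if "e \<in> Basis" for e s x w
    by (rule F_le; use inner_Basis_bounds[OF that] in simp)+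
  have Y24: "(Y w)\<^sup>2 \<le> Y w ^ 4" for w
    by (rule power_increasing) (use Y1 in auto)
  have Y04: "1 \<le> Y w ^ 4" for w
    using Y1 by (rule one_le_power)
  have zY: "norm (z * u) \<le> Y w" if "norm z \<le> 1" "norm u \<le> Y w" for z u :: complex and w
    using mult_mono[OF that] Y1[of w] by (simp add: norm_mult)
  have inner_le: "\<bar>H s x w \<bullet> u\<bar> \<le> (Y w)\<^sup>2" if "norm u \<le> Y w" for s x w u
    unfolding power2_eq_square using H[of s x w] that Y1[of w]
    by (intro order_trans[OF Cauchy_Schwarz_ineq2 mult_mono]) auto
  have HV: "\<bar>H s x w \<bullet> (z * V e s x w)\<bar> \<le> (Y w)\<^sup>2" if "norm z \<le> 1" "e \<in> Basis" for z e s x w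
    by (intro inner_le zY V that)
  have HW: "\<bar>H s x w \<bullet> (z * W e s x w)\<bar> \<le> (Y w)\<^sup>2" if "norm z \<le> 1" "e \<in> Basis" for z e s x w
    by (intro inner_le zY W that)
  have VV: "(norm (z * V e s x w))\<^sup>2 \<le> (Y w)\<^sup>2" if "norm z \<le> 1" "e \<in> Basis" for z e s x w
    by (intro power_mono zY V that norm_ge_zero)
  define c1 where "c1 = (\<epsilon>\<^sup>2) powr (p / 2 - 1)"
  define c2 where "c2 = (\<epsilon>\<^sup>2) powr (p / 2 - 2)"
  have c: "0 \<le> c1" "0 \<le> c2" by (auto simp: c1_def c2_def)
  have A1: "A s x w powr (p / 2 - 1) \<le> c1" and A2: "A s x w powr (p / 2 - 2) \<le> c2" for s x w
    unfolding c1_def c2_def using eps p A_pos[of s x w] by (auto intro!: powr_mono2')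
  have HV2: "(H s x w \<bullet> (z * V e s x w))\<^sup>2 \<le> Y w ^ 4" if "norm z \<le> 1" "e \<in> Basis" for z e s x w
    using power_mono[OF HV[OF that, of s x w] abs_ge_zero, of 2] by (simp flip: power_mult)
  \<comment> \<open>The four summands are the constants for \<open>P\<close>, for \<open>U\<close>
    and \<open>S\<close>, for \<open>Q\<close>, and for \<open>Z\<close>; all being nonnegative,
    each is below the sum.\<close>
  define K where "K = (2 + \<epsilon>\<^sup>2) + p * c1 + (p * \<bar>p - 2\<bar> * c2 + 2 * p * c1) + p\<^sup>2 * c2"
  have K0: "0 \<le> 2 + \<epsilon>\<^sup>2" "0 \<le> p * c1" "0 \<le> p * \<bar>p - 2\<bar> * c2 + 2 * p * c1" "0 \<le> p\<^sup>2 * c2"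
    using c p by auto
  have weaken: "t \<le> K * Y w ^ 4" if "t \<le> K' * Y w ^ 4" "K' \<le> K" for t K' w
    using that(1) by (rule order_trans) (intro mult_right_mono that(2), simp)
  have bP: "\<bar>P s x w\<bar> \<le> K * Y w ^ 4" for s x w
  proof (rule weaken)
    have "A s x w powr (p / 2) \<le> 1 + A s x w"
    proof (cases "A s x w \<le> 1")
      case True
      then have "A s x w powr (p / 2) \<le> 1" using A_pos[of s x w] p by (intro powr_le1) auto
      then show ?thesis using A_pos[of s x w] by simp
    next
      case False
      then have "A s x w powr (p / 2) \<le> A s x w powr 1" using p by (intro powr_mono) auto
      then show ?thesis using A_pos[of s x w] by simp
    qed
    also have "\<dots> \<le> 1 * Y w ^ 4 + (Y w ^ 4 + \<epsilon>\<^sup>2 * Y w ^ 4)"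
      unfolding A_def using Y04[of w] Y24[of w] power_mono[OF H norm_ge_zero, of s x w 2]
      mult_left_mono[OF Y04[of w], of "\<epsilon>\<^sup>2"]
      by (intro add_mono) auto
    finally show "\<bar>P s x w\<bar> \<le> (2 + \<epsilon>\<^sup>2) * Y w ^ 4" by (simp add: P_def algebra_simps)
  qed (use K0 in \<open>unfold K_def, linarith\<close>)
  have bU: "\<bar>U z e s x w\<bar> \<le> K * Y w ^ 4" if "norm z \<le> 1" "e \<in> Basis" for z e s x w
  proof (rule weaken)
    have "\<bar>U z e s x w\<bar> \<le> (p * c1) * (Y w)\<^sup>2"
      unfolding U_def abs_mult using p c A1 HV[OF that] by (intro mult_mono) auto
    also have "\<dots> \<le> (p * c1) * Y w ^ 4"
      using K0 Y24 by (intro mult_left_mono) auto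
    finally show "\<bar>U z e s x w\<bar> \<le> (p * c1) * Y w ^ 4" .
  qed (use K0 in \<open>unfold K_def, linarith\<close>)
  have bS: "\<bar>S e s x w\<bar> \<le> K * Y w ^ 4" if "e \<in> Basis" for e s x w
  proof (rule weaken)
    have "\<bar>S e s x w\<bar> \<le> (p * c1) * (Y w)\<^sup>2"
      unfolding S_def abs_mult using p c A1 HW[of 1, OF _ that] by (intro mult_mono) auto
    also have "\<dots> \<le> (p * c1) * Y w ^ 4"
      using K0 Y24 by (intro mult_left_mono) auto
    finally show "\<bar>S e s x w\<bar> \<le> (p * c1) * Y w ^ 4" .
  qed (use K0 in \<open>unfold K_def, linarith\<close>)
  have bZ: "\<bar>Z z e s x w\<bar> \<le> K * Y w ^ 4" if "norm z \<le> 1" "e \<in> Basis" for z e s x w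
  proof (rule weaken)
    show "\<bar>Z z e s x w\<bar> \<le> (p\<^sup>2 * c2) * Y w ^ 4"
      unfolding Z_def abs_mult using p c A2 HV2[OF that] by (intro mult_mono) auto
  qed (use K0 in \<open>unfold K_def, linarith\<close>)
  have bQ: "\<bar>Q z e s x w\<bar> \<le> K * Y w ^ 4" if z: "norm z \<le> 1" and e: "e \<in> Basis" for z e s x w
  proof (rule weaken)
    have 1: "\<bar>p * (p - 2) * A s x w powr (p / 2 - 2) * (H s x w \<bullet> (z * V e s x w))\<^sup>2\<bar> \<le> (p * \<bar>p - 2\<bar> * c2) * Y w ^ 4"
      unfolding abs_mult using p c A2 HV2[OF z e] by (intro mult_mono) auto
    have "norm (z\<^sup>2) \<le> 1" using z by (simp add: norm_power power_le_one)
    from HW[OF this e]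
    have "\<bar>(norm (z * V e s x w))\<^sup>2 + H s x w \<bullet> (z\<^sup>2 * W e s x w)\<bar> \<le> Y w ^ 4 + Y w ^ 4"
      using VV[OF z e, of s x w] Y24[of w]
      by (intro order_trans[OF abs_triangle_ineq] add_mono) (auto intro: order_trans)
    then have 2: "\<bar>p * A s x w powr (p / 2 - 1) * ((norm (z * V e s x w))\<^sup>2 + H s x w \<bullet> (z\<^sup>2 * W e s x w))\<bar>
      \<le> (p * c1) * (Y w ^ 4 + Y w ^ 4)"
      unfolding abs_mult[of "p * _"] abs_mult[of p] using p c A1 by (intro mult_mono) auto
    show "\<bar>Q z e s x w\<bar> \<le> (p * \<bar>p - 2\<bar> * c2 + 2 * p * c1) * Y w ^ 4"
      unfolding Q_def using order_trans[OF abs_triangle_ineq add_mono[OF 1 2]] by (simp add: algebra_simps)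
  qed (use K0 in \<open>unfold K_def, linarith\<close>)
  have Y4: "K * Y w ^ 4 = K * K1 ^ 4 * exp (4 * R * norm w)" for w
    by (simp add: Y_def power_mult_distrib flip: exp_of_nat_mult)
  have "0 \<le> K" using K0 unfolding K_def by linarith
  then have "0 \<le> K * K1 ^ 4" "0 \<le> 4 * R"
    using R by auto
  then show ?thesis
    by (rule that) (use bP bU bQ bS bZ in \<open>simp_all only: Y4\<close>)
qed

lemma
  assumes e: "e \<in> Basis"
  shows has_vector_derivative_U_w: "((\<lambda>\<tau>. U 1 e s x (w + \<tau> *\<^sub>R e)) has_vector_derivative cos s * Q 1 e s x w) (at 0)"
    and has_vector_derivative_P_x: "((\<lambda>\<tau>. P s (x + \<tau> *\<^sub>R e) w) has_vector_derivative sin s * U z0 e s x w) (at 0)"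
    and has_vector_derivative_U_x: "((\<lambda>\<tau>. U z0 e s (x + \<tau> *\<^sub>R e) w) has_vector_derivative sin s * Q z0 e s x w) (at 0)"
proof -
  have R2: "1 \<le> R\<^sup>2" using R by simp
  have Hw: "((\<lambda>\<tau>. H s x (w + \<tau> *\<^sub>R e)) has_vector_derivative cos s *\<^sub>R (1 * V e s x w)) (at 0)"
    and Hx: "((\<lambda>\<tau>. H s (x + \<tau> *\<^sub>R e) w) has_vector_derivative sin s *\<^sub>R (z0 * V e s x w)) (at 0)"
    using has_vector_derivative_F_line[where k="\<lambda>_. 1" and B=1 and s=s and x=x and w=w and e=e] by (simp_all add: z0_def)
  have Vw: "((\<lambda>\<tau>. V e s x (w + \<tau> *\<^sub>R e)) has_vector_derivative cos s *\<^sub>R (1 * W e s x w)) (at 0)"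
    and Vx: "((\<lambda>\<tau>. V e s (x + \<tau> *\<^sub>R e) w) has_vector_derivative sin s *\<^sub>R (z0 * W e s x w)) (at 0)"
    using has_vector_derivative_F_line[where k="\<lambda>a. a \<bullet> e" and B="R\<^sup>2" and s=s and x=x and w=w and e=e] inner_Basis_bounds(1)[OF e]
    by (simp_all add: z0_def power2_eq_square)
  show "((\<lambda>\<tau>. U 1 e s x (w + \<tau> *\<^sub>R e)) has_vector_derivative cos s * Q 1 e s x w) (at 0)"
    unfolding U_def Q_def A_def
    using has_vector_derivative_reg_norm_inner[where z=1 and h="\<lambda>\<tau>. H s x (w + \<tau> *\<^sub>R e)" and v="\<lambda>\<tau>. V e s x (w + \<tau> *\<^sub>R e)" and t=0 and p=p and \<kappa>="cos s", OF _ _ eps] Hw Vw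
    by simp
  show "((\<lambda>\<tau>. P s (x + \<tau> *\<^sub>R e) w) has_vector_derivative sin s * U z0 e s x w) (at 0)"
    unfolding U_def P_def A_def
    using has_vector_derivative_reg_norm[OF Hx eps, of "p / 2"] by (simp add: ac_simps)
  show "((\<lambda>\<tau>. U z0 e s (x + \<tau> *\<^sub>R e) w) has_vector_derivative sin s * Q z0 e s x w) (at 0)"
    unfolding U_def Q_def A_def
    using has_vector_derivative_reg_norm_inner[where z=z0 and h="\<lambda>\<tau>. H s (x + \<tau> *\<^sub>R e) w" and v="\<lambda>\<tau>. V e s (x + \<tau> *\<^sub>R e) w" and t=0 and p=p and \<kappa>="sin s", OF _ _ eps] Hx Vx
    by simp
qed

lemma has_vector_derivative_P_s:
  "((\<lambda>s. P s x w) has_vector_derivative (\<Sum>b\<in>Basis. - sin s * (w \<bullet> b) * U 1 b s x w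
     + cos s * (x \<bullet> b) * U z0 b s x w + sin s * cos s * p * S b s x w)) (at s)"
  unfolding P_def A_def
  by (rule has_vector_derivative_eq_rhs[OF has_vector_derivative_reg_norm[OF has_vector_derivative_H_s eps]])
    (simp add: U_def S_def A_def z0_def inner_sum_right inner_add_right sum_distrib_left algebra_simps)

end

section \<open>Gaussian averages of the flow and the sign of the derivative\<close>

context gauss_flow
begin

text \<open>This is p' / p, so that \<open>\<Psi>\<close> is a power of a mixed norm, L^p in w
  inside and L^{p'} in x outside. It is at least 1 because p \<le> 2.\<close>

definition "\<alpha> = 1 / (p - 1)"
definition "GI s x = (LBINT w. P s x w * gauss w)"
definition "UI z e s x = (LBINT w. U z e s x w * gauss w)"
definition "QI z e s x = (LBINT w. Q z e s x w * gauss w)"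
definition "SI e s x = (LBINT w. S e s x w * gauss w)"
definition "ZI z e s x = (LBINT w. Z z e s x w * gauss w)"
definition "\<Psi> s = (LBINT x. GI s x powr \<alpha> * gauss x)"

lemma \<alpha>: "1 \<le> \<alpha>"
  using p by (simp add: \<alpha>_def field_simps)

lemma measurable_flow_integrals [measurable]:
  "GI s \<in> borel_measurable borel" "UI z e s \<in> borel_measurable borel" "QI z e s \<in> borel_measurable borel"
  "SI e s \<in> borel_measurable borel" "ZI z e s \<in> borel_measurable borel"
  unfolding GI_def[abs_def] UI_def[abs_def] QI_def[abs_def] SI_def[abs_def] ZI_def[abs_def]
  by measurable

text \<open>The constants of \<open>flow_bounds\<close> are fixed here as hypotheses, so that the
  following lemmas can share them; they are discharged in \<open>\<Psi>_antimono\<close>.\<close>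

context
  fixes K C :: real
  assumes K: "0 \<le> K" and C: "0 \<le> C"
    and bP: "\<And>s x w. \<bar>P s x w\<bar> \<le> K * exp (C * norm w)"
    and bU: "\<And>s x w z e. norm z \<le> 1 \<Longrightarrow> e \<in> Basis \<Longrightarrow> \<bar>U z e s x w\<bar> \<le> K * exp (C * norm w)"
    and bQ: "\<And>s x w z e. norm z \<le> 1 \<Longrightarrow> e \<in> Basis \<Longrightarrow> \<bar>Q z e s x w\<bar> \<le> K * exp (C * norm w)"
    and bS: "\<And>s x w e. e \<in> Basis \<Longrightarrow> \<bar>S e s x w\<bar> \<le> K * exp (C * norm w)"
    and bZ: "\<And>s x w z e. norm z \<le> 1 \<Longrightarrow> e \<in> Basis \<Longrightarrow> \<bar>Z z e s x w\<bar> \<le> K * exp (C * norm w)"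
begin

definition N0 where "N0 = (LBINT x. exp (C * norm (x::'a)) * gauss x)"

lemma KN0: "0 \<le> K * N0"
  unfolding N0_def using K by (intro mult_nonneg_nonneg integral_nonneg_AE) auto

lemma
  shows intP: "integrable lborel (\<lambda>w. P s x w * gauss w)" and leP: "GI s x \<le> K * N0"
  using integrable_exp_growth_gauss[OF _ bP[of s x]] integral_exp_growth_gauss[OF _ bP[of s x]]
  by (auto simp: GI_def N0_def)

lemma
  assumes "norm z \<le> 1" "e \<in> Basis"
  shows intU: "integrable lborel (\<lambda>w. U z e s x w * gauss w)" and leU: "\<bar>UI z e s x\<bar> \<le> K * N0"
    and intQ: "integrable lborel (\<lambda>w. Q z e s x w * gauss w)" and leQ: "\<bar>QI z e s x\<bar> \<le> K * N0"
    and intZ: "integrable lborel (\<lambda>w. Z z e s x w * gauss w)" and leZ: "\<bar>ZI z e s x\<bar> \<le> K * N0"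
  using integrable_exp_growth_gauss[OF _ bU[OF assms, of s x]] integral_exp_growth_gauss[OF _ bU[OF assms, of s x]]
    integrable_exp_growth_gauss[OF _ bQ[OF assms, of s x]] integral_exp_growth_gauss[OF _ bQ[OF assms, of s x]]
    integrable_exp_growth_gauss[OF _ bZ[OF assms, of s x]] integral_exp_growth_gauss[OF _ bZ[OF assms, of s x]]
  by (simp_all add: UI_def QI_def ZI_def N0_def)

lemma
  assumes "e \<in> Basis"
  shows intS: "integrable lborel (\<lambda>w. S e s x w * gauss w)" and leS: "\<bar>SI e s x\<bar> \<le> K * N0"
  using integrable_exp_growth_gauss[OF _ bS[OF assms, of s x]] integral_exp_growth_gauss[OF _ bS[OF assms, of s x]]
  by (simp_all add: SI_def N0_def)

text \<open>The regularisation also keeps \<open>GI\<close> away from 0. A lower bound is required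
  because the exponent \<open>\<alpha> - 2\<close> is negative when p > 3/2.\<close>

definition g0 where "g0 = (\<epsilon>\<^sup>2) powr (p / 2) * (LBINT x. gauss (x::'a))"

lemma g0: "0 < g0" "g0 \<le> GI s x"
proof -
  show "0 < g0" using eps by (simp add: g0_def integral_gauss)
  have "(LBINT w. (\<epsilon>\<^sup>2) powr (p / 2) * gauss (w::'a)) \<le> (LBINT w. P s x w * gauss w)"
  proof (rule integral_mono)
    show "(\<epsilon>\<^sup>2) powr (p / 2) * gauss w \<le> P s x w * gauss w" for w
      unfolding P_def using p A_pos by (intro mult_right_mono powr_mono2) auto
  qed (use intP integrable_gauss in auto)
  then show "g0 \<le> GI s x" by (simp add: g0_def GI_def)
qed

lemma GI_pos: "0 < GI s x"
  using g0(1) g0(2)[of s x] by simp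

definition g1 where "g1 = (K * N0) powr (\<alpha> - 1)"
text \<open>The function t^(\<alpha> - 2) increases or decreases according to the size of p; the sum
  of its values at both ends of the range of \<open>GI\<close> covers the two cases.\<close>

definition g2 where "g2 = g0 powr (\<alpha> - 2) + (K * N0) powr (\<alpha> - 2)"

lemma GI_powr_le: "GI s x powr (\<alpha> - 1) \<le> g1" "GI s x powr (\<alpha> - 2) \<le> g2" "0 \<le> g1" "0 \<le> g2"
proof -
  show "GI s x powr (\<alpha> - 1) \<le> g1"
    unfolding g1_def using \<alpha> leP GI_pos[of s x] by (intro powr_mono2) auto
  show "GI s x powr (\<alpha> - 2) \<le> g2"
  proof (cases "2 \<le> \<alpha>")
    case True
    then have "GI s x powr (\<alpha> - 2) \<le> (K * N0) powr (\<alpha> - 2)"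
      using leP GI_pos[of s x] by (intro powr_mono2) auto
    then show ?thesis by (simp add: g2_def add_increasing)
  next
    case False
    then have "GI s x powr (\<alpha> - 2) \<le> g0 powr (\<alpha> - 2)"
      using g0(1) g0(2)[of s x] by (intro powr_mono2') auto
    then show ?thesis by (simp add: g2_def add_increasing2)
  qed
qed (auto simp: g1_def g2_def)

lemma has_vector_derivative_integral_x:
  assumes [measurable]: "\<And>x. \<Phi> x \<in> borel_measurable borel" and b: "\<And>x w. \<bar>\<Phi> x w\<bar> \<le> K * exp (C * norm w)"
    and b': "\<And>x w. \<bar>\<Phi>' x w\<bar> \<le> K * exp (C * norm w)"
    and der: "\<And>x w. ((\<lambda>\<tau>. \<Phi> (x + \<tau> *\<^sub>R e) w) has_vector_derivative sin s * \<Phi>' x w) (at 0)"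
  shows "((\<lambda>\<tau>. \<integral>w. \<Phi> (x + \<tau> *\<^sub>R e) w * gauss w \<partial>lborel) has_vector_derivative
      sin s * (LBINT w. \<Phi>' (x::'a) w * gauss w)) (at 0)"
proof -
  have "((\<lambda>\<tau>. \<integral>w. \<Phi> (x + \<tau> *\<^sub>R e) w * gauss w \<partial>lborel) has_vector_derivative
      (LBINT w. sin s * \<Phi>' (x + 0 *\<^sub>R e) w * gauss w)) (at 0)"
  proof (rule has_vector_derivative_integral(1)[where f'="\<lambda>\<tau> w. sin s * \<Phi>' (x + \<tau> *\<^sub>R e) w * gauss w"
        and g="\<lambda>w. K * (exp (C * norm w) * gauss w)", OF zero_less_one])
    show "((\<lambda>\<tau>. \<Phi> (x + \<tau> *\<^sub>R e) w * gauss w) has_vector_derivative sin s * \<Phi>' (x + \<tau> *\<^sub>R e) w * gauss w) (at \<tau>)" for \<tau> w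
      by (intro has_vector_derivative_mult_left has_vector_derivative_line_shift[OF der])
    have "\<bar>sin s\<bar> * \<bar>\<Phi>' y w\<bar> \<le> 1 * (K * exp (C * norm w))" for y w
      using b' by (intro mult_mono) auto
    then show "AE w in lborel. \<forall>\<tau>. \<bar>\<tau> - 0\<bar> < 1 \<longrightarrow> norm (sin s * \<Phi>' (x + \<tau> *\<^sub>R e) w * gauss w) \<le> K * (exp (C * norm w) * gauss w)"
      by (auto simp: abs_mult mult.assoc[symmetric] intro!: mult_right_mono)
  qed (auto intro!: integrable_exp_growth_gauss[OF _ b] integrable_exp_norm_gauss)
  then show ?thesis by (simp add: mult.assoc)
qed

lemma
  assumes e: "e \<in> Basis"
  shows has_vector_derivative_GI_x: "((\<lambda>\<tau>. GI s (x + \<tau> *\<^sub>R e)) has_vector_derivative sin s * UI z0 e s x) (at 0)"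
    and has_vector_derivative_UI_x: "((\<lambda>\<tau>. UI z0 e s (x + \<tau> *\<^sub>R e)) has_vector_derivative sin s * QI z0 e s x) (at 0)"
  unfolding GI_def UI_def QI_def
  by (rule has_vector_derivative_integral_x[OF _ bP bU[OF norm_z0 e] has_vector_derivative_P_x[OF e]], measurable)
    (rule has_vector_derivative_integral_x[OF _ bU[OF norm_z0 e] bQ[OF norm_z0 e] has_vector_derivative_U_x[OF e]], measurable)

text \<open>Integration by parts in w removes the coordinate factor; cos s is the inner derivative
  of cos s a.w.\<close>

lemma integral_inner_U:
  assumes e: "e \<in> Basis"
  shows "(LBINT w. (w \<bullet> e) * U 1 e s x w * gauss w) = cos s * QI 1 e s x"
proof -
  have "\<bar>cos s\<bar> * \<bar>Q 1 e s x w\<bar> \<le> 1 * (K * exp (C * norm w))" for w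
    using bQ[of 1, OF _ e] by (intro mult_mono) auto
  then have "(LBINT w. (w \<bullet> e) * U 1 e s x w * gauss w) = (LBINT w. cos s * Q 1 e s x w * gauss w)"
    using bU[of 1, OF _ e] C e
    by (intro integral_gauss_inner_eq[where K=K and C=C] has_vector_derivative_U_w) (auto simp: abs_mult)
  then show ?thesis by (simp add: QI_def mult.assoc)
qed

text \<open>The derivative of \<open>GI\<close> in s, already integrated by parts in w. The factor
  \<open>x \<bullet> b\<close> stays for now: x is the outer variable, and its integration by parts
  must include the power \<open>GI s x powr (\<alpha> - 1)\<close>.\<close>

definition "dG s x = (\<Sum>b\<in>Basis. - (sin s * cos s) * QI 1 b s x + cos s * (x \<bullet> b) * UI z0 b s x + sin s * cos s * p * SI b s x)"

lemma dP_bound: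
  assumes "b \<in> Basis"
  shows "\<bar>- sin s * (w \<bullet> b) * u + cos s * (x \<bullet> b) * v + sin s * cos s * p * t\<bar>
    \<le> norm w * \<bar>u\<bar> + norm x * \<bar>v\<bar> + 2 * \<bar>t\<bar>"
proof -
  have "\<bar>- sin s * (w \<bullet> b) * u\<bar> \<le> 1 * norm w * \<bar>u\<bar>"
    unfolding abs_mult using Basis_le_norm[OF assms, of w] by (intro mult_mono) auto
  moreover have "\<bar>cos s * (x \<bullet> b) * v\<bar> \<le> 1 * norm x * \<bar>v\<bar>"
    unfolding abs_mult using Basis_le_norm[OF assms, of x] by (intro mult_mono) auto
  moreover have "\<bar>sin s * cos s * p * t\<bar> \<le> 1 * 1 * 2 * \<bar>t\<bar>"
    unfolding abs_mult using p by (intro mult_mono) auto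
  ultimately show ?thesis by linarith
qed

lemma has_vector_derivative_GI_s:
  "((\<lambda>s. GI s x) has_vector_derivative dG s x) (at s)"
proof -
  define D where "D s w b = - sin s * (w \<bullet> b) * U 1 b s x w
     + cos s * (x \<bullet> b) * U z0 b s x w + sin s * cos s * p * S b s x w" for s w b
  \<comment> \<open>The factor \<open>norm w\<close> from the derivative of cos s a.w is absorbed
    into one more exponential, hence the exponent C + 1 in the envelope.\<close>
  define c where "c = real DIM('a) * (norm x + 2) * K"
  have "((\<lambda>s. \<integral>w. P s x w * gauss w \<partial>lborel) has_vector_derivative
      (LBINT w. (\<Sum>b\<in>Basis. D s w b) * gauss w)) (at s)"
  proof (rule has_vector_derivative_integral(1)[where f'="\<lambda>s w. (\<Sum>b\<in>Basis. D s w b) * gauss w"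
        and g="\<lambda>w. c * (exp ((C + 1) * norm w) * gauss w)", OF zero_less_one])
    show "((\<lambda>s. P s x w * gauss w) has_vector_derivative (\<Sum>b\<in>Basis. D s w b) * gauss w) (at s)" for s w
      unfolding D_def by (intro has_vector_derivative_mult_left has_vector_derivative_P_s)
    have "\<bar>\<Sum>b\<in>Basis. D s w b\<bar> \<le> c * exp ((C + 1) * norm w)" for s w
    proof -
      have "\<bar>D s w b\<bar> \<le> (norm x + 2) * (K * exp ((C + 1) * norm w))" if b: "b \<in> Basis" for b
      proof -
        let ?k = "K * exp (C * norm w)"
        have "\<bar>D s w b\<bar> \<le> norm w * ?k + norm x * ?k + 2 * ?k"
          unfolding D_def
          by (rule order_trans[OF dP_bound[OF b]])
            (use bU[OF norm_z0 b] bU[of 1, OF _ b] bS[OF b] in \<open>auto intro!: add_mono mult_left_mono\<close>)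
        also have "\<dots> = (norm w + norm x + 2) * ?k" by (simp add: algebra_simps)
        also have "\<dots> \<le> ((norm x + 2) * (1 + norm w)) * ?k"
          using K by (intro mult_right_mono) (auto simp: algebra_simps)
        also have "\<dots> \<le> ((norm x + 2) * exp (norm w)) * ?k"
          using K by (intro mult_right_mono mult_left_mono) auto
        finally show ?thesis by (simp add: exp_add algebra_simps)
      qed
      then show ?thesis
        by (intro order_trans[OF sum_abs] order_trans[OF sum_bounded_above]) (auto simp: c_def mult.assoc)
    qed
    then show "AE w in lborel. \<forall>t. \<bar>t - s\<bar> < 1 \<longrightarrow> norm ((\<Sum>b\<in>Basis. D t w b) * gauss w) \<le> c * (exp ((C + 1) * norm w) * gauss w)"
      by (auto simp: abs_mult mult.assoc[symmetric] intro!: mult_right_mono)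
  qed (auto intro!: intP integrable_exp_norm_gauss)
  also have "(LBINT w. (\<Sum>b\<in>Basis. D s w b) * gauss w) = dG s x"
  proof -
    have int: "integrable lborel (\<lambda>w. (w \<bullet> b) * U 1 b s x w * gauss w)" if b: "b \<in> Basis" for b
    proof (rule integrable_exp_growth_gauss[where K=K and C="C + 1"])
      fix w :: 'a
      have "\<bar>w \<bullet> b\<bar> \<le> exp (norm w)"
        using Basis_le_norm[OF b, of w] exp_ge_add_one_self[of "norm w"] by linarith
      then have "\<bar>w \<bullet> b\<bar> * \<bar>U 1 b s x w\<bar> \<le> exp (norm w) * (K * exp (C * norm w))"
        using bU[of 1, OF _ b] by (intro mult_mono) auto
      then show "\<bar>(w \<bullet> b) * U 1 b s x w\<bar> \<le> K * exp ((C + 1) * norm w)"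
        by (simp add: abs_mult exp_add algebra_simps)
    qed measurable
    have eq: "D s w b * gauss w = - sin s * ((w \<bullet> b) * U 1 b s x w * gauss w)
        + cos s * (x \<bullet> b) * (U z0 b s x w * gauss w) + sin s * cos s * p * (S b s x w * gauss w)" for w b
      by (simp add: D_def algebra_simps)
    have intD: "integrable lborel (\<lambda>w. D s w b * gauss w)" if b: "b \<in> Basis" for b
      unfolding eq
      by (intro Bochner_Integration.integrable_add integrable_mult_right int[OF b] intU[OF norm_z0 b] intS[OF b])
    have "(LBINT w. D s w b * gauss w) = - (sin s * cos s) * QI 1 b s x
        + cos s * (x \<bullet> b) * UI z0 b s x + sin s * cos s * p * SI b s x" if b: "b \<in> Basis" for b
      unfolding eq UI_def SI_def
      using int[OF b] intU[OF norm_z0 b, of s x] intS[OF b, of s x] integral_inner_U[OF b, of s x]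
      by (simp add: Bochner_Integration.integrable_add integrable_mult_right del: integrable_mult_left_iff)
    then show ?thesis
      unfolding sum_distrib_right dG_def by (subst Bochner_Integration.integral_sum) (use intD in auto)
  qed
  finally show ?thesis by (simp add: GI_def[abs_def])
qed

definition "d\<Psi> s x = \<alpha> * GI s x powr (\<alpha> - 1) * dG s x"

lemma has_vector_derivative_\<Psi>:
  "(\<Psi> has_vector_derivative (LBINT x. d\<Psi> s x * gauss x)) (at s)"
proof -
  have powr_der: "((\<lambda>s. GI s x powr \<alpha>) has_vector_derivative d\<Psi> s x) (at s)" for s x
  proof -
    have "((\<lambda>s. GI s x) has_real_derivative dG s x) (at s)"
      using has_vector_derivative_GI_s by (simp add: has_real_derivative_iff_has_vector_derivative)
    then show ?thesis
      unfolding has_real_derivative_iff_has_vector_derivative[symmetric]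
      using GI_pos[of s x] by (auto intro!: derivative_eq_intros simp: d\<Psi>_def powr_diff)
  qed
  \<comment> \<open>In each coordinate the three terms of \<open>dG\<close> give at most K N0 times
    1, |x| and 2 respectively, the 2 coming from p; and |x| + 3 \<le> 3 exp |x|.\<close>
  define c where "c = \<alpha> * g1 * (real DIM('a) * (3 * (K * N0)))"
  have int: "integrable lborel (\<lambda>x. GI s x powr \<alpha> * gauss x)" for s
  proof (rule integrable_exp_growth_gauss[where C=0 and K="(K * N0) powr \<alpha>"])
    show "\<bar>GI s x powr \<alpha>\<bar> \<le> (K * N0) powr \<alpha> * exp (0 * norm x)" for x
      using \<alpha> leP[of s x] GI_pos[of s x] by (auto intro!: powr_mono2)
  qed measurable
  have der: "((\<lambda>s. GI s x powr \<alpha> * gauss x) has_vector_derivative d\<Psi> s x * gauss x) (at s)" for s x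
    by (intro has_vector_derivative_mult_left powr_der)
  have bound: "\<bar>d\<Psi> s x\<bar> \<le> c * exp (norm x)" for s x
  proof -
    have "\<bar>dG s x\<bar> \<le> real DIM('a) * (3 * (K * N0) * exp (norm x))"
      unfolding dG_def
    proof (rule order_trans[OF sum_abs sum_bounded_above])
      fix b :: 'a assume b: "b \<in> Basis"
      have 1: "\<bar>- (sin s * cos s) * QI 1 b s x\<bar> \<le> 1 * 1 * (K * N0)"
        unfolding abs_mult abs_minus_cancel using leQ[of 1, OF _ b] by (intro mult_mono) auto
      have 2: "\<bar>cos s * (x \<bullet> b) * UI z0 b s x\<bar> \<le> 1 * norm x * (K * N0)"
        unfolding abs_mult using leU[OF norm_z0 b] Basis_le_norm[OF b, of x] by (intro mult_mono) auto
      have 3: "\<bar>sin s * cos s * p * SI b s x\<bar> \<le> 1 * 1 * 2 * (K * N0)"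
        unfolding abs_mult using leS[OF b] p by (intro mult_mono) auto
      have "(norm x + 3) * (K * N0) \<le> (3 * exp (norm x)) * (K * N0)"
        using KN0 exp_ge_add_one_self[of "norm x"] norm_ge_zero[of x]
        by (intro mult_right_mono) (linarith, auto)
      then show "\<bar>- (sin s * cos s) * QI 1 b s x + cos s * (x \<bullet> b) * UI z0 b s x + sin s * cos s * p * SI b s x\<bar>
          \<le> 3 * (K * N0) * exp (norm x)"
        using 1 2 3 by (simp add: algebra_simps)
    qed
    then have "\<bar>d\<Psi> s x\<bar> \<le> \<alpha> * g1 * (real DIM('a) * (3 * (K * N0) * exp (norm x)))"
      unfolding d\<Psi>_def abs_mult using \<alpha> GI_powr_le by (intro mult_mono) auto
    then show ?thesis by (simp add: c_def ac_simps)
  qed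
  then have bound': "AE x in lborel. \<forall>t. \<bar>t - s\<bar> < 1 \<longrightarrow> norm (d\<Psi> t x * gauss x) \<le> c * (exp (1 * norm x) * gauss x)" for s
    by (auto simp: abs_mult[of _ "gauss _"] mult.assoc[symmetric] intro!: mult_right_mono)
  have intg: "integrable lborel (\<lambda>x::'a. c * (exp (1 * norm x) * gauss x))"
    by (intro integrable_mult_right integrable_exp_norm_gauss)
  show "(\<Psi> has_vector_derivative (LBINT x. d\<Psi> s x * gauss x)) (at s)"
    unfolding \<Psi>_def[abs_def]
    by (rule has_vector_derivative_integral(1)[where f'="\<lambda>t x. d\<Psi> t x * gauss x"
          and g="\<lambda>x. c * (exp (1 * norm x) * gauss x)", OF zero_less_one])
      (rule int der bound' intg)+
qed

text \<open>Cauchy-Schwarz with the splitting A^(p/2 - 1) = A^(p/4) A^(p/4 - 1) and the square root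
  of the Gaussian in each factor: one square is the integrand of \<open>GI\<close>, the other that
  of \<open>ZI\<close>.\<close>

lemma UI_square_le:
  assumes z: "norm z \<le> 1" and e: "e \<in> Basis"
  shows "(UI z e s x)\<^sup>2 \<le> GI s x * ZI z e s x"
proof -
  define f where "f w = A s x w powr (p / 4) * sqrt (gauss w)" for w
  define g where "g w = p * A s x w powr (p / 4 - 1) * (H s x w \<bullet> (z * V e s x w)) * sqrt (gauss w)" for w
  have g2: "sqrt (gauss w) * sqrt (gauss w) = gauss w" for w :: 'a by simp
  have a1: "A s x w powr (p / 4) * A s x w powr (p / 4) = A s x w powr (p / 2)" for w
    by (subst powr_add[symmetric]) simp
  have a2: "A s x w powr (p / 4) * A s x w powr (p / 4 - 1) = A s x w powr (p / 2 - 1)" for w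
    by (subst powr_add[symmetric]) simp
  have a3: "A s x w powr (p / 4 - 1) * A s x w powr (p / 4 - 1) = A s x w powr (p / 2 - 2)" for w
    by (subst powr_add[symmetric]) simp
  have ff: "(f w)\<^sup>2 = P s x w * gauss w" for w
  proof -
    have "(f w)\<^sup>2 = (A s x w powr (p / 4) * A s x w powr (p / 4)) * (sqrt (gauss w) * sqrt (gauss w))"
      unfolding f_def by algebra
    then show ?thesis unfolding a1 g2 P_def .
  qed
  have gg: "(g w)\<^sup>2 = Z z e s x w * gauss w" for w
  proof -
    have "(g w)\<^sup>2 = p\<^sup>2 * (A s x w powr (p / 4 - 1) * A s x w powr (p / 4 - 1)) * (H s x w \<bullet> (z * V e s x w))\<^sup>2
        * (sqrt (gauss w) * sqrt (gauss w))"
      unfolding g_def by algebra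
    then show ?thesis unfolding a3 g2 Z_def .
  qed
  have fg: "f w * g w = U z e s x w * gauss w" for w
  proof -
    have "f w * g w = p * (A s x w powr (p / 4) * A s x w powr (p / 4 - 1)) * (H s x w \<bullet> (z * V e s x w))
        * (sqrt (gauss w) * sqrt (gauss w))"
      unfolding f_def g_def by algebra
    then show ?thesis unfolding a2 g2 U_def .
  qed
  show ?thesis
    using integral_mult_square_le[of lborel f g, unfolded ff gg fg, OF intP intZ[OF z e] intU[OF z e]]
    unfolding UI_def GI_def ZI_def .
qed

text \<open>Integration by parts in x. Besides \<open>QI\<close>, differentiating the outer power
  produces the term with \<open>(UI z0 e s x)\<^sup>2\<close>, the only one that is not linear in
  w-integrals; its coefficient \<open>\<alpha> - 1\<close> is nonnegative.\<close>

lemma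
  assumes e: "e \<in> Basis"
  shows integral_inner_UI: "(LBINT x. (x \<bullet> e) * (GI s x powr (\<alpha> - 1) * UI z0 e s x) * gauss x)
    = (LBINT x. sin s * ((\<alpha> - 1) * GI s x powr (\<alpha> - 2) * (UI z0 e s x)\<^sup>2 + GI s x powr (\<alpha> - 1) * QI z0 e s x) * gauss x)"
    and integrable_inner_UI: "integrable lborel (\<lambda>x. (x \<bullet> e) * (GI s x powr (\<alpha> - 1) * UI z0 e s x) * gauss x)"
    and integrable_UI': "integrable lborel (\<lambda>x. sin s * ((\<alpha> - 1) * GI s x powr (\<alpha> - 2) * (UI z0 e s x)\<^sup>2 + GI s x powr (\<alpha> - 1) * QI z0 e s x) * gauss x)"
proof -
  let ?\<phi> = "\<lambda>x. GI s x powr (\<alpha> - 1) * UI z0 e s x"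
  let ?\<phi>' = "\<lambda>x. sin s * ((\<alpha> - 1) * GI s x powr (\<alpha> - 2) * (UI z0 e s x)\<^sup>2 + GI s x powr (\<alpha> - 1) * QI z0 e s x)"
  define c where "c = g1 * (K * N0) + ((\<alpha> - 1) * g2 * (K * N0)\<^sup>2 + g1 * (K * N0))"
  have c': "0 \<le> g1 * (K * N0)" "0 \<le> (\<alpha> - 1) * g2 * (K * N0)\<^sup>2"
    using GI_powr_le KN0 \<alpha> by (auto intro!: mult_nonneg_nonneg)
  have b1: "\<bar>?\<phi> x\<bar> \<le> g1 * (K * N0)" for x
    unfolding abs_mult using GI_powr_le leU[OF norm_z0 e] by (intro mult_mono) auto
  have b2: "\<bar>?\<phi>' x\<bar> \<le> 1 * ((\<alpha> - 1) * g2 * (K * N0)\<^sup>2 + g1 * (K * N0))" for x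
  proof -
    have "\<bar>(\<alpha> - 1) * GI s x powr (\<alpha> - 2) * (UI z0 e s x)\<^sup>2\<bar> \<le> (\<alpha> - 1) * g2 * (K * N0)\<^sup>2"
      unfolding abs_mult using GI_powr_le leU[OF norm_z0 e, of s x] \<alpha> KN0
      by (intro mult_mono) (auto intro: abs_le_square_iff[THEN iffD1])
    moreover have "\<bar>GI s x powr (\<alpha> - 1) * QI z0 e s x\<bar> \<le> g1 * (K * N0)"
      unfolding abs_mult using GI_powr_le leQ[OF norm_z0 e] by (intro mult_mono) auto
    ultimately show ?thesis
      unfolding abs_mult[of "sin _"] using c' by (intro mult_mono) auto
  qed
  have c1: "g1 * (K * N0) \<le> c" "1 * ((\<alpha> - 1) * g2 * (K * N0)\<^sup>2 + g1 * (K * N0)) \<le> c"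
    unfolding c_def mult_1_left
    by (rule le_add_same_cancel1[THEN iffD2, OF add_nonneg_nonneg[OF c'(2) c'(1)]])
      (rule le_add_same_cancel2[THEN iffD2, OF c'(1)])
  have B1: "\<bar>?\<phi> x\<bar> \<le> c * exp (0 * norm x)" for x
    using order_trans[OF b1[of x] c1(1)] by simp
  have B2: "\<bar>?\<phi>' x\<bar> \<le> c * exp (0 * norm x)" for x
    using order_trans[OF b2[of x] c1(2)] by simp
  have der: "((\<lambda>\<tau>. ?\<phi> (x + \<tau> *\<^sub>R e)) has_vector_derivative ?\<phi>' x) (at 0)" for x
  proof -
    have 1: "((\<lambda>\<tau>. GI s (x + \<tau> *\<^sub>R e)) has_real_derivative sin s * UI z0 e s x) (at 0)"
      using has_vector_derivative_GI_x[OF e] by (simp add: has_real_derivative_iff_has_vector_derivative)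
    have 2: "((\<lambda>\<tau>. UI z0 e s (x + \<tau> *\<^sub>R e)) has_real_derivative sin s * QI z0 e s x) (at 0)"
      using has_vector_derivative_UI_x[OF e] by (simp add: has_real_derivative_iff_has_vector_derivative)
    have "((\<lambda>\<tau>. GI s (x + \<tau> *\<^sub>R e) powr (\<alpha> - 1)) has_real_derivative
        (\<alpha> - 1) * GI s x powr (\<alpha> - 2) * (sin s * UI z0 e s x)) (at 0)"
      using DERIV_fun_powr[OF 1, of "\<alpha> - 1"] GI_pos[of s x] by simp
    from DERIV_mult[OF this 2] show ?thesis
      unfolding has_real_derivative_iff_has_vector_derivative[symmetric]
      by (simp add: power2_eq_square algebra_simps)
  qed
  show "(LBINT x. (x \<bullet> e) * ?\<phi> x * gauss x) = (LBINT x. ?\<phi>' x * gauss x)"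
    by (rule integral_gauss_inner_eq[OF _ _ _ der B1 B2]) (use e in auto)
  show "integrable lborel (\<lambda>x. ?\<phi>' x * gauss x)"
    by (rule integrable_exp_growth_gauss[OF _ B2]) measurable
  show "integrable lborel (\<lambda>x. (x \<bullet> e) * ?\<phi> x * gauss x)"
  proof (rule integrable_exp_growth_gauss[where K="g1 * (K * N0)" and C=1])
    fix x :: 'a
    have "\<bar>x \<bullet> e\<bar> \<le> exp (norm x)"
      using Basis_le_norm[OF e, of x] exp_ge_add_one_self[of "norm x"] by linarith
    then have "\<bar>x \<bullet> e\<bar> * \<bar>?\<phi> x\<bar> \<le> exp (norm x) * (g1 * (K * N0))"
      using b1 by (intro mult_mono) auto
    then show "\<bar>(x \<bullet> e) * ?\<phi> x\<bar> \<le> g1 * (K * N0) * exp (1 * norm x)"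
      by (simp add: abs_mult mult.commute)
  qed measurable
qed

text \<open>After both integrations by parts every term carries the common factor sin s cos s.
  Cauchy-Schwarz replaces \<open>UI\<close> squared by \<open>GI\<close> times \<open>ZI\<close>,
  which leaves \<open>GI powr (\<alpha> - 1)\<close> times a single w-integral, and there
  \<open>flow_pointwise_le\<close> applies under the integral sign.\<close>

lemma \<Psi>'_nonpos:
  assumes sc: "0 \<le> sin s * cos s"
  shows "(LBINT x. d\<Psi> s x * gauss x) \<le> 0"
proof -
  let ?d = "\<lambda>b x. - (sin s * cos s) * QI 1 b s x + sin s * cos s * p * SI b s x" and ?B = "g1 * (1 * 1 * (K * N0) + 1 * 1 * 2 * (K * N0))"
  \<comment> \<open>\<open>I\<close> collects the terms free of coordinate factors, \<open>J\<close>
    is the term with \<open>x \<bullet> b\<close>, and \<open>J'\<close> is what integration by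
    parts makes of \<open>J\<close>.\<close>
  define I where "I b x = (GI s x powr (\<alpha> - 1) * ?d b x) * gauss x" for b x
  define J where "J b x = (x \<bullet> b) * (GI s x powr (\<alpha> - 1) * UI z0 b s x) * gauss x" for b x
  define J' where "J' b x = sin s * ((\<alpha> - 1) * GI s x powr (\<alpha> - 2) * (UI z0 b s x)\<^sup>2 + GI s x powr (\<alpha> - 1) * QI z0 b s x) * gauss x" for b x
  have intI: "integrable lborel (I b)" if b: "b \<in> Basis" for b
    unfolding I_def
  proof (rule integrable_exp_growth_gauss[where K="?B" and C=0])
    fix x
    have "\<bar>- (sin s * cos s) * QI 1 b s x\<bar> \<le> 1 * 1 * (K * N0)"
      unfolding abs_mult abs_minus_cancel using leQ[of 1, OF _ b] by (intro mult_mono) auto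
    moreover have "\<bar>sin s * cos s * p * SI b s x\<bar> \<le> 1 * 1 * 2 * (K * N0)"
      unfolding abs_mult using leS[OF b] p by (intro mult_mono) auto
    ultimately have "\<bar>?d b x\<bar> \<le> 1 * 1 * (K * N0) + 1 * 1 * 2 * (K * N0)"
      by (rule order_trans[OF abs_triangle_ineq add_mono])
    then have "\<bar>GI s x powr (\<alpha> - 1)\<bar> * \<bar>?d b x\<bar>
        \<le> ?B"
      using GI_powr_le by (intro mult_mono) auto
    then show "\<bar>GI s x powr (\<alpha> - 1) * ?d b x\<bar>
        \<le> ?B * exp (0 * norm x)"
      by (simp only: abs_mult[of "_ powr _"] mult_zero_left exp_zero mult_1_right)
  qed measurable
  have intJ: "integrable lborel (J b)" and intJ': "integrable lborel (J' b)"
    and JJ': "integral\<^sup>L lborel (J b) = integral\<^sup>L lborel (J' b)" if b: "b \<in> Basis" for b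
    unfolding J_def J'_def by (rule integrable_inner_UI[OF b] integrable_UI'[OF b] integral_inner_UI[OF b])+
  have "(LBINT x. d\<Psi> s x * gauss x) = (LBINT x. \<alpha> * (\<Sum>b\<in>Basis. I b x + cos s * J b x))"
    unfolding d\<Psi>_def dG_def I_def J_def
    by (rule Bochner_Integration.integral_cong) (simp_all add: sum_distrib_left sum_distrib_right algebra_simps)
  also have "\<dots> = \<alpha> * (\<Sum>b\<in>Basis. (LBINT x. I b x) + cos s * (LBINT x. J b x))"
    by (simp add: Bochner_Integration.integral_sum intI intJ)
  also have "\<dots> = \<alpha> * (\<Sum>b\<in>Basis. (LBINT x. I b x + cos s * J' b x))"
    by (intro arg_cong[where f="\<lambda>t. \<alpha> * t"] sum.cong) (simp_all add: intI intJ' JJ')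
  also have "\<dots> \<le> \<alpha> * 0"
  proof (intro mult_left_mono sum_nonpos)
    fix b :: 'a assume b: "b \<in> Basis"
    have "I b x + cos s * J' b x \<le> 0" for x
    proof -
      let ?G = "GI s x"
      have G: "?G powr (\<alpha> - 1) = ?G powr (\<alpha> - 2) * ?G"
        using GI_pos[of s x] powr_add[of ?G "\<alpha> - 2" 1] by simp
      have "?G powr (\<alpha> - 2) * (UI z0 b s x)\<^sup>2 \<le> ?G powr (\<alpha> - 2) * (?G * ZI z0 b s x)"
        by (intro mult_left_mono UI_square_le[OF norm_z0 b]) auto
      then have "(\<alpha> - 1) * (?G powr (\<alpha> - 2) * (UI z0 b s x)\<^sup>2) \<le> (\<alpha> - 1) * (?G powr (\<alpha> - 1) * ZI z0 b s x)"
        using \<alpha> unfolding G by (intro mult_left_mono) (auto simp: mult.assoc)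
      moreover have "?G powr (\<alpha> - 1) * (QI z0 b s x - QI 1 b s x + p * SI b s x + (\<alpha> - 1) * ZI z0 b s x) \<le> 0"
      proof (rule mult_nonneg_nonpos)
        have "QI z0 b s x - QI 1 b s x + p * SI b s x + (\<alpha> - 1) * ZI z0 b s x
          = (LBINT w. Q z0 b s x w * gauss w - Q 1 b s x w * gauss w + p * (S b s x w * gauss w) + (\<alpha> - 1) * (Z z0 b s x w * gauss w))"
          unfolding QI_def SI_def ZI_def
          using intQ[OF norm_z0 b, of s x] intQ[of 1, OF _ b, of s x] intS[OF b, of s x] intZ[OF norm_z0 b, of s x]
          by simp
        also have "\<dots> = (LBINT w. (Q z0 b s x w - Q 1 b s x w + p * S b s x w + (\<alpha> - 1) * Z z0 b s x w) * gauss w)"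
          by (simp add: algebra_simps)
        also have "\<dots> \<le> (\<integral>w. 0 \<partial>(lborel :: 'a measure))"
        proof (rule integral_mono')
          show "(Q z0 b s x w - Q 1 b s x w + p * S b s x w + (\<alpha> - 1) * Z z0 b s x w) * gauss w \<le> 0" for w
            unfolding Q_def S_def Z_def A_def \<alpha>_def z0_def
            by (rule mult_nonpos_nonneg[OF flow_pointwise_le[OF p \<omega>(3) eps] gauss_pos(2)])
        qed auto
        finally show "QI z0 b s x - QI 1 b s x + p * SI b s x + (\<alpha> - 1) * ZI z0 b s x \<le> 0" by simp
      qed simp
      ultimately have "(\<alpha> - 1) * (?G powr (\<alpha> - 2) * (UI z0 b s x)\<^sup>2) + ?G powr (\<alpha> - 1) * (QI z0 b s x - QI 1 b s x + p * SI b s x) \<le> 0"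
        by (simp add: algebra_simps)
      then have "sin s * cos s * ((\<alpha> - 1) * (?G powr (\<alpha> - 2) * (UI z0 b s x)\<^sup>2)
          + ?G powr (\<alpha> - 1) * (QI z0 b s x - QI 1 b s x + p * SI b s x)) * gauss x \<le> 0"
        by (rule mult_nonpos_nonneg[OF mult_nonneg_nonpos[OF sc] gauss_pos(2)])
      moreover have "(g * (- (s * c) * q1 + s * c * p * t)) * y + c * (s * ((a - 1) * g' * u\<^sup>2 + g * q) * y)
          = s * c * ((a - 1) * (g' * u\<^sup>2) + g * (q - q1 + p * t)) * y" for g g' s c q q1 t y a u :: real
        by algebra
      ultimately show ?thesis unfolding I_def J'_def by simp
    qed
    then have "(LBINT x. I b x + cos s * J' b x) \<le> (\<integral>x. 0 \<partial>(lborel :: 'a measure))"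
      by (intro integral_mono') auto
    also have "\<dots> = 0" by simp
    finally show "(LBINT x. I b x + cos s * J' b x) \<le> 0" .
  qed (use \<alpha> in auto)
  finally show ?thesis unfolding mult_zero_right .
qed

lemma \<Psi>_antimono_aux: "\<Psi> (pi / 2) \<le> \<Psi> 0"
proof (rule DERIV_nonpos_imp_nonincreasing[where f=\<Psi>])
  fix s :: real assume "0 \<le> s" "s \<le> pi / 2"
  then have "0 \<le> sin s * cos s" by (intro mult_nonneg_nonneg sin_ge_zero cos_ge_zero) auto
  then show "\<exists>y. (\<Psi> has_real_derivative y) (at s) \<and> y \<le> 0"
    using has_vector_derivative_\<Psi> \<Psi>'_nonpos by (auto simp: has_real_derivative_iff_has_vector_derivative)
qed simp

end

lemma \<Psi>_antimono: "\<Psi> (pi / 2) \<le> \<Psi> 0"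
  by (rule flow_bounds) (rule \<Psi>_antimono_aux)

text \<open>The powers of N come from unnormalised Gaussians. At s = pi / 2 nothing depends on w, so
  the inner integral contributes N and the outer power makes it N^\<alpha>; at s = 0 nothing depends
  on x, and the outer integral contributes a single N.\<close>

lemma gauss_flow_inequality:
  defines "N \<equiv> sqrt (2 * pi) ^ DIM('a)"
  shows "N powr (1 / (p - 1)) * (LBINT x. ((norm (\<integral>a. of_real (exp (p / 2 * (a \<bullet> a))) * iexp (sqrt (p - 1) * (x \<bullet> a)) \<partial>M))\<^sup>2 + \<epsilon>\<^sup>2) powr (p / (2 * (p - 1))) * gauss x)
    \<le> N * (LBINT w. ((\<integral>a. exp (w \<bullet> a) \<partial>M)\<^sup>2 + \<epsilon>\<^sup>2) powr (p / 2) * gauss w) powr (1 / (p - 1))"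
    (is "_ * ?J \<le> _ * ?K powr _")
proof -
  have N: "N = (LBINT w. gauss (w::'a))" "0 < N"
    by (simp_all add: N_def integral_gauss)
  have E: "E w x t a = of_real (exp (w \<bullet> a + t * (a \<bullet> a))) * iexp (x \<bullet> a)" for w x t a
    unfolding E_def by (simp only: exp_add exp_of_real)
  have H1: "H (pi / 2) x w = (\<integral>a. of_real (exp (p / 2 * (a \<bullet> a))) * iexp (sqrt (p - 1) * (x \<bullet> a)) \<partial>M)" for x w
    unfolding F_def L_def E \<omega>_def by simp
  have H0: "H 0 x w = of_real (\<integral>a. exp (w \<bullet> a) \<partial>M)" for x w
    unfolding F_def L_def E by simp
  have "GI (pi / 2) x = P (pi / 2) x 0 * N" for x
    unfolding GI_def P_def A_def H1 N by simp
  then have "\<Psi> (pi / 2) = (LBINT x. N powr \<alpha> * (P (pi / 2) x 0 powr \<alpha> * gauss x))"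
    unfolding \<Psi>_def using N(2) by (simp add: powr_mult P_def ac_simps)
  also have "\<dots> = N powr (1 / (p - 1)) * ?J"
    unfolding P_def A_def H1 powr_powr \<alpha>_def by simp
  finally have 1: "\<Psi> (pi / 2) = \<dots>" .
  have G0: "GI 0 x = GI 0 0" for x unfolding GI_def P_def A_def H0 ..
  have "\<Psi> 0 = (LBINT x. GI 0 0 powr \<alpha> * gauss (x::'a))"
    unfolding \<Psi>_def by (rule Bochner_Integration.integral_cong[OF refl]) (subst G0, rule refl)
  also have "\<dots> = N * GI 0 0 powr \<alpha>" unfolding N by simp
  also have "GI 0 0 = ?K"
    unfolding GI_def P_def A_def H0 by simp
  finally show ?thesis using \<Psi>_antimono unfolding 1 \<alpha>_def by simp
qed

end

section \<open>The sharp Hausdorff-Young inequality\<close>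

text \<open>Convexity of exp at the logarithms of the \<open>y i\<close>. A vanishing factor has no
  logarithm and is treated apart.\<close>

lemma prod_powr_le_weighted_sum:
  fixes y :: "'i \<Rightarrow> real"
  assumes "finite I" "\<And>i. i \<in> I \<Longrightarrow> 0 < \<theta> i" "(\<Sum>i\<in>I. \<theta> i) = 1" "\<And>i. i \<in> I \<Longrightarrow> 0 \<le> y i"
  shows "(\<Prod>i\<in>I. y i powr \<theta> i) \<le> (\<Sum>i\<in>I. \<theta> i * y i)"
proof (cases "\<exists>i\<in>I. y i = 0")
  case True
  then have "(\<Prod>i\<in>I. y i powr \<theta> i) = 0" using \<open>finite I\<close> by (auto simp: prod_zero_iff)
  also have "0 \<le> (\<Sum>i\<in>I. \<theta> i * y i)"
    using assms(2,4) by (intro sum_nonneg mult_nonneg_nonneg) (auto intro: less_imp_le)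
  finally show ?thesis .
next
  case False
  then have pos: "0 < y i" if "i \<in> I" for i using assms(4)[OF that] that by force
  have "(\<Prod>i\<in>I. y i powr \<theta> i) = exp (\<Sum>i\<in>I. \<theta> i * ln (y i))"
    unfolding exp_sum[OF \<open>finite I\<close>] by (intro prod.cong refl) (metis pos powr_def less_irrefl)
  also have "\<dots> \<le> (\<Sum>i\<in>I. \<theta> i * exp (ln (y i)))"
    using convex_on_sum[OF \<open>finite I\<close> _ exp_convex, of \<theta> "\<lambda>i. ln (y i)"] assms(2,3)
    by (cases "I = {}") (auto simp: less_imp_le)
  also have "\<dots> = (\<Sum>i\<in>I. \<theta> i * y i)" using pos by (intro sum.cong) auto
  finally show ?thesis .
qed

text \<open>Divide each factor by its bound and integrate the weighted arithmetic-geometric mean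
  inequality. The bounds \<open>c i\<close> replace the integrals themselves because Hausdorff-Young
  delivers upper bounds. Where some \<open>c i\<close> is 0, division fails, but then
  \<open>u i\<close> vanishes almost everywhere.\<close>

lemma nn_integral_Holder:
  fixes u :: "'i \<Rightarrow> 'a \<Rightarrow> real"
  assumes "finite I" and \<theta>: "\<And>i. i \<in> I \<Longrightarrow> 0 < \<theta> i" "(\<Sum>i\<in>I. \<theta> i) = 1"
    and [measurable]: "\<And>i. i \<in> I \<Longrightarrow> u i \<in> borel_measurable M"
    and u: "\<And>i x. i \<in> I \<Longrightarrow> 0 \<le> u i x" and c: "\<And>i. i \<in> I \<Longrightarrow> 0 \<le> c i"
    and le: "\<And>i. i \<in> I \<Longrightarrow> (\<integral>\<^sup>+x. ennreal (u i x) \<partial>M) \<le> ennreal (c i)"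
  shows "(\<integral>\<^sup>+x. ennreal (\<Prod>i\<in>I. u i x powr \<theta> i) \<partial>M) \<le> ennreal (\<Prod>i\<in>I. c i powr \<theta> i)"
proof (cases "\<exists>i\<in>I. c i = 0")
  case True
  then obtain i where i: "i \<in> I" "c i = 0" by auto
  then have "(\<integral>\<^sup>+x. ennreal (u i x) \<partial>M) = 0" using le[OF i(1)] by simp
  then have "AE x in M. ennreal (u i x) = 0" using i(1) by (subst (asm) nn_integral_0_iff_AE) auto
  then have "AE x in M. ennreal (\<Prod>i\<in>I. u i x powr \<theta> i) = 0"
  proof eventually_elim
    case (elim x)
    then have "u i x = 0" using u[OF i(1), of x] by (simp add: ennreal_eq_0_iff)
    then have "(\<Prod>i\<in>I. u i x powr \<theta> i) = 0" using i(1) \<open>finite I\<close> by (auto simp: prod_zero_iff)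
    then show ?case by simp
  qed
  then show ?thesis by (subst nn_integral_cong_AE) auto
next
  case False
  then have pos: "0 < c i" if "i \<in> I" for i using c[OF that] that by force
  define P where "P = (\<Prod>i\<in>I. c i powr \<theta> i)"
  have P: "0 \<le> P" unfolding P_def by (intro prod_nonneg) auto
  have "(\<integral>\<^sup>+x. ennreal (\<Prod>i\<in>I. u i x powr \<theta> i) \<partial>M) \<le> (\<integral>\<^sup>+x. ennreal P * (\<Sum>i\<in>I. ennreal (\<theta> i / c i) * ennreal (u i x)) \<partial>M)"
  proof (rule nn_integral_mono)
    fix x
    have "(\<Prod>i\<in>I. u i x powr \<theta> i) = P * (\<Prod>i\<in>I. (u i x / c i) powr \<theta> i)"
      unfolding P_def prod.distrib[symmetric]
      using pos u by (intro prod.cong) (auto simp: powr_divide less_imp_le dest!: pos)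
    also have "\<dots> \<le> P * (\<Sum>i\<in>I. \<theta> i * (u i x / c i))"
      using \<theta> pos u P \<open>finite I\<close> by (intro mult_left_mono prod_powr_le_weighted_sum) (auto simp: less_imp_le)
    finally have "ennreal (\<Prod>i\<in>I. u i x powr \<theta> i) \<le> ennreal (P * (\<Sum>i\<in>I. \<theta> i / c i * u i x))"
      by (intro ennreal_leI) simp
    also have "\<dots> = ennreal P * ennreal (\<Sum>i\<in>I. \<theta> i / c i * u i x)"
      using P by (rule ennreal_mult')
    also have "ennreal (\<Sum>i\<in>I. \<theta> i / c i * u i x) = (\<Sum>i\<in>I. ennreal (\<theta> i / c i * u i x))"
      using \<theta> pos u by (intro sum_ennreal[symmetric] mult_nonneg_nonneg divide_nonneg_nonneg) (auto simp: less_imp_le)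
    also have "\<dots> = (\<Sum>i\<in>I. ennreal (\<theta> i / c i) * ennreal (u i x))"
      using \<theta> pos u by (intro sum.cong refl ennreal_mult) (auto simp: less_imp_le)
    finally show "ennreal (\<Prod>i\<in>I. u i x powr \<theta> i) \<le> ennreal P * (\<Sum>i\<in>I. ennreal (\<theta> i / c i) * ennreal (u i x))" .
  qed
  also have "\<dots> = ennreal P * (\<Sum>i\<in>I. ennreal (\<theta> i / c i) * (\<integral>\<^sup>+x. ennreal (u i x) \<partial>M))"
    by (simp add: nn_integral_cmult nn_integral_sum)
  also have "\<dots> \<le> ennreal P * (\<Sum>i\<in>I. ennreal (\<theta> i / c i) * ennreal (c i))"
    by (intro mult_left_mono sum_mono le) auto
  also have "(\<Sum>i\<in>I. ennreal (\<theta> i / c i) * ennreal (c i)) = (\<Sum>i\<in>I. ennreal (\<theta> i))"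
    using pos \<theta> by (intro sum.cong refl) (subst ennreal_mult[symmetric]; force simp: less_imp_le)
  also have "\<dots> = 1" using \<theta> by (simp add: sum_ennreal less_imp_le)
  finally show ?thesis by (simp add: P_def)
qed

lemma nn_integral_Holder2:
  fixes u v :: "'a \<Rightarrow> real"
  assumes "0 < a" "0 < b" "a + b = 1" "u \<in> borel_measurable M" "v \<in> borel_measurable M"
    and "\<And>x. 0 \<le> u x" "\<And>x. 0 \<le> v x" "0 \<le> c" "0 \<le> d"
    and "(\<integral>\<^sup>+x. ennreal (u x) \<partial>M) \<le> ennreal c" "(\<integral>\<^sup>+x. ennreal (v x) \<partial>M) \<le> ennreal d"
  shows "(\<integral>\<^sup>+x. ennreal (u x powr a * v x powr b) \<partial>M) \<le> ennreal (c powr a * d powr b)"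
proof -
  have "(\<integral>\<^sup>+x. ennreal (\<Prod>i\<in>{True, False}. (if i then u x else v x) powr (if i then a else b)) \<partial>M)
    \<le> ennreal (\<Prod>i\<in>{True, False}. (if i then c else d) powr (if i then a else b))"
    using assms by (intro nn_integral_Holder) auto
  then show ?thesis by simp
qed

text \<open>On [0, 1] one has t \<le> t^r; apply this to the two fractions of u + v. With r = p / 2
  it separates \<epsilon> from the modulus.\<close>

lemma powr_add_le:
  fixes u v r :: real
  assumes "0 \<le> u" "0 \<le> v" "0 < r" "r \<le> 1"
  shows "(u + v) powr r \<le> u powr r + v powr r"
proof (cases "u + v = 0")
  case True
  then have "u = 0" "v = 0" using assms by auto
  then show ?thesis by simp
next
  case False
  then have s: "0 < u + v" using assms by simp
  have le: "t / (u + v) \<le> (t / (u + v)) powr r" if "0 \<le> t" "t \<le> u + v" for t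
    using powr_mono'[of r 1 "t / (u + v)"] that assms s by (simp add: field_simps)
  have "1 = u / (u + v) + v / (u + v)" using s by (simp add: add_divide_distrib[symmetric])
  also have "\<dots> \<le> (u / (u + v)) powr r + (v / (u + v)) powr r"
    using assms by (intro add_mono le) auto
  also have "\<dots> = (u powr r + v powr r) / (u + v) powr r"
    using assms s by (simp add: powr_divide add_divide_distrib)
  finally show ?thesis using s by (simp add: field_simps)
qed

text \<open>Letting \<epsilon> tend to 0. On the left \<epsilon> is dropped by monotonicity; on the
  right subadditivity of t^(p/2) shows that it costs at most \<epsilon>^p N inside the integral, and
  this vanishes along \<epsilon> = 1 / (n + 1).\<close>

lemma gauss_flow_limit:
  fixes M :: "'a::euclidean_space measure"
  assumes M: "finite_measure M" "sets M = sets borel" "AE a in M. norm a \<le> R" and R: "1 \<le> R"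
    and p: "1 < p" "p \<le> 2"
  defines "N \<equiv> sqrt (2 * pi) ^ DIM('a)" and "q \<equiv> p / (p - 1)"
    and "T \<equiv> \<lambda>x. norm (\<integral>a. of_real (exp (p / 2 * (a \<bullet> a))) * iexp (sqrt (p - 1) * (x \<bullet> a)) \<partial>M)" and "h \<equiv> \<lambda>w. \<integral>a. exp (w \<bullet> a) \<partial>M"
  shows "N powr (1 / (p - 1)) * (LBINT x. T x powr q * gauss x)
      \<le> N * (LBINT w. h w powr p * gauss w) powr (1 / (p - 1))"
    and "integrable lborel (\<lambda>x. T x powr q * gauss x)"
    and "integrable lborel (\<lambda>w. h w powr p * gauss w)"
proof -
  interpret finite_measure M by fact
  note M(2)[measurable_cong]
  have space_M: "space M = UNIV" using sets_eq_imp_space_eq[OF M(2)] by simp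
  have [measurable]: "T \<in> borel_measurable borel" "h \<in> borel_measurable borel"
    unfolding T_def[abs_def] h_def[abs_def] by measurable
  have q: "0 < q" using p by (simp add: q_def)
  have h0: "0 \<le> h w" for w unfolding h_def by simp
  define m where "m = measure M UNIV"
  have m: "0 \<le> m" by (simp add: m_def)
  have T: "T x \<le> exp (p / 2 * R\<^sup>2) * m" for x
  proof -
    have "T x \<le> (\<integral>a. exp (p / 2 * R\<^sup>2) \<partial>M)"
      unfolding T_def
    proof (rule order_trans[OF integral_norm_bound], rule integral_mono_AE')
      show "AE a in M. norm (of_real (exp (p / 2 * (a \<bullet> a))) * iexp (sqrt (p - 1) * (x \<bullet> a))) \<le> exp (p / 2 * R\<^sup>2)"
        using M(3)
      proof eventually_elim
        case (elim a)
        have "p / 2 * (a \<bullet> a) \<le> p / 2 * R\<^sup>2"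
          unfolding power2_norm_eq_inner[symmetric] using elim p by (intro mult_left_mono power_mono) auto
        then show ?case by (simp add: norm_mult)
      qed
    qed auto
    then show ?thesis by (simp add: m_def space_M mult.commute)
  qed
  have h: "h w \<le> m * exp (R * norm w)" for w
  proof -
    have "h w \<le> (\<integral>a. exp (R * norm w) \<partial>M)"
      unfolding h_def
    proof (rule integral_mono_AE')
      show "AE a in M. exp (w \<bullet> a) \<le> exp (R * norm w)"
        using M(3)
      proof eventually_elim
        case (elim a)
        have "w \<bullet> a \<le> norm w * norm a" by (rule norm_cauchy_schwarz)
        also have "\<dots> \<le> R * norm w" using elim by (simp add: mult.commute mult_right_mono)
        finally show ?case by simp
      qed
    qed auto
    then show ?thesis by (simp add: m_def space_M)
  qed
  define B where "B = exp (p / 2 * R\<^sup>2) * m"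
  have intT: "integrable lborel (\<lambda>x. ((T x)\<^sup>2 + \<epsilon>) powr (q / 2) * gauss x)" if "0 \<le> \<epsilon>" for \<epsilon>
  proof (rule integrable_exp_growth_gauss[where K="(B\<^sup>2 + \<epsilon>) powr (q / 2)" and C=0])
    fix x
    have "(T x)\<^sup>2 \<le> B\<^sup>2" using T by (intro power_mono) (auto simp: T_def B_def)
    then show "\<bar>((T x)\<^sup>2 + \<epsilon>) powr (q / 2)\<bar> \<le> (B\<^sup>2 + \<epsilon>) powr (q / 2) * exp (0 * norm x)"
      using q that by (auto intro!: powr_mono2)
  qed measurable
  have T2: "((T x)\<^sup>2 + 0) powr (q / 2) = T x powr q" for x
    using powr_powr[of "T x" 2 "q / 2"] by (simp add: T_def)
  have h2: "((h w)\<^sup>2) powr (p / 2) = h w powr p" for w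
    using powr_powr[of "h w" 2 "p / 2"] h0[of w] by simp
  have inth: "integrable lborel (\<lambda>w. h w powr p * gauss w)"
  proof (rule integrable_exp_growth_gauss[where K="m powr p" and C="R * p"])
    fix w
    have "h w powr p \<le> (m * exp (R * norm w)) powr p" using h h0 p by (intro powr_mono2) auto
    also have "\<dots> = m powr p * exp (R * p * norm w)"
      using m by (simp add: powr_mult exp_powr_real ac_simps)
    finally show "\<bar>h w powr p\<bar> \<le> m powr p * exp (R * p * norm w)" by simp
  qed measurable
  have N: "N = (LBINT w. gauss (w::'a))" "0 < N"
    by (simp_all add: N_def integral_gauss)
  have step: "N powr (1 / (p - 1)) * (LBINT x. T x powr q * gauss x)
      \<le> N * ((LBINT w. h w powr p * gauss w) + \<epsilon> powr p * N) powr (1 / (p - 1))" if \<epsilon>: "0 < \<epsilon>" for \<epsilon>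
  proof -
    interpret gauss_flow M R p \<epsilon>
      by unfold_locales (use assms \<epsilon> in auto)
    have "(LBINT x. T x powr q * gauss x) \<le> (LBINT x. ((T x)\<^sup>2 + \<epsilon>\<^sup>2) powr (q / 2) * gauss x)"
      using intT[of 0] intT[of "\<epsilon>\<^sup>2"] q unfolding T2[symmetric]
      by (intro integral_mono mult_right_mono powr_mono2) auto
    then have "N powr (1 / (p - 1)) * (LBINT x. T x powr q * gauss x) \<le> N powr (1 / (p - 1)) * (LBINT x. ((T x)\<^sup>2 + \<epsilon>\<^sup>2) powr (q / 2) * gauss x)"
      by (intro mult_left_mono) auto
    also have "\<dots> \<le> N * (LBINT w. ((h w)\<^sup>2 + \<epsilon>\<^sup>2) powr (p / 2) * gauss w) powr (1 / (p - 1))"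
      using gauss_flow_inequality unfolding T_def h_def N_def q_def by (simp add: mult.commute)
    also have "N * (LBINT w. ((h w)\<^sup>2 + \<epsilon>\<^sup>2) powr (p / 2) * gauss w) powr (1 / (p - 1)) \<le> N * ((LBINT w. h w powr p * gauss w) + \<epsilon> powr p * N) powr (1 / (p - 1))"
    proof (intro mult_left_mono powr_mono2)
      have "(LBINT w. ((h w)\<^sup>2 + \<epsilon>\<^sup>2) powr (p / 2) * gauss w) \<le> (LBINT w. h w powr p * gauss w + \<epsilon> powr p * gauss w)"
      proof (rule integral_mono')
        show "integrable lborel (\<lambda>w. h w powr p * gauss w + \<epsilon> powr p * gauss w)"
          by (intro Bochner_Integration.integrable_add inth integrable_mult_right integrable_gauss)
        fix w
        have "((h w)\<^sup>2 + \<epsilon>\<^sup>2) powr (p / 2) \<le> ((h w)\<^sup>2) powr (p / 2) + (\<epsilon>\<^sup>2) powr (p / 2)"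
          using p by (intro powr_add_le) auto
        also have "(\<epsilon>\<^sup>2) powr (p / 2) = \<epsilon> powr p" using powr_powr[of \<epsilon> 2 "p / 2"] \<epsilon> by simp
        finally show "((h w)\<^sup>2 + \<epsilon>\<^sup>2) powr (p / 2) * gauss w \<le> h w powr p * gauss w + \<epsilon> powr p * gauss w"
          unfolding h2 distrib_right[symmetric] by (intro mult_right_mono) auto
      qed auto
      also have "\<dots> = (LBINT w. h w powr p * gauss w) + \<epsilon> powr p * N"
        using inth integrable_gauss N(1) by (subst Bochner_Integration.integral_add) auto
      finally show "(LBINT w. ((h w)\<^sup>2 + \<epsilon>\<^sup>2) powr (p / 2) * gauss w) \<le> (LBINT w. h w powr p * gauss w) + \<epsilon> powr p * N" .
    qed (use N(2) p in auto)
    finally show ?thesis .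
  qed
  have lim: "(\<lambda>n. N * ((LBINT w. h w powr p * gauss w) + (1 / real (Suc n)) powr p * N) powr (1 / (p - 1)))
      \<longlonglongrightarrow> N * ((LBINT w. h w powr p * gauss w) + 0 powr p * N) powr (1 / (p - 1))"
  proof (intro tendsto_mult tendsto_powr' tendsto_add tendsto_const disjI2 conjI)
    show "\<forall>\<^sub>F n in sequentially. 0 \<le> (LBINT w. h w powr p * gauss w) + (1 / real (Suc n)) powr p * N"
      using N(2) by (intro always_eventually allI add_nonneg_nonneg integral_nonneg_AE) auto
    show "(\<lambda>n. 1 / real (Suc n)) \<longlonglongrightarrow> 0" by (rule LIMSEQ_Suc[OF lim_1_over_n])
  qed (use p in auto)
  have "N powr (1 / (p - 1)) * (LBINT x. T x powr q * gauss x)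
    \<le> N * ((LBINT w. h w powr p * gauss w) + 0 powr p * N) powr (1 / (p - 1))"
    by (rule LIMSEQ_le_const[OF lim]) (use step in auto)
  then show "N powr (1 / (p - 1)) * (LBINT x. T x powr q * gauss x)
      \<le> N * (LBINT w. h w powr p * gauss w) powr (1 / (p - 1))"
    by simp
  show "integrable lborel (\<lambda>x. T x powr q * gauss x)" "integrable lborel (\<lambda>w. h w powr p * gauss w)"
    using intT[of 0] inth unfolding T2 by simp_all
qed

text \<open>The convention without 2 pi in the exponent and without a prefactor; this is why (2
  pi)^n appears in the Hausdorff-Young and Parseval statements.\<close>

definition fourier :: "('a::euclidean_space \<Rightarrow> real) \<Rightarrow> 'a \<Rightarrow> complex"
  where "fourier f \<xi> = (LBINT x. of_real (f x) * iexp (\<xi> \<bullet> x))"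

lemma measurable_fourier [measurable]:
  assumes [measurable]: "f \<in> borel_measurable borel"
  shows "fourier f \<in> borel_measurable borel"
  unfolding fourier_def[abs_def] by measurable

lemma norm_fourier_le:
  assumes f: "integrable lborel f" "\<And>x. 0 \<le> f x"
  shows "norm (fourier f \<xi>) \<le> (LBINT x. f x)"
  unfolding fourier_def
  by (rule order_trans[OF integral_norm_bound]) (simp add: norm_mult f(2))

lemma nn_integral_gauss_affine:
  fixes t :: "'a::euclidean_space"
  assumes "c \<noteq> 0"
  shows "(\<integral>\<^sup>+x. ennreal (gauss (t + c *\<^sub>R x)) \<partial>lborel) = ennreal (sqrt (2 * pi) ^ DIM('a) / \<bar>c\<bar> ^ DIM('a))"
proof -
  have "ennreal (sqrt (2 * pi) ^ DIM('a)) = (\<integral>\<^sup>+x. ennreal (gauss (x::'a)) \<partial>lborel)"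
    by (subst nn_integral_eq_integral[OF integrable_gauss]) (auto simp: integral_gauss)
  also have "\<dots> = ennreal (\<bar>c\<bar> ^ DIM('a)) * (\<integral>\<^sup>+x. ennreal (gauss (t + c *\<^sub>R x)) \<partial>lborel)"
    by (rule nn_integral_lborel_affine[OF _ assms]) simp
  finally have "ennreal (1 / \<bar>c\<bar> ^ DIM('a)) * ennreal (sqrt (2 * pi) ^ DIM('a))
    = ennreal (1 / \<bar>c\<bar> ^ DIM('a) * \<bar>c\<bar> ^ DIM('a)) * (\<integral>\<^sup>+x. ennreal (gauss (t + c *\<^sub>R x)) \<partial>lborel)"
    by (simp only: ennreal_mult[OF divide_nonneg_nonneg zero_le_power_abs] zero_le_one zero_le_power_abs mult.assoc)
  then show ?thesis using assms by (simp add: ennreal_mult'[symmetric])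
qed

text \<open>The flow is applied to k tilted by a Gaussian. At s = pi / 2 the tilt cancels the growth
  factor and leaves the Fourier transform of k at sqrt (p - 1) x. At s = 0 it combines with the
  weight into a Gaussian mean of k, whose L^p norm is controlled by that of k.\<close>

lemma hausdorff_young_gauss:
  fixes k :: "'a::euclidean_space \<Rightarrow> real"
  assumes p: "1 < p" "p \<le> 2" and R: "1 \<le> R"
    and k: "integrable lborel k" "\<And>a. 0 \<le> k a" "\<And>a. R < norm a \<Longrightarrow> k a = 0"
    and D: "0 \<le> D" "(\<integral>\<^sup>+a. ennreal (k a powr p) \<partial>lborel) \<le> ennreal D"
  shows "(\<integral>\<^sup>+x. ennreal (norm (fourier k (sqrt (p - 1) *\<^sub>R x)) powr (p / (p - 1)) * gauss x) \<partial>lborel)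
    \<le> ennreal ((2 * pi) ^ DIM('a) * (sqrt p ^ DIM('a)) powr (1 / (p - 1) - 1) * D powr (1 / (p - 1)))"
proof -
  have [measurable]: "k \<in> borel_measurable borel" using borel_measurable_integrable[OF k(1)] by simp
  define M where "M = density lborel (\<lambda>a. ennreal (k a * exp (- (p / 2) * (a \<bullet> a))))"
  define N where "N = sqrt (2 * pi) ^ DIM('a)"
  define s where "s = sqrt p ^ DIM('a)"
  have N: "0 < N" by (simp add: N_def)
  have s: "0 < s" using p by (simp add: s_def)
  have "emeasure M UNIV = (\<integral>\<^sup>+a. ennreal (k a * exp (- (p / 2) * (a \<bullet> a))) \<partial>lborel)"
    unfolding M_def by (subst emeasure_density) auto
  also have "\<dots> \<le> (\<integral>\<^sup>+a. ennreal (k a) \<partial>lborel)"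
    using p k(2) by (intro nn_integral_mono ennreal_leI mult_left_le) auto
  also have "\<dots> < \<infinity>"
    using k(1,2) by (simp add: nn_integral_eq_integral)
  finally have fin: "finite_measure M"
    by (intro finite_measureI) (simp add: M_def)
  have sets_M: "sets M = sets borel" by (simp add: M_def)
  have "k a = 0" if "\<not> norm a \<le> R" for a using k(3) that by simp
  then have supp: "AE a in M. norm a \<le> R"
    unfolding M_def by (subst AE_density) (auto intro!: AE_I2, metis mult_zero_left ennreal_0 less_irrefl not_le)
  note flow = gauss_flow_limit[OF fin sets_M supp R p]
  have T: "(\<integral>a. of_real (exp (p / 2 * (a \<bullet> a))) * iexp (sqrt (p - 1) * (x \<bullet> a)) \<partial>M) = fourier k (sqrt (p - 1) *\<^sub>R x)" for x
  proof -
    let ?k = "\<lambda>a. k a * exp (- (p / 2) * (a \<bullet> a))"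
    let ?z = "\<lambda>a. complex_of_real (exp (p / 2 * (a \<bullet> a))) * iexp (sqrt (p - 1) * (x \<bullet> a))"
    have "(\<integral>a. ?z a \<partial>M)
      = (LBINT a. ?k a *\<^sub>R ?z a)"
      unfolding M_def using k(2) by (subst integral_density) auto
    also have "\<dots> = (LBINT a. of_real (k a) * iexp (sqrt (p - 1) * (x \<bullet> a)))"
    proof (rule Bochner_Integration.integral_cong[OF refl])
      fix a :: 'a
      have e: "exp (- (p / 2) * (a \<bullet> a)) * exp (p / 2 * (a \<bullet> a)) = 1"
        by (simp add: exp_add[symmetric])
      have "?k a *\<^sub>R ?z a
        = of_real (k a * (exp (- (p / 2) * (a \<bullet> a)) * exp (p / 2 * (a \<bullet> a)))) * iexp (sqrt (p - 1) * (x \<bullet> a))"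
        by (simp only: scaleR_conv_of_real of_real_mult mult.assoc)
      then show "?k a *\<^sub>R ?z a
        = of_real (k a) * iexp (sqrt (p - 1) * (x \<bullet> a))"
        unfolding e by simp
    qed
    finally show ?thesis by (simp add: fourier_def)
  qed
  define h where "h w = (\<integral>a. exp (w \<bullet> a) \<partial>M)" for w
  \<comment> \<open>Completing the square: -(p / 2) |a|^2 + w.a - |w|^2 / (2 p) = -|w / sqrt p -
    sqrt p a|^2 / 2. Here -|w|^2 / (2 p) is the p-th root of the Gaussian weight. The kernel has
    mass N / s in a and N s in w.\<close>
  define g where "g w a = gauss ((1 / sqrt p) *\<^sub>R w - sqrt p *\<^sub>R a)" for w a :: 'a
  have [measurable]: "(\<lambda>a. g w a) \<in> borel_measurable borel" "(\<lambda>(a, w). g w a) \<in> borel_measurable (borel \<Otimes>\<^sub>M borel)"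
    "(\<lambda>(w, a). g w a) \<in> borel_measurable (borel \<Otimes>\<^sub>M borel)" for w
    unfolding g_def by measurable
  have hg: "h w * gauss w powr (1 / p) = (LBINT a. k a * g w a)" for w
  proof -
    have "h w = (LBINT a. (k a * exp (- (p / 2) * (a \<bullet> a))) * exp (w \<bullet> a))"
      unfolding h_def M_def using k(2) by (subst integral_density) auto
    then have "h w * gauss w powr (1 / p) = (LBINT a. (k a * exp (- (p / 2) * (a \<bullet> a))) * exp (w \<bullet> a) * gauss w powr (1 / p))"
      by simp
    also have "(\<lambda>a. (k a * exp (- (p / 2) * (a \<bullet> a))) * exp (w \<bullet> a) * gauss w powr (1 / p)) = (\<lambda>a. k a * g w a)"
    proof
      fix a
      have "exp (- (p / 2) * (a \<bullet> a)) * exp (w \<bullet> a) * gauss w powr (1 / p) = g w a"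
        unfolding g_def gauss_def exp_powr_real exp_add[symmetric]
        using p by (simp add: inner_diff_left inner_diff_right inner_commute field_simps)
      then show "(k a * exp (- (p / 2) * (a \<bullet> a))) * exp (w \<bullet> a) * gauss w powr (1 / p) = k a * g w a"
        by (simp add: mult.assoc)
    qed
    finally show ?thesis .
  qed
  have g01: "0 \<le> g w a" "g w a \<le> 1" for w a by (auto simp: g_def gauss_def)
  have int_g: "(\<integral>\<^sup>+a. ennreal (g w a) \<partial>lborel) = ennreal (N / s)" for w
    using nn_integral_gauss_affine[of "- sqrt p" "(1 / sqrt p) *\<^sub>R w"] p by (simp add: g_def N_def s_def)
  have int_g': "(\<integral>\<^sup>+w. ennreal (g w a) \<partial>lborel) = ennreal (N * s)" for a
    using nn_integral_gauss_affine[of "1 / sqrt p" "- (sqrt p *\<^sub>R a)"] p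
    by (simp add: g_def N_def s_def power_one_over field_simps)
  define E where "E w = (\<integral>\<^sup>+a. ennreal (k a powr p * g w a) \<partial>lborel)" for w
  \<comment> \<open>Jensen's inequality for the kernel \<open>g w\<close>, obtained from Hoelder
    with exponents 1 / p and 1 - 1 / p; its mass N / s accounts for the factor (N / s)^(p -
    1).\<close>
  have jensen: "h w powr p * gauss w \<le> (N / s) powr (p - 1) * enn2real (E w)"
    and fin_D: "E w < \<infinity>" for w
  proof -
    have "E w \<le> (\<integral>\<^sup>+a. ennreal (k a powr p) \<partial>lborel)"
      unfolding E_def using g01 by (intro nn_integral_mono ennreal_leI mult_left_le) auto
    also have "\<dots> < \<infinity>" using D(2) by (rule le_less_trans) simp
    finally show fin: "E w < \<infinity>" .
    define Dw where "Dw = enn2real (E w)"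
    have "k a * g w a = (k a powr p * g w a) powr (1 / p) * g w a powr (1 - 1 / p)" for a
    proof -
      have "(k a powr p * g w a) powr (1 / p) * g w a powr (1 - 1 / p) = k a * (g w a powr (1 / p) * g w a powr (1 - 1 / p))"
        using p k(2)[of a] g01[of w a] by (simp add: powr_mult powr_powr)
      also have "g w a powr (1 / p) * g w a powr (1 - 1 / p) = g w a"
        by (subst powr_add[symmetric]) (simp add: g_def)
      finally show ?thesis ..
    qed
    then have "(\<integral>\<^sup>+a. ennreal (k a * g w a) \<partial>lborel) \<le> ennreal (Dw powr (1 / p) * (N / s) powr (1 - 1 / p))"
      using p g01 fin N s
      by (simp only:, intro nn_integral_Holder2) (auto simp: Dw_def int_g E_def[symmetric])
    moreover have "integrable lborel (\<lambda>a. k a * g w a)"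
      by (rule Bochner_Integration.integrable_bound[OF k(1)]) (use k(2) g01 in \<open>auto simp: abs_mult intro!: mult_left_le\<close>)
    ultimately have le: "h w * gauss w powr (1 / p) \<le> Dw powr (1 / p) * (N / s) powr (1 - 1 / p)"
      unfolding hg using k(2) g01 by (subst (asm) nn_integral_eq_integral) auto
    have "h w powr p * gauss w = (h w * gauss w powr (1 / p)) powr p"
      using p by (simp add: powr_mult h_def powr_powr)
    also have "\<dots> \<le> (Dw powr (1 / p) * (N / s) powr (1 - 1 / p)) powr p"
      using p le by (intro powr_mono2) (auto simp: h_def)
    also have "\<dots> = (N / s) powr (p - 1) * Dw"
    proof -
      have "(1 - 1 / p) * p = p - 1" using p by (simp add: field_simps)
      then show ?thesis using p N s by (simp add: powr_mult powr_powr Dw_def)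
    qed
    finally show "h w powr p * gauss w \<le> (N / s) powr (p - 1) * enn2real (E w)"
      by (simp add: Dw_def)
  qed
  define I where "I = (LBINT w. h w powr p * gauss w)"
  have I0: "0 \<le> I" by (simp add: I_def)
  have "ennreal I = (\<integral>\<^sup>+w. ennreal (h w powr p * gauss w) \<partial>lborel)"
    unfolding I_def using flow(3) by (subst nn_integral_eq_integral) (auto simp: h_def)
  also have "\<dots> \<le> (\<integral>\<^sup>+w. ennreal ((N / s) powr (p - 1)) * E w \<partial>lborel)"
  proof (rule nn_integral_mono)
    fix w
    have "ennreal (h w powr p * gauss w) \<le> ennreal ((N / s) powr (p - 1) * enn2real (E w))"
      by (rule ennreal_leI[OF jensen])
    also have "\<dots> = ennreal ((N / s) powr (p - 1)) * E w"
      using fin_D[of w] by (simp add: ennreal_mult)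
    finally show "ennreal (h w powr p * gauss w) \<le> ennreal ((N / s) powr (p - 1)) * E w" .
  qed
  also have "\<dots> = ennreal ((N / s) powr (p - 1)) * (\<integral>\<^sup>+w. E w \<partial>lborel)"
    unfolding E_def by (rule nn_integral_cmult) measurable
  also have "(\<integral>\<^sup>+w. E w \<partial>lborel) = (\<integral>\<^sup>+a. (\<integral>\<^sup>+w. ennreal (k a powr p * g w a) \<partial>lborel) \<partial>lborel)"
    unfolding E_def by (rule lborel_pair.Fubini'[symmetric]) measurable
  also have "\<dots> = (\<integral>\<^sup>+a. ennreal (k a powr p) * ennreal (N * s) \<partial>lborel)"
    using g01 by (simp add: ennreal_mult nn_integral_cmult int_g')
  also have "\<dots> = (\<integral>\<^sup>+a. ennreal (k a powr p) \<partial>lborel) * ennreal (N * s)"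
    by (rule nn_integral_multc) measurable
  also have "ennreal ((N / s) powr (p - 1)) * \<dots> \<le> ennreal ((N / s) powr (p - 1)) * (ennreal D * ennreal (N * s))"
    by (intro mult_left_mono mult_right_mono D) auto
  also have "\<dots> = ennreal ((N / s) powr (p - 1) * (D * (N * s)))"
    using D N s by (simp add: ennreal_mult)
  finally have I: "I \<le> (N / s) powr (p - 1) * (D * (N * s))"
    using D N s by (subst (asm) ennreal_le_iff) auto
  define \<alpha> where "\<alpha> = 1 / (p - 1)"
  have \<alpha>: "0 < \<alpha>" "(p - 1) * \<alpha> = 1" using p by (auto simp: \<alpha>_def)
  define J where "J = (LBINT x. norm (fourier k (sqrt (p - 1) *\<^sub>R x)) powr (p / (p - 1)) * gauss x)"
  have "N powr \<alpha> * J \<le> N * I powr \<alpha>"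
    using flow(1) unfolding T J_def I_def h_def N_def \<alpha>_def .
  also have "\<dots> \<le> N * ((N / s) powr (p - 1) * (D * (N * s))) powr \<alpha>"
    using I I0 \<alpha> N by (intro mult_left_mono powr_mono2) auto
  also have "\<dots> = N powr \<alpha> * (N * N * s powr (\<alpha> - 1) * D powr \<alpha>)"
    using N s D \<alpha> by (simp add: powr_mult powr_divide powr_powr powr_diff powr_add field_simps)
  finally have J: "J \<le> N * N * s powr (\<alpha> - 1) * D powr \<alpha>"
    using N by (simp add: mult_le_cancel_left_pos)
  have "N * N = (2 * pi) ^ DIM('a)" unfolding N_def by (subst power_mult_distrib[symmetric]) simp
  moreover have "(\<integral>\<^sup>+x. ennreal (norm (fourier k (sqrt (p - 1) *\<^sub>R x)) powr (p / (p - 1)) * gauss x) \<partial>lborel) = ennreal J"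
    unfolding J_def using flow(2) unfolding T by (subst nn_integral_eq_integral) auto
  ultimately show ?thesis
    using J by (auto simp: s_def \<alpha>_def intro: ennreal_leI)
qed

text \<open>Truncate f to a ball and dilate it by l. In the original variable the Gaussian weight
  becomes gauss (\<xi> / (l \<omega>)), which tends to 1, while the bound does not depend on l. One
  index m drives truncation and dilation together, and Fatou's lemma passes to the limit.\<close>

lemma hausdorff_young:
  fixes f :: "'a::euclidean_space \<Rightarrow> real"
  assumes p: "1 < p" "p \<le> 2" and f: "integrable lborel f" "\<And>x. 0 \<le> f x"
    and D: "0 \<le> D" "(\<integral>\<^sup>+x. ennreal (f x powr p) \<partial>lborel) \<le> ennreal D"
  shows "(\<integral>\<^sup>+\<xi>. ennreal (norm (fourier f \<xi>) powr (p / (p - 1))) \<partial>lborel)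
    \<le> ennreal (((2 * pi) ^ DIM('a) * (sqrt p ^ DIM('a)) powr (1 / (p - 1) - 1) * D powr (1 / (p - 1))) * sqrt (p - 1) ^ DIM('a))"
proof -
  have [measurable]: "f \<in> borel_measurable borel" using borel_measurable_integrable[OF f(1)] by simp
  define q where "q = p / (p - 1)"
  define \<alpha> where "\<alpha> = 1 / (p - 1)"
  have q: "0 < q" "q = \<alpha> + 1" using p by (auto simp: q_def \<alpha>_def field_simps)
  define c where "c = (2 * pi) ^ DIM('a) * (sqrt p ^ DIM('a)) powr (\<alpha> - 1)"
  have c0: "0 \<le> c" by (simp add: c_def)
  define \<omega> where "\<omega> = sqrt (p - 1)"
  have \<omega>: "0 < \<omega>" using p by (simp add: \<omega>_def)
  define fm where "fm m x = f x * indicator (cball 0 (real (Suc m))) x" for m x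
  let ?u = "\<lambda>m \<xi>. ennreal (norm (fourier (fm m) \<xi>) powr q * gauss ((1 / (real (Suc m) * \<omega>)) *\<^sub>R \<xi>))"
  have [measurable]: "cball (0 :: 'a) r \<in> sets borel" for r by (intro borel_closed closed_cball)
  have [measurable]: "fm m \<in> borel_measurable borel" for m unfolding fm_def by measurable
  have fm: "0 \<le> fm m x" "fm m x \<le> f x" for m x using f(2) by (auto simp: fm_def indicator_def)
  have intfm: "integrable lborel (fm m)" for m
    by (rule Bochner_Integration.integrable_bound[OF f(1)]) (use fm f(2) in auto)
  have step: "(\<integral>\<^sup>+\<xi>. ?u m \<xi> \<partial>lborel)
      \<le> ennreal (c * D powr \<alpha> * \<omega> ^ DIM('a))" for m
  proof -
    define l where "l = real (Suc m)"
    have l: "1 \<le> l" by (simp add: l_def)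
    define n where "n = DIM('a)"
    define k where "k a = fm m ((1 / l) *\<^sub>R a)" for a
    have [measurable]: "k \<in> borel_measurable borel" unfolding k_def by measurable
    have intk: "integrable lborel k"
      using integrable_lborel_affine_iff[of "fm m" "1 / l" 0] l intfm by (simp add: k_def[abs_def])
    have kl: "k (0 + l *\<^sub>R a) = fm m a" for a using l by (simp add: k_def)
    have fk: "fourier k \<xi> = (l ^ n) *\<^sub>R fourier (fm m) (l *\<^sub>R \<xi>)" for \<xi>
      unfolding fourier_def n_def
      by (subst integral_lborel_affine[of _ l 0]) (use l in \<open>auto simp: kl[simplified]\<close>)
    have kp: "(\<integral>\<^sup>+a. ennreal (k a powr p) \<partial>lborel) \<le> ennreal (l ^ n * D)"
    proof -
      have "(\<integral>\<^sup>+a. ennreal (k a powr p) \<partial>lborel) = ennreal (l ^ n) * (\<integral>\<^sup>+a. ennreal (fm m a powr p) \<partial>lborel)"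
        unfolding n_def by (subst nn_integral_lborel_affine[of _ l 0]) (use l in \<open>auto simp: kl[simplified]\<close>)
      also have "\<dots> \<le> ennreal (l ^ n) * (\<integral>\<^sup>+a. ennreal (f a powr p) \<partial>lborel)"
        using fm p by (intro mult_left_mono nn_integral_mono ennreal_leI powr_mono2) auto
      also have "\<dots> \<le> ennreal (l ^ n) * ennreal D" by (intro mult_left_mono D) auto
      finally show ?thesis using l D by (simp add: ennreal_mult)
    qed
    \<comment> \<open>\<open>fm m\<close> lives in the ball of radius l, and the dilation by l
      enlarges this to l^2.\<close>
    have ksupp: "k a = 0" if "l * l < norm a" for a
    proof -
      have "l < norm ((1 / l) *\<^sub>R a)" using that l by (simp add: field_simps)
      then show ?thesis unfolding k_def fm_def l_def by simp
    qed
    have ll: "1 \<le> l * l" using mult_mono[OF l l] l by simp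
    have main: "(\<integral>\<^sup>+x. ennreal (norm (fourier k (\<omega> *\<^sub>R x)) powr q * gauss x) \<partial>lborel) \<le> ennreal (c * (l ^ n * D) powr \<alpha>)"
      unfolding \<omega>_def q_def c_def \<alpha>_def
      by (rule hausdorff_young_gauss[OF p ll intk _ ksupp _ kp]) (use l D fm in \<open>auto simp: k_def\<close>)
    have "(\<integral>\<^sup>+\<xi>. ennreal (norm (fourier (fm m) \<xi>) powr q * gauss ((1 / (l * \<omega>)) *\<^sub>R \<xi>)) \<partial>lborel)
      = ennreal ((l * \<omega>) ^ n) * (\<integral>\<^sup>+x. ennreal (norm (fourier (fm m) ((l * \<omega>) *\<^sub>R x)) powr q * gauss x) \<partial>lborel)"
      unfolding n_def by (subst nn_integral_lborel_affine[of _ "l * \<omega>" 0]) (use l \<omega> in auto)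
    also have "\<dots> = ennreal ((l * \<omega>) ^ n) * (\<integral>\<^sup>+x. ennreal ((l ^ n) powr - q) * ennreal (norm (fourier k (\<omega> *\<^sub>R x)) powr q * gauss x) \<partial>lborel)"
    proof -
      have "norm (fourier (fm m) ((l * \<omega>) *\<^sub>R x)) powr q = (l ^ n) powr - q * norm (fourier k (\<omega> *\<^sub>R x)) powr q" for x
        using l by (simp add: fk powr_mult powr_minus field_simps)
      then show ?thesis by (simp add: ennreal_mult[symmetric] mult.assoc)
    qed
    also have "\<dots> = ennreal ((l * \<omega>) ^ n * (l ^ n) powr - q) * (\<integral>\<^sup>+x. ennreal (norm (fourier k (\<omega> *\<^sub>R x)) powr q * gauss x) \<partial>lborel)"
      using l \<omega> by (subst nn_integral_cmult) (auto simp: ennreal_mult mult.assoc)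
    also have "\<dots> \<le> ennreal ((l * \<omega>) ^ n * (l ^ n) powr - q) * ennreal (c * (l ^ n * D) powr \<alpha>)"
      by (intro mult_left_mono main) auto
    also have "\<dots> = ennreal (((l * \<omega>) ^ n * (l ^ n) powr - q) * (c * (l ^ n * D) powr \<alpha>))"
      using l \<omega> c0 by (intro ennreal_mult[symmetric]) auto
    \<comment> \<open>The powers of l^n are 1, -q and \<alpha>, and q = \<alpha> + 1; only
      \<omega>^n is left from the substitution.\<close>
    also have "((l * \<omega>) ^ n * (l ^ n) powr - q) * (c * (l ^ n * D) powr \<alpha>) = c * D powr \<alpha> * \<omega> ^ n"
    proof -
      have "(l ^ n) powr - q = 1 / ((l ^ n) powr \<alpha> * l ^ n)"
        using l by (simp add: q(2) powr_diff powr_minus powr_add field_simps)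
      then show ?thesis using l D by (simp add: powr_mult power_mult_distrib field_simps)
    qed
    finally show ?thesis by (simp add: l_def n_def)
  qed
  have lim: "(\<lambda>m. ?u m \<xi>)
      \<longlonglongrightarrow> ennreal (norm (fourier f \<xi>) powr q)" for \<xi>
  proof -
    have "(\<lambda>m. fm m x) \<longlonglongrightarrow> f x" for x
    proof (rule tendsto_eventually)
      obtain m0 where "norm x \<le> real m0" using real_arch_simple by blast
      then have "\<forall>m\<ge>m0. fm m x = f x" by (auto simp: fm_def)
      then show "\<forall>\<^sub>F m in sequentially. fm m x = f x" unfolding eventually_sequentially by blast
    qed
    then have 1: "(\<lambda>m. fourier (fm m) \<xi>) \<longlonglongrightarrow> fourier f \<xi>"
      unfolding fourier_def
      by (intro integral_dominated_convergence[where w=f])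
        (use fm f in \<open>auto intro!: tendsto_intros simp: norm_mult\<close>)
    have "(\<lambda>m. gauss ((1 / (real (Suc m) * \<omega>)) *\<^sub>R \<xi>)) \<longlonglongrightarrow> exp (- ((0 *\<^sub>R \<xi>) \<bullet> (0 *\<^sub>R \<xi>)) / 2)"
    proof -
      have "(\<lambda>m. (1 / real (Suc m)) * (1 / \<omega>)) \<longlonglongrightarrow> 0 * (1 / \<omega>)"
        by (intro tendsto_mult tendsto_const LIMSEQ_Suc[OF lim_1_over_n])
      then have "(\<lambda>m. 1 / (real (Suc m) * \<omega>)) \<longlonglongrightarrow> 0" by simp
      then show ?thesis unfolding gauss_def by (intro tendsto_intros) auto
    qed
    then have 2: "(\<lambda>m. gauss ((1 / (real (Suc m) * \<omega>)) *\<^sub>R \<xi>)) \<longlonglongrightarrow> 1" by simp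
    have "(\<lambda>m. norm (fourier (fm m) \<xi>) powr q) \<longlonglongrightarrow> norm (fourier f \<xi>) powr q"
      using q(1) by (intro tendsto_powr' tendsto_norm 1 tendsto_const) auto
    from tendsto_mult[OF this 2] show ?thesis by (intro tendsto_ennrealI) simp
  qed
  have "(\<integral>\<^sup>+\<xi>. ennreal (norm (fourier f \<xi>) powr q) \<partial>lborel)
    = (\<integral>\<^sup>+\<xi>. liminf (\<lambda>m. ?u m \<xi>) \<partial>lborel)"
    by (intro nn_integral_cong lim_imp_Liminf[symmetric] lim) simp
  also have "\<dots> \<le> liminf (\<lambda>m. (\<integral>\<^sup>+\<xi>. ?u m \<xi> \<partial>lborel))"
    by (rule nn_integral_liminf) measurable
  also have "\<dots> \<le> ennreal (c * D powr \<alpha> * \<omega> ^ DIM('a))"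
    by (rule order_trans[OF Liminf_le_Limsup Limsup_bounded[OF always_eventually]]) (use step in auto)
  finally show ?thesis unfolding q_def c_def \<alpha>_def \<omega>_def .
qed

section \<open>From the Fourier side back to the function\<close>

lemma borel_measurable_cnj [measurable (raw)]:
  "f \<in> borel_measurable M \<Longrightarrow> (\<lambda>x. cnj (f x)) \<in> borel_measurable M"
  by (rule measurable_compose[OF _ borel_measurable_continuous_onI]) (auto intro: continuous_intros)

lemma
  fixes u v :: "'a::euclidean_space \<Rightarrow> real" and b :: "'a \<Rightarrow> 'a \<Rightarrow> complex"
  assumes u: "integrable lborel u" and v: "integrable lborel v"
    and [measurable]: "(\<lambda>(x, y). b x y) \<in> borel_measurable (borel \<Otimes>\<^sub>M borel)"
    and b: "\<And>x y. norm (b x y) \<le> B"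
  shows integral_swap_bounded: "(LBINT x. (LBINT y. of_real (u x * v y) * b x y))
    = (LBINT y. (LBINT x. of_real (u x * v y) * b x y))"
proof -
  have [measurable]: "u \<in> borel_measurable borel" "v \<in> borel_measurable borel"
    using borel_measurable_integrable[OF u] borel_measurable_integrable[OF v] by simp_all
  have "integrable (lborel \<Otimes>\<^sub>M lborel) (\<lambda>(x, y). (\<bar>u x\<bar> * B) * \<bar>v y\<bar>)"
    by (rule lborel_pair.Fubini_integrable) (use u v in \<open>auto simp: abs_mult\<close>)
  then have "integrable (lborel \<Otimes>\<^sub>M lborel) (\<lambda>(x, y). of_real (u x * v y) * b x y)"
  proof (rule Bochner_Integration.integrable_bound)
    have "norm (of_real (u x * v y) * b x y) \<le> norm ((\<bar>u x\<bar> * B) * \<bar>v y\<bar>)" for x y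
      using mult_left_mono[OF order_trans[OF b[of x y] abs_ge_self[of B]], of "\<bar>u x\<bar> * \<bar>v y\<bar>"]
      by (simp add: norm_mult abs_mult ac_simps)
    then show "AE z in lborel \<Otimes>\<^sub>M lborel. norm (case z of (x, y) \<Rightarrow> of_real (u x * v y) * b x y)
        \<le> norm (case z of (x, y) \<Rightarrow> (\<bar>u x\<bar> * B) * \<bar>v y\<bar>)"
      by (intro AE_I2) (auto split: prod.splits)
  qed measurable
  from lborel_pair.Fubini_integral[OF this] show ?thesis by simp
qed

lemma integral_iexp_gauss_scaled:
  fixes z :: "'a::euclidean_space"
  assumes "0 < \<sigma>"
  shows "(LBINT \<xi>. iexp (\<xi> \<bullet> z) * of_real (gauss (\<sigma> *\<^sub>R \<xi>)))
    = of_real (sqrt (2 * pi) ^ DIM('a) / \<sigma> ^ DIM('a) * gauss ((1 / \<sigma>) *\<^sub>R z))"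
proof -
  have "(LBINT \<xi>. iexp (\<xi> \<bullet> z) * of_real (gauss (\<sigma> *\<^sub>R \<xi>)))
    = (1 / \<sigma> ^ DIM('a)) *\<^sub>R (LBINT \<xi>. iexp (((1 / \<sigma>) *\<^sub>R z) \<bullet> \<xi>) * of_real (gauss \<xi>))"
    using assms by (subst integral_lborel_affine[of _ "1 / \<sigma>" 0]) (auto simp: power_one_over inner_commute)
  also have "\<dots> = of_real (sqrt (2 * pi) ^ DIM('a) / \<sigma> ^ DIM('a) * gauss ((1 / \<sigma>) *\<^sub>R z))"
    unfolding integral_gauss_iexp by (simp add: scaleR_conv_of_real)
  finally show ?thesis .
qed

text \<open>For merely integrable h and g the product of the transforms need not be integrable. The
  Gaussian factor makes both exchanges of integration legitimate, and its own transform reappears as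
  an averaging of g at width \<sigma>.\<close>

lemma integral_fourier_mult_gauss:
  fixes h g :: "'a::euclidean_space \<Rightarrow> real"
  assumes h: "integrable lborel h" "\<And>x. 0 \<le> h x" and g: "integrable lborel g" "\<And>x. 0 \<le> g x" and \<sigma>: "0 < \<sigma>"
  shows "(LBINT \<xi>. fourier h \<xi> * cnj (fourier g \<xi>) * of_real (gauss (\<sigma> *\<^sub>R \<xi>)))
    = of_real (sqrt (2 * pi) ^ DIM('a) * (LBINT x. h x * (LBINT u. g (x - \<sigma> *\<^sub>R u) * gauss u)))"
proof -
  let ?\<gamma> = "\<lambda>\<xi>. gauss (\<sigma> *\<^sub>R \<xi>)" and ?c = "\<lambda>\<xi>. cnj (fourier g \<xi>)"
    and ?G = "\<lambda>x. LBINT u. g (x - \<sigma> *\<^sub>R u) * gauss u"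
  let ?E = "\<lambda>x \<xi>. iexp (\<xi> \<bullet> x) * ?c \<xi>" and ?e = "\<lambda>x y \<xi>. iexp (\<xi> \<bullet> (x - y))"
  have [measurable]: "h \<in> borel_measurable borel" "g \<in> borel_measurable borel"
    using borel_measurable_integrable[OF h(1)] borel_measurable_integrable[OF g(1)] by simp_all
  define N where "N = sqrt (2 * pi) ^ DIM('a)"
  let ?m = "\<lambda>x y. N / \<sigma> ^ DIM('a) * gauss ((1 / \<sigma>) *\<^sub>R (x - y))"
  have int_gauss: "integrable lborel (\<lambda>\<xi>::'a. ?\<gamma> \<xi>)"
    using integrable_lborel_affine_iff[of "gauss :: 'a \<Rightarrow> real" \<sigma> 0] \<sigma> integrable_gauss by simp
  have cnj_iexp: "cnj (iexp t) = iexp (- t)" for t :: real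
    by (simp add: exp_cnj)
  have cnj_g: "?c \<xi> = (LBINT y. of_real (g y) * iexp (- (\<xi> \<bullet> y)))" for \<xi>
    unfolding fourier_def Bochner_Integration.integral_cnj[symmetric] by (simp only: complex_cnj_mult complex_cnj_complex_of_real cnj_iexp)
  have norm_g: "norm (?c \<xi>) \<le> (LBINT x. g x)" for \<xi>
    using norm_fourier_le[OF g] by simp
  have inner: "(LBINT \<xi>. ?E x \<xi> * of_real (?\<gamma> \<xi>))
      = of_real (N * ?G x)" for x
  proof -
    have "(LBINT \<xi>. ?E x \<xi> * of_real (?\<gamma> \<xi>))
      = (LBINT \<xi>. (LBINT y. of_real (?\<gamma> \<xi> * g y) * ?e x y \<xi>))"
    proof (rule Bochner_Integration.integral_cong[OF refl])
      fix \<xi>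
      have eq: "of_real (?\<gamma> \<xi> * g y) * ?e x y \<xi>
          = (of_real (?\<gamma> \<xi>) * iexp (\<xi> \<bullet> x)) * (of_real (g y) * iexp (- (\<xi> \<bullet> y)))" for y
        by (simp add: inner_diff_right exp_diff exp_minus right_diff_distrib divide_inverse ac_simps)
      show "?E x \<xi> * of_real (?\<gamma> \<xi>)
        = (LBINT y. of_real (?\<gamma> \<xi> * g y) * ?e x y \<xi>)"
        unfolding eq cnj_g integral_mult_right_zero by (simp only: ac_simps)
    qed
    also have "\<dots> = (LBINT y. (LBINT \<xi>. of_real (?\<gamma> \<xi> * g y) * ?e x y \<xi>))"
    proof (rule integral_swap_bounded[OF int_gauss g(1), where B=1])
      show "(\<lambda>(\<xi>, y). ?e x y \<xi>) \<in> borel_measurable (borel \<Otimes>\<^sub>M borel)"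
        by measurable
    qed simp
    also have "\<dots> = (LBINT y. of_real (g y * ?m x y))"
    proof (rule Bochner_Integration.integral_cong[OF refl])
      fix y
      have "(LBINT \<xi>. of_real (?\<gamma> \<xi> * g y) * ?e x y \<xi>)
        = of_real (g y) * (LBINT \<xi>. ?e x y \<xi> * of_real (?\<gamma> \<xi>))"
        unfolding integral_mult_right_zero[symmetric] of_real_mult by (simp only: ac_simps)
      then show "(LBINT \<xi>. of_real (?\<gamma> \<xi> * g y) * ?e x y \<xi>)
        = of_real (g y * ?m x y)"
        unfolding integral_iexp_gauss_scaled[OF \<sigma>] N_def by (simp only: of_real_mult)
    qed
    also have "\<dots> = of_real (LBINT y. g y * ?m x y)"
      by (rule integral_complex_of_real)
    \<comment> \<open>Substitution y = x - \<sigma> u; its Jacobian cancels the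
      \<open>\<sigma> ^ DIM('a)\<close> in the denominator.\<close>
    also have "(LBINT y. g y * ?m x y)
      = \<sigma> ^ DIM('a) * (LBINT u. g (x - \<sigma> *\<^sub>R u) * (N / \<sigma> ^ DIM('a) * gauss u))"
      using \<sigma> by (subst integral_lborel_affine[of _ "- \<sigma>" x]) auto
    also have "\<dots> = N * ?G x"
    proof -
      have "g (x - \<sigma> *\<^sub>R u) * (N / \<sigma> ^ DIM('a) * gauss u) = (N / \<sigma> ^ DIM('a)) * (g (x - \<sigma> *\<^sub>R u) * gauss u)" for u
        by (simp only: ac_simps)
      then have "(LBINT u. g (x - \<sigma> *\<^sub>R u) * (N / \<sigma> ^ DIM('a) * gauss u))
          = (N / \<sigma> ^ DIM('a)) * ?G x"
        by (simp only: integral_mult_right_zero)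
      then show ?thesis using \<sigma> by simp
    qed
    finally show ?thesis .
  qed
  have "(LBINT \<xi>. fourier h \<xi> * ?c \<xi> * of_real (?\<gamma> \<xi>))
    = (LBINT \<xi>. (LBINT x. of_real (?\<gamma> \<xi> * h x) * (?E x \<xi>)))"
  proof (rule Bochner_Integration.integral_cong[OF refl])
    fix \<xi>
    have eq: "of_real (?\<gamma> \<xi> * h x) * (?E x \<xi>)
        = (of_real (?\<gamma> \<xi>) * ?c \<xi>) * (of_real (h x) * iexp (\<xi> \<bullet> x))" for x
      by (simp only: of_real_mult ac_simps)
    show "fourier h \<xi> * ?c \<xi> * of_real (?\<gamma> \<xi>)
      = (LBINT x. of_real (?\<gamma> \<xi> * h x) * (?E x \<xi>))"
      unfolding eq integral_mult_right_zero fourier_def[of h] by (simp only: ac_simps)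
  qed
  also have "\<dots> = (LBINT x. (LBINT \<xi>. of_real (?\<gamma> \<xi> * h x) * (?E x \<xi>)))"
  proof (rule integral_swap_bounded[OF int_gauss h(1), where B="\<integral>x. g x \<partial>lborel"])
    show "(\<lambda>(\<xi>, x). ?E x \<xi>) \<in> borel_measurable (borel \<Otimes>\<^sub>M borel)"
      by measurable
  qed (use norm_g in \<open>simp add: norm_mult\<close>)
  also have "\<dots> = (LBINT x. of_real (N * (h x * ?G x)))"
  proof (rule Bochner_Integration.integral_cong[OF refl])
    fix x
    have "(LBINT \<xi>. of_real (?\<gamma> \<xi> * h x) * (?E x \<xi>))
      = of_real (h x) * (LBINT \<xi>. ?E x \<xi> * of_real (?\<gamma> \<xi>))"
      unfolding integral_mult_right_zero[symmetric] of_real_mult by (simp only: ac_simps)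
    then show "(LBINT \<xi>. of_real (?\<gamma> \<xi> * h x) * (?E x \<xi>))
      = of_real (N * (h x * ?G x))"
      unfolding inner of_real_mult by (simp only: ac_simps)
  qed
  also have "\<dots> = of_real (N * (LBINT x. h x * ?G x))"
    unfolding integral_complex_of_real integral_mult_right_zero ..
  finally show ?thesis by (simp only: N_def)
qed

text \<open>The Gaussian is at most 1, so the regularised integrals are bounded by K for every
  \<sigma>. As \<sigma> tends to 0, continuity of g gives convergence of its averages at every x,
  and boundedness of g supplies the dominating functions. The two factors sqrt (2 pi)^n come from
  the Parseval identity and from the mass of the Gaussian.\<close>

lemma integral_mult_le_of_fourier_bound:
  fixes h g :: "'a::euclidean_space \<Rightarrow> real"
  assumes h: "integrable lborel h" "\<And>x. 0 \<le> h x" and g: "integrable lborel g" "\<And>x. 0 \<le> g x"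
    and cont: "continuous_on UNIV g" and B: "\<And>x. g x \<le> B"
    and bound: "(\<integral>\<^sup>+\<xi>. ennreal (norm (fourier h \<xi>) * norm (fourier g \<xi>)) \<partial>lborel) \<le> ennreal K" and K: "0 \<le> K"
  shows "(2 * pi) ^ DIM('a) * (LBINT x. h x * g x) \<le> K"
proof -
  have [measurable]: "h \<in> borel_measurable borel" "g \<in> borel_measurable borel"
    using borel_measurable_integrable[OF h(1)] borel_measurable_integrable[OF g(1)] by simp_all
  define N where "N = sqrt (2 * pi) ^ DIM('a)"
  have N: "N = (LBINT x. gauss (x::'a))" by (simp add: N_def integral_gauss)
  define \<sigma> where "\<sigma> m = 1 / real (Suc m)" for m
  have \<sigma>: "0 < \<sigma> m" for m by (simp add: \<sigma>_def)
  have \<sigma>0: "\<sigma> \<longlonglongrightarrow> 0" unfolding \<sigma>_def by (rule LIMSEQ_Suc[OF lim_1_over_n])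
  have B0: "0 \<le> B" using order_trans[OF g(2) B] .
  have le: "N * (LBINT x. h x * (LBINT u. g (x - \<sigma> m *\<^sub>R u) * gauss u)) \<le> K" (is "?t \<le> K") for m
  proof -
    let ?F = "\<lambda>\<xi>. fourier h \<xi> * cnj (fourier g \<xi>) * of_real (gauss (\<sigma> m *\<^sub>R \<xi>))"
    have gauss_le: "gauss x \<le> 1" for x :: 'a by (simp add: gauss_def)
    have F_le: "ennreal (norm (?F \<xi>)) \<le> ennreal (norm (fourier h \<xi>) * norm (fourier g \<xi>))" for \<xi>
      by (intro ennreal_leI) (auto simp: norm_mult gauss_le intro!: mult_left_le)
    have "ennreal \<bar>?t\<bar> = ennreal (norm (LBINT \<xi>. ?F \<xi>))"
      unfolding integral_fourier_mult_gauss[OF h g \<sigma>] N_def norm_of_real ..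
    also have "\<dots> \<le> (\<integral>\<^sup>+\<xi>. ennreal (norm (?F \<xi>)) \<partial>lborel)"
    proof (rule integral_norm_bound_ennreal)
      have "(\<integral>\<^sup>+\<xi>. ennreal (norm (?F \<xi>)) \<partial>lborel) \<le> ennreal K"
        by (rule order_trans[OF nn_integral_mono[OF F_le] bound])
      then show "integrable lborel ?F"
        by (intro integrableI_bounded) (measurable, auto intro: le_less_trans)
    qed
    also have "\<dots> \<le> ennreal K"
      by (rule order_trans[OF nn_integral_mono[OF F_le] bound])
    finally show ?thesis using K by simp
  qed
  have inner_lim: "(\<lambda>m. \<integral>u. g (x - \<sigma> m *\<^sub>R u) * gauss u \<partial>lborel) \<longlonglongrightarrow> (LBINT u. g x * gauss (u::'a))" for x
  proof (rule integral_dominated_convergence[where w="\<lambda>u. B * gauss u"])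
    show "AE u in lborel. (\<lambda>m. g (x - \<sigma> m *\<^sub>R u) * gauss u) \<longlonglongrightarrow> g x * gauss u"
    proof (intro AE_I2 tendsto_mult tendsto_const)
      fix u
      have "(\<lambda>m. x - \<sigma> m *\<^sub>R u) \<longlonglongrightarrow> x - 0 *\<^sub>R u"
        by (intro tendsto_intros \<sigma>0)
      then have "(\<lambda>m. g (x - \<sigma> m *\<^sub>R u)) \<longlonglongrightarrow> g (x - 0 *\<^sub>R u)"
        by (intro continuous_on_tendsto_compose[OF cont]) auto
      then show "(\<lambda>m. g (x - \<sigma> m *\<^sub>R u)) \<longlonglongrightarrow> g x" by simp
    qed
    show "AE u in lborel. norm (g (x - \<sigma> m *\<^sub>R u) * gauss u) \<le> B * gauss u" for m
      using g(2) B by (auto simp: abs_mult intro!: mult_right_mono)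
  qed (auto intro!: integrable_mult_right integrable_gauss)
  have inner_le: "\<bar>\<integral>u. g (x - \<sigma> m *\<^sub>R u) * gauss u \<partial>lborel\<bar> \<le> B * N" for x m
  proof -
    have "\<bar>\<integral>u. g (x - \<sigma> m *\<^sub>R u) * gauss u \<partial>lborel\<bar> \<le> (LBINT u. B * gauss (u::'a))"
      using g(2) B B0 unfolding real_norm_def[symmetric]
      by (intro order_trans[OF integral_norm_bound] integral_mono')
        (auto simp: abs_mult intro!: mult_right_mono integrable_mult_right integrable_gauss)
    then show ?thesis by (simp add: N)
  qed
  have "(\<lambda>m. \<integral>x. h x * (LBINT u. g (x - \<sigma> m *\<^sub>R u) * gauss u) \<partial>lborel) \<longlonglongrightarrow> (LBINT x. h x * (LBINT u. g x * gauss (u::'a)))"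
  proof (rule integral_dominated_convergence[where w="\<lambda>x. h x * (B * N)"])
    show "AE x in lborel. (\<lambda>m. h x * (LBINT u. g (x - \<sigma> m *\<^sub>R u) * gauss u)) \<longlonglongrightarrow> h x * (LBINT u. g x * gauss (u::'a))"
      by (intro AE_I2 tendsto_mult tendsto_const inner_lim)
    show "AE x in lborel. norm (h x * (LBINT u. g (x - \<sigma> m *\<^sub>R u) * gauss u)) \<le> h x * (B * N)" for m
      using h(2) inner_le by (auto simp: abs_mult intro!: mult_left_mono)
  qed (use h in \<open>auto simp: mult.assoc[symmetric]\<close>)
  from tendsto_mult_left[OF this, of N]
  have "N * (LBINT x. h x * (LBINT u. g x * gauss (u::'a))) \<le> K"
    by (rule LIMSEQ_le_const2) (use le in auto)
  also have "(LBINT x. h x * (LBINT u. g x * gauss (u::'a))) = N * (LBINT x. h x * g x)"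
    unfolding N by (simp add: mult.assoc[symmetric])
  also have "N * (N * (LBINT x. h x * g x)) = (2 * pi) ^ DIM('a) * (LBINT x. h x * g x)"
    unfolding N_def mult.assoc[symmetric] by (subst power_mult_distrib[symmetric]) simp
  finally show ?thesis .
qed

text \<open>The pairing is available only against continuous g of bounded support. It is first
  extended to bounded measurable g of bounded support and then tested with the power r - 1 of a
  truncation of h, the extremal function of Hoelder's inequality.\<close>

lemma Lp_bound_by_duality:
  fixes h :: "'a::euclidean_space \<Rightarrow> real"
  assumes h: "integrable lborel h" "\<And>x. 0 \<le> h x" and r: "1 < r" and r': "r' = r / (r - 1)" and K: "0 \<le> K"
    and dual: "\<And>g B R D. continuous_on UNIV g \<Longrightarrow> (\<And>x. 0 \<le> g x) \<Longrightarrow> (\<And>x. g x \<le> B) \<Longrightarrow> (\<And>x. R < norm x \<Longrightarrow> g x = 0)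
      \<Longrightarrow> integrable lborel g \<Longrightarrow> 0 \<le> D \<Longrightarrow> (\<integral>\<^sup>+x. ennreal (g x powr r') \<partial>lborel) \<le> ennreal D \<Longrightarrow> (LBINT x. h x * g x) \<le> K * D powr (1 / r')"
  shows "(\<integral>\<^sup>+x. ennreal (h x powr r) \<partial>lborel) \<le> ennreal (K powr r)"
proof -
  have [measurable]: "h \<in> borel_measurable borel" using borel_measurable_integrable[OF h(1)] by simp
  have [measurable]: "cball (0 :: 'a) \<rho> \<in> sets borel" for \<rho> by (intro borel_closed closed_cball)
  have r'1: "1 < r'" "(r - 1) * r' = r" "1 - 1 / r' = 1 / r" using r by (auto simp: r' field_simps)
  have int_ball: "integrable lborel (\<lambda>x. c * indicator (cball (0::'a) \<rho>) x)" for c \<rho> :: real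
    by (intro integrable_mult_right integrable_real_indicator) (use emeasure_bounded_finite[OF bounded_cball, of "0::'a" \<rho>] in auto)
  have dual': "(LBINT x. h x * g x) \<le> K * (LBINT x. g x powr r') powr (1 / r')"
    if [measurable]: "g \<in> borel_measurable borel" and g: "\<And>x. 0 \<le> g x" "\<And>x. g x \<le> B" "\<And>x. \<rho> < norm x \<Longrightarrow> g x = 0"
    for g B \<rho>
  proof -
    have B0: "0 \<le> B" using order_trans[OF g(1) g(2)] .
    \<comment> \<open>This notion of measurability supplies a sequence of continuous functions
      converging to g off a negligible set.\<close>
    have "g measurable_on UNIV"
      by (intro lebesgue_measurable_imp_measurable_on measurable_completion) auto
    then obtain Z \<phi> where Z: "negligible Z" and \<phi>: "\<And>n. continuous_on UNIV (\<phi> n)"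
        and lim: "\<And>x. x \<notin> Z \<Longrightarrow> (\<lambda>n. \<phi> n x) \<longlonglongrightarrow> g x"
      unfolding measurable_on_def by auto
    \<comment> \<open>Clamping to [0, B] gives a uniform bound; the tent is 1 on the ball of radius
      \<rho> and 0 beyond \<rho> + 1. Both operations are continuous, and neither alters the limit
      g.\<close>
    define G where "G n x = min B (max 0 (\<phi> n x)) * max 0 (min 1 (\<rho> + 1 - norm x))" for n x
    have contG: "continuous_on UNIV (G n)" for n
      unfolding G_def by (intro continuous_intros \<phi>)
    then have [measurable]: "G n \<in> borel_measurable borel" for n
      by (rule borel_measurable_continuous_onI)
    have G0: "0 \<le> G n x" for n x using B0 by (auto simp: G_def)
    have GB: "G n x \<le> B * 1" for n x
      unfolding G_def using B0 by (intro mult_mono) auto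
    have Gsupp: "G n x = 0" if "\<rho> + 1 < norm x" for n x using that by (simp add: G_def)
    have Gle: "G n x \<le> B * indicator (cball 0 (\<rho> + 1)) x" for n x
      using GB[of n x] Gsupp[of x n] by (cases "norm x \<le> \<rho> + 1") auto
    have intG: "integrable lborel (G n)" for n
      by (rule Bochner_Integration.integrable_bound[OF int_ball[of B "\<rho> + 1"]]) (use G0 Gle B0 in \<open>auto simp: abs_mult\<close>)
    have limG: "AE x in lborel. (\<lambda>n. G n x) \<longlonglongrightarrow> g x"
    proof -
      have "AE x in lebesgue. x \<notin> Z"
        using Z by (intro AE_not_in) (simp add: negligible_iff_null_sets)
      then have "AE x in lborel. x \<notin> Z" by (simp add: AE_completion_iff)
      then show ?thesis
      proof eventually_elim
        case (elim x)
        have "(\<lambda>n. G n x) \<longlonglongrightarrow> min B (max 0 (g x)) * max 0 (min 1 (\<rho> + 1 - norm x))"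
          unfolding G_def by (intro tendsto_intros lim[OF elim])
        also have "min B (max 0 (g x)) * max 0 (min 1 (\<rho> + 1 - norm x)) = g x"
          using g[of x] by (cases "norm x \<le> \<rho>") auto
        finally show ?case .
      qed
    qed
    have Gp: "G n x powr r' \<le> B powr r' * indicator (cball 0 (\<rho> + 1)) x" for n x
    proof (cases "norm x \<le> \<rho> + 1")
      case True
      then show ?thesis using GB[of n x] G0[of n x] r'1 by (auto intro!: powr_mono2)
    qed (simp add: Gsupp)
    have intGp: "integrable lborel (\<lambda>x. G n x powr r')" for n
      by (rule Bochner_Integration.integrable_bound[OF int_ball[of "B powr r'" "\<rho> + 1"]]) (use Gp in \<open>auto simp: abs_mult\<close>)
    have le: "(LBINT x. h x * G n x) \<le> K * (LBINT x. G n x powr r') powr (1 / r')" for n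
      by (rule dual[where B="B * 1" and R="\<rho> + 1"])
        (use contG G0 GB Gsupp intG intGp in \<open>auto simp: nn_integral_eq_integral\<close>)
    have lim1: "(\<lambda>n. \<integral>x. h x * G n x \<partial>lborel) \<longlonglongrightarrow> (LBINT x. h x * g x)"
    proof (rule integral_dominated_convergence[where w="\<lambda>x. h x * B"])
      show "AE x in lborel. (\<lambda>n. h x * G n x) \<longlonglongrightarrow> h x * g x"
        using limG by eventually_elim (intro tendsto_intros)
      show "AE x in lborel. norm (h x * G n x) \<le> h x * B" for n
        using h(2) G0 GB by (auto simp: abs_mult intro!: mult_left_mono)
    qed (use h in auto)
    have lim2: "(\<lambda>n. \<integral>x. G n x powr r' \<partial>lborel) \<longlonglongrightarrow> (LBINT x. g x powr r')"
    proof (rule integral_dominated_convergence[where w="\<lambda>x. B powr r' * indicator (cball 0 (\<rho> + 1)) x"])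
      show "AE x in lborel. (\<lambda>n. G n x powr r') \<longlonglongrightarrow> g x powr r'"
        using limG by eventually_elim (intro tendsto_powr' tendsto_const, use G0 r'1 in auto)
    qed (use Gp int_ball in auto)
    have "(\<lambda>n. K * (LBINT x. G n x powr r') powr (1 / r')) \<longlonglongrightarrow> K * (LBINT x. g x powr r') powr (1 / r')"
      by (intro tendsto_mult tendsto_const tendsto_powr' lim2) (use r'1 in auto)
    from LIMSEQ_le[OF lim1 this] show ?thesis using le by auto
  qed
  define H where "H m x = min (h x) (real m) * indicator (cball 0 (real m)) x" for m x
  have [measurable]: "H m \<in> borel_measurable borel" for m unfolding H_def by measurable
  have H0: "0 \<le> H m x" and Hm: "H m x \<le> real m" and Hh: "H m x \<le> h x" for m x
    using h(2)[of x] by (auto simp: H_def indicator_def)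
  have Hs: "H m x = 0" if "real m < norm x" for m x using that by (simp add: H_def)
  have step: "(\<integral>\<^sup>+x. ennreal (H m x powr r) \<partial>lborel) \<le> ennreal (K powr r)" for m
  proof -
    have Hp: "H m x powr r \<le> real m powr r * indicator (cball 0 (real m)) x" for x
    proof (cases "norm x \<le> real m")
      case True
      then show ?thesis using Hm[of m x] H0[of m x] r by (auto intro!: powr_mono2)
    qed (simp add: Hs)
    have int: "integrable lborel (\<lambda>x. H m x powr r)"
      by (rule Bochner_Integration.integrable_bound[OF int_ball[of "real m powr r" "real m"]]) (use Hp in \<open>auto simp: abs_mult\<close>)
    define a where "a = (LBINT x. H m x powr r)"
    have a0: "0 \<le> a" by (simp add: a_def)
    \<comment> \<open>Only one of the r factors of \<open>H m\<close> is replaced by h. The other r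
      - 1 form the test function, and its power r' is \<open>H m x powr r\<close> again.\<close>
    have "a \<le> (LBINT x. h x * H m x powr (r - 1))"
      unfolding a_def
    proof (rule integral_mono[OF int])
      show "integrable lborel (\<lambda>x. h x * H m x powr (r - 1))"
      proof (rule Bochner_Integration.integrable_bound[where f="\<lambda>x. h x * real m powr (r - 1)"])
        show "AE x in lborel. norm (h x * H m x powr (r - 1)) \<le> norm (h x * real m powr (r - 1))"
          using h(2) H0 Hm r by (auto simp: abs_mult intro!: mult_left_mono powr_mono2)
      qed (use h in auto)
      show "H m x powr r \<le> h x * H m x powr (r - 1)" for x
      proof -
        have "H m x powr r = H m x * H m x powr (r - 1)"
          using H0[of m x] r by (cases "H m x = 0") (auto simp: powr_diff)
        then show ?thesis using Hh[of m x] by (simp add: mult_right_mono)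
      qed
    qed
    also have "\<dots> \<le> K * (LBINT x. (H m x powr (r - 1)) powr r') powr (1 / r')"
      by (rule dual'[where B="real m powr (r - 1)" and \<rho>="real m"]) (use H0 Hm Hs r in \<open>auto intro!: powr_mono2\<close>)
    also have "(LBINT x. (H m x powr (r - 1)) powr r') = a"
      unfolding a_def powr_powr r'1(2) ..
    finally have le: "a \<le> K * a powr (1 / r')" .
    \<comment> \<open>Truncation made \<open>a\<close> finite, so \<open>a powr (1 / r')\<close> can
      be divided out and a^(1/r) \<le> K remains.\<close>
    have "a \<le> K powr r"
    proof (cases "a = 0")
      case False
      then have "0 < a" using a0 by simp
      have "a = a powr (1 / r') * a powr (1 / r)"
        using \<open>0 < a\<close> r'1(3)[symmetric] by (simp add: powr_add[symmetric])
      then have "a powr (1 / r') * a powr (1 / r) \<le> a powr (1 / r') * K" using le by (simp add: mult.commute)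
      then have "a powr (1 / r) \<le> K" using \<open>0 < a\<close> by (simp add: mult_le_cancel_left_pos)
      then have "(a powr (1 / r)) powr r \<le> K powr r" using r by (intro powr_mono2) auto
      then show ?thesis using \<open>0 < a\<close> r by (simp add: powr_powr)
    qed simp
    then show ?thesis
      using int by (subst nn_integral_eq_integral) (auto simp: a_def)
  qed
  have "(\<lambda>m. ennreal (H m x powr r)) \<longlonglongrightarrow> ennreal (h x powr r)" for x
  proof (rule tendsto_eventually)
    obtain m0 where m0: "max (h x) (norm x) \<le> real m0" using real_arch_simple by blast
    then have "\<forall>m\<ge>m0. H m x = h x" by (auto simp: H_def)
    then show "\<forall>\<^sub>F m in sequentially. ennreal (H m x powr r) = ennreal (h x powr r)"
      unfolding eventually_sequentially by (metis (no_types))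
  qed
  then have "(\<integral>\<^sup>+x. ennreal (h x powr r) \<partial>lborel) = (\<integral>\<^sup>+x. liminf (\<lambda>m. ennreal (H m x powr r)) \<partial>lborel)"
    by (intro nn_integral_cong lim_imp_Liminf[symmetric]) auto
  also have "\<dots> \<le> liminf (\<lambda>m. \<integral>\<^sup>+x. ennreal (H m x powr r) \<partial>lborel)"
    by (rule nn_integral_liminf) measurable
  also have "\<dots> \<le> ennreal (K powr r)"
    by (rule order_trans[OF Liminf_le_Limsup Limsup_bounded[OF always_eventually]]) (use step in auto)
  finally show ?thesis .
qed

section \<open>Convolutions of densities\<close>

lemma young_const_powr_eq:
  assumes p: "1 < p"
  shows "sqrt p powr (1 / (p - 1) - 1) * sqrt (p - 1) = young_const p powr (p / (p - 1))"
proof -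
  define q where "q = p / (p - 1)"
  have q: "0 < q" "q / p - 1 = 1 / (p - 1) - 1" using p by (auto simp: q_def)
  have lnq: "ln q = ln p - ln (p - 1)" unfolding q_def using p by (simp add: ln_div)
  have pos: "0 < young_const p" using p by (intro young_const_pos) auto
  have "ln (young_const p) = (ln p / p - ln q / q) / 2"
    unfolding young_const_def conj_exp_def q_def[symmetric] using p q by (simp add: ln_sqrt ln_div ln_powr)
  then have "ln (young_const p powr q) = ((q / p - 1) * ln p + ln (p - 1)) / 2"
    using pos q(1) p unfolding lnq by (simp add: ln_powr field_simps)
  also have "\<dots> = ln (sqrt p powr (1 / (p - 1) - 1) * sqrt (p - 1))"
    unfolding q(2) using p by (simp add: ln_mult ln_powr ln_sqrt field_simps)
  finally show ?thesis
    using p pos by (subst (asm) ln_inj_iff) (auto simp: q_def)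
qed

lemma young_const_conj:
  assumes "1 < r"
  shows "young_const (r / (r - 1)) = 1 / young_const r"
proof -
  have "conj_exp (r / (r - 1)) = r" using assms by (simp add: conj_exp_def field_simps)
  then show ?thesis
    unfolding young_const_def using assms by (simp add: conj_exp_def real_sqrt_divide)
qed

text \<open>The factor (2 pi)^n is kept outside the power: in Hoelder's inequality it enters every
  factor with weights summing to 1 and is recovered exactly once.\<close>

lemma hausdorff_young_young_const:
  fixes f :: "'a::euclidean_space \<Rightarrow> real"
  assumes p: "1 < p" "p \<le> 2" and f: "integrable lborel f" "\<And>x. 0 \<le> f x"
    and D: "0 \<le> D" "(\<integral>\<^sup>+x. ennreal (f x powr p) \<partial>lborel) \<le> ennreal D"
  shows "(\<integral>\<^sup>+\<xi>. ennreal (norm (fourier f \<xi>) powr (p / (p - 1))) \<partial>lborel)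
    \<le> ennreal ((2 * pi) ^ DIM('a) * (young_const p ^ DIM('a) * D powr (1 / p)) powr (p / (p - 1)))"
proof -
  have pos: "0 < young_const p" using p by (intro young_const_pos) auto
  have pw: "(x ^ DIM('a)) powr t = (x powr t) ^ DIM('a)" if "0 < x" for x t :: real
    using that by (simp add: powr_realpow[symmetric] powr_powr mult.commute)
  have "(sqrt p ^ DIM('a)) powr (1 / (p - 1) - 1) * sqrt (p - 1) ^ DIM('a) = (young_const p ^ DIM('a)) powr (p / (p - 1))"
    using p pos by (simp add: pw young_const_powr_eq[symmetric] power_mult_distrib)
  moreover have "(D powr (1 / p)) powr (p / (p - 1)) = D powr (1 / (p - 1))"
    using p by (simp add: powr_powr)
  ultimately have eq: "((2 * pi) ^ DIM('a) * (sqrt p ^ DIM('a)) powr (1 / (p - 1) - 1) * D powr (1 / (p - 1))) * sqrt (p - 1) ^ DIM('a)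
    = (2 * pi) ^ DIM('a) * (young_const p ^ DIM('a) * D powr (1 / p)) powr (p / (p - 1))"
    using pos by (simp add: powr_mult ac_simps)
  show ?thesis using hausdorff_young[OF p f D] unfolding eq .
qed

text \<open>Since r \<ge> 2, the conjugate exponent s = r' lies in (1, 2], and Hausdorff-Young
  bounds the transform of a test function g in L^r. Hoelder against the transform of h gives c K L
  with c = (2 pi)^n, and Parseval cancels the c.\<close>

lemma Lp_bound_of_fourier_bound:
  fixes h :: "'a::euclidean_space \<Rightarrow> real"
  assumes h: "integrable lborel h" "\<And>x. 0 \<le> h x" and r: "2 \<le> r" and K: "0 \<le> K"
    and bound: "(\<integral>\<^sup>+\<xi>. ennreal (norm (fourier h \<xi>) powr (r / (r - 1))) \<partial>lborel) \<le> ennreal ((2 * pi) ^ DIM('a) * K powr (r / (r - 1)))"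
  shows "(\<integral>\<^sup>+x. ennreal (h x powr r) \<partial>lborel) \<le> ennreal ((1 / young_const r ^ DIM('a) * K) powr r)"
proof (rule Lp_bound_by_duality[OF h, where r'="r / (r - 1)"])
  have yc: "0 < young_const r" using r by (intro young_const_pos) auto
  then show "0 \<le> 1 / young_const r ^ DIM('a) * K" using K by simp
  fix g :: "'a \<Rightarrow> real" and B R D :: real
  assume g: "continuous_on UNIV g" "\<And>x. 0 \<le> g x" "\<And>x. g x \<le> B" "\<And>x. R < norm x \<Longrightarrow> g x = 0" "integrable lborel g"
    and D: "0 \<le> D" "(\<integral>\<^sup>+x. ennreal (g x powr (r / (r - 1))) \<partial>lborel) \<le> ennreal D"
  have [measurable]: "h \<in> borel_measurable borel" "g \<in> borel_measurable borel"
    using borel_measurable_integrable[OF h(1)] borel_measurable_integrable[OF g(5)] by simp_all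
  define s where "s = r / (r - 1)"
  have s: "1 < s" "s \<le> 2" "s / (s - 1) = r" "1 / s + 1 / r = 1" using r by (auto simp: s_def field_simps)
  define c where "c = (2 * pi) ^ DIM('a)"
  have c: "0 < c" by (simp add: c_def)
  define L where "L = young_const s ^ DIM('a) * D powr (1 / s)"
  have ys: "young_const s = 1 / young_const r" unfolding s_def using r by (intro young_const_conj) auto
  have L: "0 \<le> L" unfolding L_def ys using yc by simp
  have HY: "(\<integral>\<^sup>+\<xi>. ennreal (norm (fourier g \<xi>) powr r) \<partial>lborel) \<le> ennreal (c * L powr r)"
    using hausdorff_young_young_const[OF s(1,2) g(5,2) D(1) D(2)[folded s_def]] unfolding s(3) L_def c_def .
  have "(\<integral>\<^sup>+\<xi>. ennreal ((norm (fourier h \<xi>) powr s) powr (1 / s) * (norm (fourier g \<xi>) powr r) powr (1 / r)) \<partial>lborel)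
    \<le> ennreal ((c * K powr s) powr (1 / s) * (c * L powr r) powr (1 / r))"
    using s r c HY bound by (intro nn_integral_Holder2) (auto simp: c_def s_def)
  also have "(c * K powr s) powr (1 / s) * (c * L powr r) powr (1 / r) = (c powr (1 / s) * c powr (1 / r)) * (K * L)"
    using s r c K L by (simp add: powr_mult powr_powr)
  also have "c powr (1 / s) * c powr (1 / r) = c"
    using c by (simp add: powr_add[symmetric] s(4))
  finally have "(\<integral>\<^sup>+\<xi>. ennreal (norm (fourier h \<xi>) * norm (fourier g \<xi>)) \<partial>lborel) \<le> ennreal (c * (K * L))"
    using s r by (simp add: powr_powr)
  then have "c * (LBINT x. h x * g x) \<le> c * (K * L)"
    unfolding c_def by (rule integral_mult_le_of_fourier_bound[OF h g(5,2,1,3)]) (use K L in auto)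
  then have "(LBINT x. h x * g x) \<le> K * L" using c by simp
  then show "(LBINT x. h x * g x) \<le> 1 / young_const r ^ DIM('a) * K * D powr (1 / (r / (r - 1)))"
    unfolding L_def ys by (simp add: s_def power_one_over)
qed (use r in auto)

text \<open>The Fubini arguments run over products of Borel measures, whereas
  \<open>prob_density\<close> asks only for Lebesgue measurability. Each density is therefore
  exchanged for a Borel function equal to it almost everywhere.\<close>

definition borel_density :: "('a::euclidean_space \<Rightarrow> real) \<Rightarrow> bool"
  where "borel_density F \<longleftrightarrow> F \<in> borel_measurable borel \<and> (\<forall>x. 0 \<le> F x) \<and> integrable lborel F \<and> (LBINT x. F x) = 1"

lemma borel_densityI:
  assumes [measurable]: "F \<in> borel_measurable borel" and "\<And>x. 0 \<le> F x" "(\<integral>\<^sup>+x. ennreal (F x) \<partial>lborel) = 1"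
  shows "borel_density F"
proof -
  have "integrable lborel F"
    using assms by (intro integrableI_nonneg) auto
  moreover have "(LBINT x. F x) = 1"
    using assms by (subst integral_eq_nn_integral) auto
  ultimately show ?thesis using assms by (simp add: borel_density_def)
qed

lemma prob_density_borel_version:
  assumes f: "prob_density f"
  shows "\<exists>F. borel_density F \<and> (AE x in lborel. f x = F x)"
proof -
  have "f \<in> borel_measurable (completion lborel)" using f by (simp add: prob_density_def)
  from completion_ex_borel_measurable_real[OF this]
  obtain g where [measurable]: "g \<in> borel_measurable lborel" and g: "AE x in lborel. f x = g x"
    by auto
  define F where "F x = max 0 (g x)" for x
  have [measurable]: "F \<in> borel_measurable borel" unfolding F_def[abs_def] by measurable
  have AE: "AE x in lborel. f x = F x"
    using g
  proof eventually_elim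
    case (elim x)
    moreover have "0 \<le> f x" using f by (simp add: prob_density_def)
    ultimately show ?case by (simp add: F_def)
  qed
  have "(\<integral>\<^sup>+x. ennreal (F x) \<partial>lborel) = (\<integral>\<^sup>+x. ennreal (f x) \<partial>lborel)"
    using AE by (intro nn_integral_cong_AE) auto
  also have "\<dots> = 1" using f by (simp add: prob_density_def nn_integral_completion)
  finally have "borel_density F" by (intro borel_densityI) (auto simp: F_def)
  with AE show ?thesis by blast
qed

lemma AE_lborel_minus:
  assumes "AE y in lborel. P y"
  shows "AE y in lborel. P (x - y :: 'a::euclidean_space)"
proof -
  obtain N where N: "{y \<in> space lborel. \<not> P y} \<subseteq> N" "emeasure lborel N = 0" "N \<in> sets lborel"
    using AE_E[OF assms] by blast
  have [measurable]: "N \<in> sets borel" using N(3) by simp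
  have "(\<integral>\<^sup>+y. indicator N (x - y) \<partial>lborel) = (\<integral>\<^sup>+y. indicator N y \<partial>lborel)"
    by (rule nn_integral_lborel_minus) measurable
  also have "\<dots> = 0" using N(2) by simp
  finally have "AE y in lborel. (indicator N (x - y) :: ennreal) = 0"
    by (subst (asm) nn_integral_0_iff_AE) auto
  then show ?thesis
    by eventually_elim (use N(1) in \<open>auto simp: indicator_eq_0_iff\<close>)
qed

text \<open>The Borel version, total mass 1 and multiplicativity of the transform are proved
  together, since iterating the convolution needs all of them. Finiteness of the convolution almost
  everywhere follows from its total mass.\<close>

lemma conv_borel_density:
  fixes F h :: "'a::euclidean_space \<Rightarrow> real"
  assumes F: "borel_density F" and h: "borel_density h"
    and f: "AE x in lborel. f x = ennreal (F x)" and c: "AE x in lborel. c x = ennreal (h x)"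
  shows "\<exists>k. borel_density k \<and> (AE x in lborel. conv f c x = ennreal (k x))
    \<and> (\<forall>\<xi>. fourier k \<xi> = fourier F \<xi> * fourier h \<xi>)"
proof -
  have [measurable]: "F \<in> borel_measurable borel" "h \<in> borel_measurable borel"
    and F0: "\<And>x. 0 \<le> F x" and h0: "\<And>x. 0 \<le> h x"
    and intF: "integrable lborel F" and inth: "integrable lborel h"
    and F1: "(LBINT x. F x) = 1" and h1: "(LBINT x. h x) = 1"
    using F h by (auto simp: borel_density_def)
  define C where "C x = (\<integral>\<^sup>+y. ennreal (F (x - y) * h y) \<partial>lborel)" for x
  have [measurable]: "C \<in> borel_measurable borel" unfolding C_def[abs_def] by measurable
  \<comment> \<open>This holds at every x: altering \<open>f\<close> and \<open>c\<close> on null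
    sets does not affect the integral in y, null sets being preserved by y -> x - y.\<close>
  have conv: "conv f c x = C x" for x
  proof -
    have "conv f c x = (\<integral>\<^sup>+y. f (x - y) * c y \<partial>lborel)"
      by (simp add: conv_def nn_integral_completion)
    also have "\<dots> = C x"
      unfolding C_def
    proof (rule nn_integral_cong_AE)
      show "AE y in lborel. f (x - y) * c y = ennreal (F (x - y) * h y)"
        using AE_lborel_minus[OF f, of x] c
        by eventually_elim (use F0 h0 in \<open>simp add: ennreal_mult\<close>)
    qed
    finally show ?thesis .
  qed
  have nnF: "(\<integral>\<^sup>+x. ennreal (F (x - y)) \<partial>lborel) = 1" for y
  proof -
    have "(\<integral>\<^sup>+x. ennreal (F (x - y)) \<partial>lborel) = (\<integral>\<^sup>+x. ennreal (F x) \<partial>lborel)"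
      using nn_integral_lborel_affine[of "\<lambda>x. ennreal (F x)" 1 "- y"] by simp
    then show ?thesis using intF F0 F1 by (simp add: nn_integral_eq_integral)
  qed
  have "(\<integral>\<^sup>+x. C x \<partial>lborel) = (\<integral>\<^sup>+y. (\<integral>\<^sup>+x. ennreal (F (x - y) * h y) \<partial>lborel) \<partial>lborel)"
    unfolding C_def by (rule lborel_pair.Fubini') measurable
  also have "\<dots> = (\<integral>\<^sup>+y. ennreal (h y) \<partial>lborel)"
    using F0 h0 by (simp add: ennreal_mult nn_integral_multc nnF)
  also have "\<dots> = 1" using inth h0 h1 by (simp add: nn_integral_eq_integral)
  finally have C1: "(\<integral>\<^sup>+x. C x \<partial>lborel) = 1" .
  define k where "k x = enn2real (C x)" for x
  have [measurable]: "k \<in> borel_measurable borel" unfolding k_def by measurable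
  have "AE x in lborel. C x \<noteq> \<infinity>"
    using C1 by (intro nn_integral_PInf_AE) auto
  then have Ck: "AE x in lborel. C x = ennreal (k x)"
    by eventually_elim (simp add: k_def less_top)
  have "(\<integral>\<^sup>+x. ennreal (k x) \<partial>lborel) = (\<integral>\<^sup>+x. C x \<partial>lborel)"
    using Ck by (intro nn_integral_cong_AE) auto
  then have k: "borel_density k" using C1 by (intro borel_densityI) (auto simp: k_def)
  have "fourier k \<xi> = fourier F \<xi> * fourier h \<xi>" for \<xi>
  proof -
    define \<Phi> where "\<Phi> y x = complex_of_real (F (x - y) * h y) * iexp (\<xi> \<bullet> x)" for y x
    have [measurable]: "\<Phi> y \<in> borel_measurable borel" for y unfolding \<Phi>_def[abs_def] by measurable
    have intF': "integrable lborel (\<lambda>x. F (x - y))" for y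
      using integrable_lborel_affine_iff[of F 1 "- y"] intF by simp
    have F1': "(LBINT x. F (x - y)) = 1" for y
      using integral_lborel_affine[of F 1 "- y"] F1 by simp
    have "integrable (lborel \<Otimes>\<^sub>M lborel) (\<lambda>(y, x). \<Phi> y x)"
    proof (rule lborel_pair.Fubini_integrable)
      show "(\<lambda>(y, x). \<Phi> y x) \<in> borel_measurable (lborel \<Otimes>\<^sub>M lborel)"
        unfolding \<Phi>_def by measurable
      have "(LBINT x. norm (case (y, x) of (y, x) \<Rightarrow> \<Phi> y x)) = h y" for y
        using F0 h0 by (simp add: \<Phi>_def norm_mult F1')
      then show "integrable lborel (\<lambda>y. \<integral>x. norm (case (y, x) of (y, x) \<Rightarrow> \<Phi> y x) \<partial>lborel)"
        using inth by simp
      show "AE y in lborel. integrable lborel (\<lambda>x. case (y, x) of (y, x) \<Rightarrow> \<Phi> y x)"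
      proof (rule AE_I2)
        fix y :: 'a
        have "integrable lborel (\<lambda>x. F (x - y) * h y)"
          by (intro integrable_mult_left intF')
        then show "integrable lborel (\<lambda>x. case (y, x) of (y, x) \<Rightarrow> \<Phi> y x)"
          unfolding prod.case by (rule Bochner_Integration.integrable_bound) (auto simp: \<Phi>_def norm_mult)
      qed
    qed
    from lborel_pair.Fubini_integral[OF this]
    have swap: "(LBINT x. (LBINT y. \<Phi> y x)) = (LBINT y. (LBINT x. \<Phi> y x))" by simp
    have "(LBINT x. \<Phi> y x) = fourier F \<xi> * (of_real (h y) * iexp (\<xi> \<bullet> y))" for y
    proof -
      have "(LBINT x. \<Phi> y x) = (LBINT x. \<Phi> y (y + 1 *\<^sub>R x))"
        by (subst integral_lborel_affine[of _ 1 y]) (auto simp: \<Phi>_def)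
      also have "\<dots> = (LBINT x. (of_real (h y) * iexp (\<xi> \<bullet> y)) * (of_real (F x) * iexp (\<xi> \<bullet> x)))"
        by (intro Bochner_Integration.integral_cong) (auto simp: \<Phi>_def inner_add_right exp_add distrib_left)
      finally show ?thesis unfolding integral_mult_right_zero fourier_def[symmetric] by (simp only: ac_simps)
    qed
    then have R: "(LBINT y. (LBINT x. \<Phi> y x)) = fourier F \<xi> * fourier h \<xi>"
      by (simp only: integral_mult_right_zero fourier_def[of h])
    have "fourier k \<xi> = (LBINT x. (LBINT y. \<Phi> y x))"
      unfolding fourier_def
    proof (rule integral_cong_AE)
      show "AE x in lborel. complex_of_real (k x) * iexp (\<xi> \<bullet> x) = (LBINT y. \<Phi> y x)"
        using Ck
      proof eventually_elim
        case (elim x)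
        have "k x = (LBINT y. F (x - y) * h y)"
          unfolding k_def C_def using F0 h0 by (subst integral_eq_nn_integral) auto
        moreover have "(LBINT y. \<Phi> y x) = of_real (LBINT y. F (x - y) * h y) * iexp (\<xi> \<bullet> x)"
          unfolding \<Phi>_def integral_mult_left_zero integral_complex_of_real ..
        ultimately show ?case by simp
      qed
      show "(\<lambda>x. \<integral>y. \<Phi> y x \<partial>lborel) \<in> borel_measurable lborel"
        unfolding \<Phi>_def by measurable
    qed measurable
    then show ?thesis unfolding swap R .
  qed
  then show ?thesis using k Ck unfolding conv by blast
qed

lemma conv_list_borel_density:
  assumes "js \<noteq> []" and F: "\<And>j. j \<in> set js \<Longrightarrow> borel_density (F j) \<and> (AE x in lborel. f j x = F j x)"
  shows "\<exists>k. borel_density k \<and> (AE x in lborel. conv_list (map (\<lambda>j x. ennreal (f j x)) js) x = ennreal (k x))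
    \<and> (\<forall>\<xi>. fourier k \<xi> = (\<Prod>j\<leftarrow>js. fourier (F j) \<xi>))"
  using assms
proof (induction js rule: induct_list012)
  case (2 j)
  then show ?case by (intro exI[of _ "F j"]) (auto elim: AE_mp)
next
  case (3 i j js)
  then obtain k where k: "borel_density k" "AE x in lborel. conv_list (map (\<lambda>j x. ennreal (f j x)) (j # js)) x = ennreal (k x)"
    "\<And>\<xi>. fourier k \<xi> = (\<Prod>j\<leftarrow>j # js. fourier (F j) \<xi>)"
    using "3.IH"(2) "3.prems"(2) by auto
  have "borel_density (F i)" "AE x in lborel. ennreal (f i x) = ennreal (F i x)"
    using "3.prems"(2)[of i] by (auto elim: AE_mp)
  from conv_borel_density[OF this(1) k(1) this(2) k(2)] show ?case
    by (simp add: k(3))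
qed auto

lemma conv_over_borel_density:
  assumes "finite s" "s \<noteq> {}" "\<And>j. j \<in> s \<Longrightarrow> borel_density (F j) \<and> (AE x in lborel. f j x = F j x)"
  shows "\<exists>k. borel_density k \<and> (AE x in lborel. conv_over s f x = ennreal (k x))
    \<and> (\<forall>\<xi>. fourier k \<xi> = (\<Prod>j\<in>s. fourier (F j) \<xi>))"
proof -
  have "(\<Prod>j\<leftarrow>sorted_list_of_set s. fourier (F j) \<xi>) = (\<Prod>j\<in>s. fourier (F j) \<xi>)" for \<xi>
    using assms(1) by (simp add: prod.distinct_set_conv_list[symmetric])
  then show ?thesis
    using conv_list_borel_density[of "sorted_list_of_set s" F f] assms by (simp add: conv_over_def)
qed

section \<open>Extended-valued norms and counting in the hypergraph\<close>

lemma ennpowr_eq_0_iff: "ennpowr x a = 0 \<longleftrightarrow> x = 0"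
  by (cases x) (auto simp: ennpowr_def ennreal_eq_0_iff)

lemma Lp_norm_eq:
  assumes "AE x in lborel. g x = ennreal (k x)" "\<And>x. 0 \<le> k x"
  shows "Lp_norm p g = ennpowr (\<integral>\<^sup>+x. ennreal (k x powr p) \<partial>lborel) (1 / p)"
proof -
  have "(\<integral>\<^sup>+x. ennpowr (g x) p \<partial>lebesgue) = (\<integral>\<^sup>+x. ennreal (k x powr p) \<partial>lborel)"
    unfolding nn_integral_completion
    by (rule nn_integral_cong_AE, use assms(1) in eventually_elim) (simp add: ennpowr_def assms(2))
  then show ?thesis by (simp add: Lp_norm_def)
qed

lemma nn_integral_powr_ne_0:
  assumes "borel_density k"
  shows "(\<integral>\<^sup>+x. ennreal (k x powr p) \<partial>lborel) \<noteq> 0"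
proof
  have [measurable]: "k \<in> borel_measurable borel" using assms by (simp add: borel_density_def)
  assume "(\<integral>\<^sup>+x. ennreal (k x powr p) \<partial>lborel) = 0"
  then have "AE x in lborel. ennreal (k x powr p) = 0" by (subst (asm) nn_integral_0_iff_AE) auto
  then have "AE x in lborel. k x = 0" by eventually_elim (simp add: ennreal_eq_0_iff)
  then have "(LBINT x. k x) = (\<integral>x. 0 \<partial>(lborel :: 'a measure))"
    by (intro integral_cong_AE) auto
  then show False using assms by (simp add: borel_density_def)
qed

text \<open>Nonvanishing of the factors matters because 0 * \<top> = 0 in
  \<open>ennreal\<close>.\<close>

lemma prod_ennreal_eq_top:
  fixes a :: "'i \<Rightarrow> ennreal"
  assumes "finite I" "i \<in> I" "a i = \<top>" "\<And>j. j \<in> I \<Longrightarrow> a j \<noteq> 0"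
  shows "(\<Prod>j\<in>I. a j) = \<top>"
proof -
  have "(\<Prod>j\<in>I - {i}. a j) \<noteq> 0" using assms by (simp add: prod_zero_iff)
  then show ?thesis using assms by (simp add: prod.remove[of I i] ennreal_top_mult)
qed

text \<open>Double counting: after exchanging the products, each index j is met once for every
  hyperedge containing it, that is d times.\<close>

lemma regular_hypergraph_prod_prod:
  fixes a :: "nat \<Rightarrow> 'b::comm_semiring_1"
  assumes G: "regular_hypergraph M d G"
  shows "(\<Prod>s\<in>G. \<Prod>j\<in>s. a j) = (\<Prod>j\<in>{1..M}. a j) ^ d"
proof -
  have sub: "s \<subseteq> {1..M}" if "s \<in> G" for s
    using G that by (auto simp: regular_hypergraph_def hypergraph_on_def)
  have fin: "finite G" by (rule finite_subset[of _ "Pow {1..M}"]) (use sub in blast, simp)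
  have "{j \<in> {1..M}. j \<in> s} = s" if "s \<in> G" for s using sub[OF that] by blast
  then have "(\<Prod>s\<in>G. \<Prod>j\<in>s. a j) = (\<Prod>s\<in>G. \<Prod>j\<in>{j \<in> {1..M}. j \<in> s}. a j)"
    by (intro prod.cong) (simp_all only:)
  also have "\<dots> = (\<Prod>j\<in>{1..M}. \<Prod>s\<in>{s \<in> G. j \<in> s}. a j)"
    using fin by (rule prod.swap_restrict) simp
  also have "\<dots> = (\<Prod>j\<in>{1..M}. a j ^ d)"
    using G by (intro prod.cong refl) (auto simp: regular_hypergraph_def)
  finally show ?thesis by (simp add: prod_power_distrib)
qed

theorem theorem2p6:
  fixes M d :: nat and G :: "nat set set"
    and p :: "nat set \<Rightarrow> real" and r :: real
    and f :: "nat \<Rightarrow> real ^ 'n \<Rightarrow> real"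
  assumes "2 \<le> M"
    and "1 \<le> d"
    and "regular_hypergraph M d G"
    and "\<And>s. s \<in> G \<Longrightarrow> 1 < p s"
    and "1 < r"
    and "(\<Sum>s\<in>G. 1 / p s) = real (card G) - real d / conj_exp r"
    and "2 \<le> r"
    and "\<And>s. s \<in> G \<Longrightarrow> p s \<in> {1..2}"
    and "\<And>j. j \<in> {1..M} \<Longrightarrow> prob_density (f j)"
  shows "Lp_norm r (conv_over {1..M} f)
    \<le> ennreal (1 / young_const r ^ CARD('n)) *
      (\<Prod>s\<in>G. ennpowr (ennreal (young_const (p s) ^ CARD('n)) * Lp_norm (p s) (conv_over s f))
                (1 / real d))"
proof -
  let ?T = "\<lambda>s. ennpowr (ennreal (young_const (p s) ^ CARD('n)) * Lp_norm (p s) (conv_over s f)) (1 / real d)"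
  have p: "1 < p s" "p s \<le> 2" if "s \<in> G" for s using assms(4,8) that by auto
  have sub: "s \<subseteq> {1..M}" "s \<noteq> {}" if "s \<in> G" for s
    using assms(3) that by (auto simp: regular_hypergraph_def hypergraph_on_def)
  have finG: "finite G" by (rule finite_subset[of _ "Pow {1..M}"]) (use sub in blast, simp)
  have yc: "0 < young_const (p s)" if "s \<in> G" for s using p[OF that] by (intro young_const_pos) auto
  have ycr: "0 < young_const r" using assms(5) by (intro young_const_pos) auto
  have d: "0 < real d" using assms(2) by simp
  have "\<forall>j\<in>{1..M}. \<exists>F. borel_density F \<and> (AE x in lborel. f j x = F x)"
    using assms(9) prob_density_borel_version by blast
  then obtain F where F: "\<And>j. j \<in> {1..M} \<Longrightarrow> borel_density (F j) \<and> (AE x in lborel. f j x = F j x)"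
    by metis
  let ?P = "\<lambda>s k. borel_density k \<and> (AE x in lborel. conv_over s f x = ennreal (k x))
      \<and> (\<forall>\<xi>. fourier k \<xi> = (\<Prod>j\<in>s. fourier (F j) \<xi>))"
  have ex: "\<exists>k. ?P s k" if "s \<subseteq> {1..M}" "s \<noteq> {}" for s
    using that F by (intro conv_over_borel_density) (auto intro: finite_subset)
  obtain h where h: "borel_density h" "AE x in lborel. conv_over {1..M} f x = ennreal (h x)"
      "\<And>\<xi>. fourier h \<xi> = (\<Prod>j\<in>{1..M}. fourier (F j) \<xi>)"
    using ex[of "{1..M}"] assms(1) by auto
  have "\<forall>s\<in>G. \<exists>k. ?P s k"
    using ex sub by blast
  then obtain k where k: "\<And>s. s \<in> G \<Longrightarrow> borel_density (k s)"
      "\<And>s. s \<in> G \<Longrightarrow> AE x in lborel. conv_over s f x = ennreal (k s x)"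
      "\<And>s \<xi>. s \<in> G \<Longrightarrow> fourier (k s) \<xi> = (\<Prod>j\<in>s. fourier (F j) \<xi>)"
    unfolding bchoice_iff by blast
  define I where "I s = (\<integral>\<^sup>+x. ennreal (k s x powr p s) \<partial>lborel)" for s
  have Lp: "Lp_norm (p s) (conv_over s f) = ennpowr (I s) (1 / p s)" if "s \<in> G" for s
    unfolding I_def using k that by (intro Lp_norm_eq) (auto simp: borel_density_def)
  have I0: "I s \<noteq> 0" if "s \<in> G" for s
    unfolding I_def using k(1)[OF that] by (rule nn_integral_powr_ne_0)
  \<comment> \<open>No density vanishes almost everywhere, so every factor on the right is positive,
    and one infinite norm makes the whole right side infinite.\<close>
  have ne0: "?T s \<noteq> 0" if s: "s \<in> G" for s
    using yc[OF s] I0[OF s] unfolding Lp[OF s] by (simp add: ennpowr_eq_0_iff ennreal_eq_0_iff not_le)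
  show ?thesis
  proof (cases "\<exists>s\<in>G. I s = \<top>")
    case True
    then obtain s where s: "s \<in> G" "I s = \<top>" by auto
    then have "?T s = \<top>"
      using yc[OF s(1)] by (simp add: Lp ennpowr_def ennreal_mult_top)
    then have "(\<Prod>s\<in>G. ?T s) = \<top>"
      by (rule prod_ennreal_eq_top[OF finG s(1)]) (rule ne0)
    then show ?thesis using ycr by (simp add: ennreal_mult_top)
  next
    case False
    define D where "D s = enn2real (I s)" for s
    have D: "0 \<le> D s" "I s = ennreal (D s)" if "s \<in> G" for s
      using False that by (auto simp: D_def less_top)
    define L where "L s = young_const (p s) ^ CARD('n) * D s powr (1 / p s)" for s
    have L: "0 \<le> L s" if "s \<in> G" for s using yc[OF that] by (simp add: L_def)
    define K where "K = (\<Prod>s\<in>G. L s powr (1 / real d))"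
    have K: "0 \<le> K" unfolding K_def by (intro prod_nonneg) auto
    have term_eq: "?T s
        = ennreal (L s powr (1 / real d))" if s: "s \<in> G" for s
      using L[OF s] yc[OF s] D[OF s] unfolding Lp[OF s]
      by (simp add: ennpowr_def ennreal_mult[symmetric] L_def)
    have rhs: "ennreal (1 / young_const r ^ CARD('n)) *
      (\<Prod>s\<in>G. ?T s)
      = ennreal (1 / young_const r ^ CARD('n) * K)"
      using ycr K by (simp add: term_eq prod_ennreal K_def[symmetric] ennreal_mult[symmetric] cong: prod.cong)
    define r' where "r' = r / (r - 1)"
    have r': "0 < r'" using assms(5) by (simp add: r'_def)
    define q where "q s = p s / (p s - 1)" for s
    have q: "0 < q s" "1 / q s = 1 - 1 / p s" if "s \<in> G" for s using p[OF that] by (auto simp: q_def field_simps)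
    \<comment> \<open>The Hoelder weights are chosen so that each transform of a convolution over s
      enters with the same power r' / d; together these make up the power r' of the transform of h.
      They sum to 1 because the scaling relation says that the sum of the 1 / q s is d / r'.\<close>
    define \<theta> where "\<theta> s = r' / (real d * q s)" for s
    have \<theta>: "0 < \<theta> s" "q s * \<theta> s = r' / real d" if "s \<in> G" for s
      using q[OF that] r' d by (auto simp: \<theta>_def)
    have "(\<Sum>s\<in>G. \<theta> s) = (r' / real d) * (\<Sum>s\<in>G. 1 - 1 / p s)"
      unfolding sum_distrib_left by (intro sum.cong) (auto simp: \<theta>_def q(2)[symmetric])
    also have "(\<Sum>s\<in>G. 1 - 1 / p s) = real d / r'"
      using assms(6) by (simp add: sum_subtractf r'_def conj_exp_def)
    finally have \<theta>1: "(\<Sum>s\<in>G. \<theta> s) = 1" using d r' by simp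
    have [measurable]: "k s \<in> borel_measurable borel" if "s \<in> G" for s using k(1)[OF that] by (simp add: borel_density_def)
    have four: "norm (fourier h \<xi>) powr r' = (\<Prod>s\<in>G. (norm (fourier (k s) \<xi>) powr q s) powr \<theta> s)" for \<xi>
    proof -
      have "(\<Prod>s\<in>G. norm (fourier (k s) \<xi>)) = norm (\<Prod>s\<in>G. \<Prod>j\<in>s. fourier (F j) \<xi>)"
        unfolding prod_norm[symmetric] by (intro prod.cong) (auto simp: k(3) prod_norm)
      also have "\<dots> = norm (fourier h \<xi>) ^ d"
        unfolding regular_hypergraph_prod_prod[OF assms(3)] h(3) by (rule norm_power)
      finally have e: "(\<Prod>s\<in>G. norm (fourier (k s) \<xi>)) = norm (fourier h \<xi>) ^ d" .
      have "(\<Prod>s\<in>G. (norm (fourier (k s) \<xi>) powr q s) powr \<theta> s) = (\<Prod>s\<in>G. norm (fourier (k s) \<xi>) powr (r' / real d))"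
        by (intro prod.cong) (auto simp: powr_powr \<theta>)
      also have "\<dots> = (\<Prod>s\<in>G. norm (fourier (k s) \<xi>)) powr (r' / real d)"
        by (rule prod_powr_distrib[symmetric])
      also have "\<dots> = norm (fourier h \<xi>) powr r'"
        unfolding e using d r' by (cases "fourier h \<xi> = 0") (auto simp: powr_realpow[symmetric] powr_powr power_0_left)
      finally show ?thesis ..
    qed
    define c where "c = (2 * pi) ^ CARD('n)"
    have c: "0 < c" by (simp add: c_def)
    have "(\<integral>\<^sup>+\<xi>. ennreal (norm (fourier h \<xi>) powr r') \<partial>lborel) \<le> ennreal (\<Prod>s\<in>G. (c * L s powr q s) powr \<theta> s)"
      unfolding four
    proof (rule nn_integral_Holder[OF finG \<theta>(1) \<theta>1])
      fix s assume s: "s \<in> G"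
      have "(\<integral>\<^sup>+x. ennreal (k s x powr p s) \<partial>lborel) \<le> ennreal (D s)"
        using D(2)[OF s] by (simp add: I_def)
      from hausdorff_young_young_const[OF p[OF s] _ _ D(1)[OF s] this] k(1)[OF s]
      show "(\<integral>\<^sup>+\<xi>. ennreal (norm (fourier (k s) \<xi>) powr q s) \<partial>lborel) \<le> ennreal (c * L s powr q s)"
        by (simp add: borel_density_def q_def L_def c_def)
    qed (use c in auto)
    \<comment> \<open>The powers of c add up to 1, which is the normalisation that
      \<open>Lp_bound_of_fourier_bound\<close> expects.\<close>
    also have "(\<Prod>s\<in>G. (c * L s powr q s) powr \<theta> s) = c * K powr r'"
    proof -
      have "(\<Prod>s\<in>G. (c * L s powr q s) powr \<theta> s) = (\<Prod>s\<in>G. c powr \<theta> s * (L s powr (1 / real d)) powr r')"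
        using c L by (intro prod.cong refl) (simp add: powr_mult powr_powr \<theta>)
      also have "\<dots> = c * K powr r'"
        unfolding prod.distrib K_def using c finG
        by (simp add: powr_sum[symmetric] \<theta>1 prod_powr_distrib)
      finally show ?thesis .
    qed
    finally have "(\<integral>\<^sup>+\<xi>. ennreal (norm (fourier h \<xi>) powr r') \<partial>lborel) \<le> ennreal (c * K powr r')" .
    then have "(\<integral>\<^sup>+x. ennreal (h x powr r) \<partial>lborel) \<le> ennreal ((1 / young_const r ^ CARD('n) * K) powr r)"
      using Lp_bound_of_fourier_bound[of h r K] h(1) assms(7) K
      by (simp add: borel_density_def c_def r'_def)
    then have "ennpowr (\<integral>\<^sup>+x. ennreal (h x powr r) \<partial>lborel) (1 / r) \<le> ennreal (1 / young_const r ^ CARD('n) * K)"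
    proof -
      define X where "X = (\<integral>\<^sup>+x. ennreal (h x powr r) \<partial>lborel)"
      define b where "b = 1 / young_const r ^ CARD('n) * K"
      have b: "0 \<le> b" using K ycr by (simp add: b_def)
      assume "(\<integral>\<^sup>+x. ennreal (h x powr r) \<partial>lborel) \<le> ennreal ((1 / young_const r ^ CARD('n) * K) powr r)"
      then have X: "X \<le> ennreal (b powr r)" by (simp add: X_def b_def)
      then have fin: "X \<noteq> \<top>" by (auto simp: top_unique)
      have "enn2real X \<le> b powr r" using X by (simp add: enn2real_leI)
      then have "enn2real X powr (1 / r) \<le> (b powr r) powr (1 / r)"
        using assms(5) by (intro powr_mono2) auto
      also have "\<dots> = b" using b assms(5) by (simp add: powr_powr)
      finally show ?thesis
        unfolding X_def[symmetric] b_def[symmetric] using fin by (simp add: ennpowr_def ennreal_leI)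
    qed
    moreover have "Lp_norm r (conv_over {1..M} f) = ennpowr (\<integral>\<^sup>+x. ennreal (h x powr r) \<partial>lborel) (1 / r)"
      using h by (intro Lp_norm_eq) (auto simp: borel_density_def)
    ultimately show ?thesis unfolding rhs by simp
  qed
qed

end
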